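(* Let $X\subseteq\mathbb{P}^n$ be a subscheme. For any non-negative integer $j$, the sequence $(AV_{X,j}(m))_{m\ge 1}$ shifted to the left by $1$, i.e. the sequence $d\mapsto AV_{X,j}(d+1)$, $d\ge 0$, is an $O$-sequence. In particular, setting $J:=\operatorname{gin}(I_X):x_0^{j+1}$, this shifted sequence coincides with the Hilbert function of $R/J$, i.e. $$AV_{X,j}(d+1)=h_{R/J}(d)\qquad\text{for all } d\ge 0.$$
   Context: $K$ is an infinite field and $R=K[x_0,\dots,x_n]$ is the standard graded polynomial ring, with the lexicographic monomial order satisfying $x_0>x_1>\cdots>x_n$. For a homogeneous ideal $I$, $\operatorname{gin}(I)$ is the generic initial ideal of $I$ with respect to this order (the initial ideal of $g\cdot I$ for a general linear change of variables $g$). $[\,\cdot\,]_t$ is the degree $t$ component, and $h_{R/J}(t)=\dim_K[R/J]_t$. For a closed subscheme $X\subseteq\mathbb{P}^n$, $I_X\subseteq R$ is its saturated homogeneous ideal. Let $P\in\mathbb{P}^n$ be a general point (i.e. in a suitable nonempty Zariski open subset) with ideal $I_P$. Set $\operatorname{adim}(X,t,m)=\dim[I_X\cap I_P^m]_t$ and $\operatorname{vdim}(X,t,m)=\dim[I_X]_t-\binom{m+n-1}{n}$. For $j\ge0$ and $m\ge1$, $AV_{X,j}(m)=\operatorname{adim}(X,m+j,m)-\operatorname{vdim}(X,m+j,m)$. $O$-sequence: for $d\ge1$, each integer $a\ge 1$ has a unique expansion $a=\binom{k_d}{d}+\binom{k_{d-1}}{d-1}+\cdots+\binom{k_i}{i}$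 with $k_d>k_{d-1}>\cdots>k_i\ge i\ge1$; put $a^{\langle d\rangle}=\binom{k_d+1}{d+1}+\cdots+\binom{k_i+1}{i+1}$ and $0^{\langle d\rangle}=0$. A sequence $h(0),h(1),\dots$ of non-negative integers is an $O$-sequence if $h(0)=1$ and $h(d+1)\le h(d)^{\langle d\rangle}$ for all $d\ge1$ (equivalently, it is the Hilbert function of a standard graded $K$-algebra). The identically zero sequence (Hilbert function of the zero ring, occurring when $J=R$) is also allowed as an $O$-sequence. *)

theory Defs
  imports "HOL-Analysis.Determinants" "HOL-Library.Poly_Mapping"
begin

section \<open>Polynomials\<close>

text \<open>
  The ring \<open>K[x\<^sub>0,\<dots>,x\<^sub>n]\<close> is the type \<open>('v, 'k) mpoly\<close> for a finite linearly
  ordered index type \<open>'v\<close> with \<open>n + 1\<close> elements; the \<open>i\<close>-th smallest index stands for the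
  variable \<open>x\<^sub>i\<close>.  In particular \<open>x\<^sub>0\<close> belongs to \<open>Min UNIV\<close>.
\<close>

type_synonym ('v, 'k) mpoly = "('v \<Rightarrow>\<^sub>0 nat) \<Rightarrow>\<^sub>0 'k"

definition proj_dim :: "'v::finite itself \<Rightarrow> nat" where
  "proj_dim _ = CARD('v) - 1"

definition mpoly_const :: "'k::field \<Rightarrow> ('v, 'k) mpoly" where
  "mpoly_const c = Poly_Mapping.single 0 c"

definition mpoly_var :: "'v \<Rightarrow> ('v, 'k::field) mpoly" where
  "mpoly_var v = Poly_Mapping.single (Poly_Mapping.single v 1) 1"

definition mpoly_scale :: "'k::field \<Rightarrow> ('v, 'k) mpoly \<Rightarrow> ('v, 'k) mpoly" where
  "mpoly_scale c p = mpoly_const c * p"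

global_interpretation mpoly_vs: vector_space "mpoly_scale :: 'k::field \<Rightarrow> ('v, 'k) mpoly \<Rightarrow> _"
  by unfold_locales
    (simp_all add: mpoly_scale_def mpoly_const_def algebra_simps single_add mult_single
      flip: mult.assoc)

text \<open>The ring as a module over itself: \<open>mpoly_id.subspace\<close> is ``ideal'' and
  \<open>mpoly_id.span\<close> is ``ideal generated by''.\<close>

global_interpretation mpoly_id: module "(*) :: ('v, 'k::field) mpoly \<Rightarrow> ('v, 'k) mpoly \<Rightarrow> _"
  by unfold_locales (simp_all add: algebra_simps)

definition mpoly_subst :: "('v \<Rightarrow> ('w, 'k::field) mpoly) \<Rightarrow> ('v, 'k) mpoly \<Rightarrow> ('w, 'k) mpoly" where
  "mpoly_subst \<sigma> p = (\<Sum>m\<in>Poly_Mapping.keys p. mpoly_const (Poly_Mapping.lookup p m) *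
     (\<Prod>v\<in>Poly_Mapping.keys m. \<sigma> v ^ Poly_Mapping.lookup m v))"

definition mpoly_eval :: "('v \<Rightarrow> 'k::field) \<Rightarrow> ('v, 'k) mpoly \<Rightarrow> 'k" where
  "mpoly_eval a p = (\<Sum>m\<in>Poly_Mapping.keys p. Poly_Mapping.lookup p m *
     (\<Prod>v\<in>Poly_Mapping.keys m. a v ^ Poly_Mapping.lookup m v))"

definition mdeg :: "('v \<Rightarrow>\<^sub>0 nat) \<Rightarrow> nat" where
  "mdeg m = (\<Sum>v\<in>Poly_Mapping.keys m. Poly_Mapping.lookup m v)"

definition forms :: "nat \<Rightarrow> ('v, 'k::field) mpoly set" where
  "forms t = {p. \<forall>m\<in>Poly_Mapping.keys p. mdeg m = t}"

text \<open>The ideal product and power are those of the ring, so \<open>ideal_power I 0\<close> is the unit ideal.\<close>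

definition ideal_prod ::
    "('v, 'k::field) mpoly set \<Rightarrow> ('v, 'k) mpoly set \<Rightarrow> ('v, 'k) mpoly set" where
  "ideal_prod I J = mpoly_id.span {f * g |f g. f \<in> I \<and> g \<in> J}"

primrec ideal_power :: "('v, 'k::field) mpoly set \<Rightarrow> nat \<Rightarrow> ('v, 'k) mpoly set" where
  "ideal_power I 0 = UNIV"
| "ideal_power I (Suc m) = ideal_prod I (ideal_power I m)"

definition ideal_colon :: "('v, 'k::field) mpoly set \<Rightarrow> ('v, 'k) mpoly \<Rightarrow> ('v, 'k) mpoly set" where
  "ideal_colon I f = {g. g * f \<in> I}"

text \<open>
  The dimension of \<open>V / W\<close> for subspaces \<open>W \<subseteq> V\<close>: the cardinality of a finite set \<open>B\<close> of
  representatives of a basis.  Independence of \<open>B\<close> together with \<open>span B \<inter> W = {0}\<close> says that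
  the elements of \<open>B\<close> are linearly independent modulo \<open>W\<close>.
\<close>

definition quotient_dim :: "('v, 'k::field) mpoly set \<Rightarrow> ('v, 'k) mpoly set \<Rightarrow> nat" where
  "quotient_dim V W = (THE k. \<exists>B. finite B \<and> card B = k \<and> B \<subseteq> V \<and>
     mpoly_vs.independent B \<and> mpoly_vs.span B \<inter> W = {0} \<and>
     V = {b + w |b w. b \<in> mpoly_vs.span B \<and> w \<in> W})"

text \<open>\<open>hilbert_fun J t\<close> is the dimension of the degree \<open>t\<close> component of \<open>R/J\<close>, for homogeneous \<open>J\<close>.\<close>

definition hilbert_fun :: "('v, 'k::field) mpoly set \<Rightarrow> nat \<Rightarrow> nat" where
  "hilbert_fun J t = quotient_dim (forms t) (J \<inter> forms t)"


section \<open>Closed subschemes of projective space\<close>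

text \<open>
  The chart \<open>D\<^sub>+(x\<^sub>i)\<close> has coordinate ring \<open>K[x\<^sub>u/x\<^sub>i : u \<noteq> i]\<close>, realised as the polynomials not
  involving \<open>x\<^sub>i\<close>; for a form \<open>f\<close> of degree \<open>t\<close>, \<open>dehom i f\<close> is then \<open>f / x\<^sub>i\<^sup>t\<close>.
\<close>

definition chart_ring :: "'v \<Rightarrow> ('v, 'k::field) mpoly set" where
  "chart_ring i = {p. \<forall>m\<in>Poly_Mapping.keys p. Poly_Mapping.lookup m i = 0}"

definition dehom :: "'v \<Rightarrow> ('v, 'k::field) mpoly \<Rightarrow> ('v, 'k) mpoly" where
  "dehom i = mpoly_subst (\<lambda>u. if u = i then 1 else mpoly_var u)"

definition chart_ideal :: "'v \<Rightarrow> ('v, 'k::field) mpoly set \<Rightarrow> bool" where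
  "chart_ideal i A \<longleftrightarrow> A \<subseteq> chart_ring i \<and> 0 \<in> A \<and> (\<forall>f\<in>A. \<forall>g\<in>A. f + g \<in> A) \<and>
     (\<forall>r\<in>chart_ring i. \<forall>f\<in>A. r * f \<in> A)"

text \<open>
  A closed subscheme is a quasi-coherent sheaf of ideals, that is, an ideal \<open>X i\<close> of each chart
  ring such that \<open>X i\<close> and \<open>X j\<close> generate the same ideal on \<open>D\<^sub>+(x\<^sub>i) \<inter> D\<^sub>+(x\<^sub>j)\<close>.  In the latter
  condition, \<open>f / x\<^sub>i\<^sup>t\<close> lies in the localisation of \<open>X j\<close> at \<open>x\<^sub>i / x\<^sub>j\<close> iff
  \<open>(x\<^sub>i / x\<^sub>j)\<^sup>k (f / x\<^sub>j\<^sup>t)\<close> lies in \<open>X j\<close> for some \<open>k\<close>.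
\<close>

definition closed_subscheme :: "('v \<Rightarrow> ('v, 'k::field) mpoly set) \<Rightarrow> bool" where
  "closed_subscheme X \<longleftrightarrow> (\<forall>i. chart_ideal i (X i)) \<and>
     (\<forall>i j t. \<forall>f\<in>forms t. dehom i f \<in> X i \<longrightarrow> (\<exists>k. dehom j (mpoly_var i ^ k * f) \<in> X j))"

text \<open>The saturated homogeneous ideal \<open>I\<^sub>X\<close>: it is generated by the forms that vanish on \<open>X\<close>,
  i.e. by the global sections of the twists of the ideal sheaf.\<close>

definition subscheme_ideal :: "('v \<Rightarrow> ('v, 'k::field) mpoly set) \<Rightarrow> ('v, 'k) mpoly set" where
  "subscheme_ideal X = mpoly_id.span {f. (\<exists>t. f \<in> forms t) \<and> (\<forall>i. dehom i f \<in> X i)}"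


section \<open>Generic initial ideals\<close>

text \<open>
  The order on \<open>'v \<Rightarrow>\<^sub>0 nat\<close> from the library compares exponents at the smallest index where they
  differ, so it is the lexicographic order with \<open>x\<^sub>0 > x\<^sub>1 > \<dots> > x\<^sub>n\<close>.
\<close>

definition initial_monom :: "('v::linorder, 'k::field) mpoly \<Rightarrow> ('v, 'k) mpoly" where
  "initial_monom f = Poly_Mapping.single (Max (Poly_Mapping.keys f)) 1"

definition initial_ideal :: "('v::linorder, 'k::field) mpoly set \<Rightarrow> ('v, 'k) mpoly set" where
  "initial_ideal I = mpoly_id.span {initial_monom f |f. f \<in> I \<and> f \<noteq> 0}"

definition lin_change :: "'k::field ^ 'v ^ 'v \<Rightarrow> ('v::finite, 'k) mpoly \<Rightarrow> ('v, 'k) mpoly" where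
  "lin_change g = mpoly_subst (\<lambda>j. \<Sum>i\<in>UNIV. mpoly_const (g $ i $ j) * mpoly_var i)"

text \<open>Zariski open subsets of the general linear group; the polynomials in \<open>S\<close> have the matrix
  entries as variables.\<close>

definition GL_open :: "('k::field ^ 'v ^ 'v::finite) set \<Rightarrow> bool" where
  "GL_open U \<longleftrightarrow> (\<exists>S :: ('v \<times> 'v, 'k) mpoly set.
     U = {g. invertible g \<and> (\<exists>F\<in>S. mpoly_eval (\<lambda>(i, j). g $ i $ j) F \<noteq> 0)})"

definition gin :: "('v::{finite,linorder}, 'k::field) mpoly set \<Rightarrow> ('v, 'k) mpoly set" where
  "gin I = (THE J. \<exists>U. GL_open U \<and> U \<noteq> {} \<and> (\<forall>g\<in>U. initial_ideal (lin_change g ` I) = J))"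


section \<open>Actual and virtual dimension\<close>

text \<open>Points of projective space are given by nonzero coordinate vectors.  All notions below are
  invariant under scaling, so a Zariski open set is represented by its cone without the origin.\<close>

definition proj_open :: "('k::field ^ 'v::finite) set \<Rightarrow> bool" where
  "proj_open U \<longleftrightarrow> (\<exists>S :: ('v, 'k) mpoly set. S \<subseteq> (\<Union>t. forms t) \<and>
     U = {a. a \<noteq> 0 \<and> (\<exists>F\<in>S. mpoly_eval (($) a) F \<noteq> 0)})"

definition point_ideal :: "'k::field ^ 'v \<Rightarrow> ('v::finite, 'k) mpoly set" where
  "point_ideal a = mpoly_id.span {f. (\<exists>t. f \<in> forms t) \<and> mpoly_eval (($) a) f = 0}"

text \<open>The value for a general point; the open set may depend on \<open>t\<close> and \<open>m\<close>.\<close>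

definition adim :: "('v::finite \<Rightarrow> ('v, 'k::field) mpoly set) \<Rightarrow> nat \<Rightarrow> nat \<Rightarrow> nat" where
  "adim X t m = (THE d. \<exists>U :: ('k ^ 'v) set. proj_open U \<and> U \<noteq> {} \<and>
     (\<forall>a\<in>U. mpoly_vs.dim (subscheme_ideal X \<inter> ideal_power (point_ideal a) m \<inter> forms t) = d))"

definition vdim :: "('v::finite \<Rightarrow> ('v, 'k::field) mpoly set) \<Rightarrow> nat \<Rightarrow> nat \<Rightarrow> int" where
  "vdim X t m = int (mpoly_vs.dim (subscheme_ideal X \<inter> forms t))
     - int ((m + proj_dim TYPE('v) - 1) choose proj_dim TYPE('v))"

definition AV :: "('v::finite \<Rightarrow> ('v, 'k::field) mpoly set) \<Rightarrow> nat \<Rightarrow> nat \<Rightarrow> int" where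
  "AV X j m = int (adim X (m + j) m) - vdim X (m + j) m"


section \<open>O-sequences\<close>

text \<open>\<open>macaulay_expansion d a i k\<close>: the \<open>d\<close>-th Macaulay expansion of \<open>a\<close> is the sum of
  \<open>k l choose l\<close> over \<open>i \<le> l \<le> d\<close>.  Only the values of \<open>k\<close> on \<open>{i..d}\<close> are relevant.\<close>

definition macaulay_expansion :: "nat \<Rightarrow> nat \<Rightarrow> nat \<Rightarrow> (nat \<Rightarrow> nat) \<Rightarrow> bool" where
  "macaulay_expansion d a i k \<longleftrightarrow> 1 \<le> i \<and> i \<le> d \<and> i \<le> k i \<and>
     (\<forall>l\<in>{i..<d}. k l < k (Suc l)) \<and> a = (\<Sum>l=i..d. k l choose l)"

definition macaulay_upper :: "nat \<Rightarrow> nat \<Rightarrow> nat" where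
  "macaulay_upper a d = (if a = 0 then 0 else
     (THE b. \<exists>i k. macaulay_expansion d a i k \<and> b = (\<Sum>l=i..d. (k l + 1) choose (l + 1))))"

definition O_sequence :: "(nat \<Rightarrow> int) \<Rightarrow> bool" where
  "O_sequence h \<longleftrightarrow> (\<forall>d. 0 \<le> h d) \<and>
     ((\<forall>d. h d = 0) \<or>
      (h 0 = 1 \<and> (\<forall>d\<ge>1. h (d + 1) \<le> int (macaulay_upper (nat (h d)) d))))"

end

theory Submission
  imports Defs "HOL-Computational_Algebra.Polynomial"
begin

text \<open>
  Write \<open>I = I\<^sub>X\<close>, \<open>t = m + j\<close>, and let \<open>g\<close> be a general change of coordinates.  Then \<open>g\<close> carries the
  general point to \<open>E = (1 : 0 : \<dots> : 0)\<close>, the ideal \<open>I\<^sub>E\<^sup>m\<close> is spanned by the monomials whose degree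
  in the variables other than \<open>x\<^sub>0\<close> is at least \<open>m\<close>, and in degree \<open>t\<close> these are the monomials of
  \<open>x\<^sub>0\<close>-degree at most \<open>j\<close>.  As the order is lexicographic, a form lies in \<open>I\<^sub>E\<^sup>m\<close> iff its leading
  monomial does.  So \<open>dim [I \<inter> I\<^sub>P\<^sup>m]\<^sub>t\<close> counts the monomials of \<open>gin I\<close> of degree \<open>t\<close> not divisible by
  \<open>x\<^sub>0\<^sup>j\<^sup>+\<^sup>1\<close> (lemmas \<open>leads_Int_vanishing\<close>, \<open>dim_Int_point_ideal_power\<close> and \<open>adim_eq_card\<close>).  Subtracting
  from \<open>dim [I]\<^sub>t\<close> leaves the multiples of \<open>x\<^sub>0\<^sup>j\<^sup>+\<^sup>1\<close> in \<open>gin I\<close>, that is, the monomials of \<open>J\<close> of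
  degree \<open>m - 1\<close>.  All monomials of degree \<open>m - 1\<close> are \<open>(m + n - 1) choose n\<close> in number, so
  \<open>AV X j m\<close> is the number of monomials of degree \<open>m - 1\<close> outside \<open>J\<close>.

  That \<open>gin I\<close> exists (\<open>generic_leads_ideal\<close>) is shown by Gaussian elimination with coefficients
  that are polynomials in the entries of \<open>g\<close>: in each degree the leading monomials are constant
  where one nonzero polynomial does not vanish (\<open>generic_leads\<close>).  By Dickson's lemma finitely many
  degrees determine the initial ideal.  Uniqueness of generic values holds because two nonempty
  open sets meet: on the line through a point of each, the conditions become nonzero univariate
  polynomials, and \<open>K\<close> is infinite.

  The bound in the definition of an \<open>O\<close>-sequence is Macaulay's theorem, in the form that a set of
  monomials of degree \<open>d + 1\<close> whose quotients by variables are \<open>a\<close> in number has at most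
  \<open>a\<^sup>\<langle>\<^sup>d\<^sup>\<rangle>\<close> elements (\<open>macaulay_bound\<close>).  Compressing along pairs of variables makes such a set
  stable, keeping its size and not enlarging its shadow, the set of these quotients; for stable
  sets the bound follows by induction on the number of variables and the degree, together with
  Green's bound for the monomials not involving the first variable.
\<close>

section \<open>Macaulay expansions\<close>

text \<open>The top entry \<open>k\<close> of the \<open>d\<close>-th Macaulay expansion of \<open>a\<close>, found greedily.  For \<open>a = 0\<close> it
  is \<open>d - 1\<close>, so that expansions can be continued by zero terms down to \<open>d = 1\<close>.\<close>

definition macaulay_top :: "nat \<Rightarrow> nat \<Rightarrow> nat" where
  "macaulay_top d a = (GREATEST k. k choose d \<le> a)"

text \<open>\<open>macaulay_fun d a\<close> is \<open>a\<^sup>\<langle>\<^sup>d\<^sup>\<rangle>\<close>: each term \<open>k choose d\<close> of the expansion becomes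
  \<open>(k + 1) choose (d + 1)\<close>.  In degree \<open>0\<close> it takes the value \<open>0\<close>; the recursion uses it there only
  at \<open>a = 0\<close>.\<close>

primrec macaulay_fun :: "nat \<Rightarrow> nat \<Rightarrow> nat" where
  "macaulay_fun 0 a = 0"
| "macaulay_fun (Suc d) a = (let k = macaulay_top (Suc d) a in
     (Suc k choose Suc (Suc d)) + macaulay_fun d (a - (k choose Suc d)))"

text \<open>\<open>green_fun d a\<close> is Green's \<open>a\<^sub>\<langle>\<^sub>d\<^sub>\<rangle>\<close>: each term \<open>k choose d\<close> becomes \<open>(k - 1) choose d\<close>.\<close>

primrec green_fun :: "nat \<Rightarrow> nat \<Rightarrow> nat" where
  "green_fun 0 a = 0"
| "green_fun (Suc d) a = (let k = macaulay_top (Suc d) a in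
     ((k - 1) choose Suc d) + green_fun d (a - (k choose Suc d)))"

declare macaulay_fun.simps(2) [simp del] green_fun.simps(2) [simp del]

lemma choose_Suc_lower_bound: "k - d \<le> k choose Suc d"
proof (induction k)
  case (Suc k)
  show ?case
  proof (cases "d \<le> k")
    case True
    then have "k choose d \<ge> 1" by (simp add: Suc_leI)
    with Suc show ?thesis by simp
  qed simp
qed simp

lemma macaulay_top_bounds:
  fixes d a :: nat
  shows "(macaulay_top (Suc d) a choose Suc d) \<le> a" "a < (Suc (macaulay_top (Suc d) a) choose Suc d)"
proof -
  have bound: "k \<le> a + d" if "k choose Suc d \<le> a" for k
    using choose_Suc_lower_bound[of k d] that by simp
  show "(macaulay_top (Suc d) a choose Suc d) \<le> a"
    unfolding macaulay_top_def
    by (rule GreatestI_nat[where k = 0 and b = "a + d"]) (use bound in auto)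
  show "a < (Suc (macaulay_top (Suc d) a) choose Suc d)"
  proof (rule ccontr)
    assume "\<not> ?thesis"
    then have "Suc (macaulay_top (Suc d) a) choose Suc d \<le> a" by simp
    then have "Suc (macaulay_top (Suc d) a) \<le> macaulay_top (Suc d) a"
      unfolding macaulay_top_def
      by (rule Greatest_le_nat) (use bound in blast)
    then show False by simp
  qed
qed

lemma choose_lessD: "(k choose d) < (l choose d) \<Longrightarrow> k < l"
  by (meson binomial_right_mono not_less)

lemma macaulay_top_unique:
  assumes "(k choose Suc d) \<le> a" "a < (Suc k choose Suc d)"
  shows "macaulay_top (Suc d) a = k"
proof -
  let ?t = "macaulay_top (Suc d) a"
  have "?t < Suc k" "k < Suc ?t"
    using macaulay_top_bounds[where d = d and a = a] assms
    by (meson choose_lessD le_less_trans)+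
  then show ?thesis by simp
qed

lemma macaulay_top_less:
  assumes "a < (k choose Suc d)" shows "macaulay_top (Suc d) a < k"
  using macaulay_top_bounds(1)[where d = d and a = a] assms choose_lessD le_less_trans by blast

lemma macaulay_top_ge: "d \<le> macaulay_top (Suc d) a"
proof -
  have "Suc (macaulay_top (Suc d) a) choose Suc d \<noteq> 0"
    using macaulay_top_bounds(2)[where d = d and a = a] by (metis not_less_zero)
  then show ?thesis by (metis Suc_le_mono binomial_eq_0 not_less)
qed

lemma macaulay_top_decomp:
  obtains a' where "a = (macaulay_top (Suc d) a choose Suc d) + a'"
    "a' < (macaulay_top (Suc d) a choose d)"
proof
  show "a = (macaulay_top (Suc d) a choose Suc d) + (a - (macaulay_top (Suc d) a choose Suc d))"
    using macaulay_top_bounds(1)[where d = d and a = a] by simp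
  show "a - (macaulay_top (Suc d) a choose Suc d) < (macaulay_top (Suc d) a choose d)"
    using macaulay_top_bounds[where d = d and a = a] by simp
qed

lemma macaulay_fun_decomp:
  assumes "b < (k choose d)"
  shows "macaulay_fun (Suc d) ((k choose Suc d) + b) = (Suc k choose Suc (Suc d)) + macaulay_fun d b"
    and "green_fun (Suc d) ((k choose Suc d) + b) = ((k - 1) choose Suc d) + green_fun d b"
proof -
  have "macaulay_top (Suc d) ((k choose Suc d) + b) = k"
    using assms by (intro macaulay_top_unique) auto
  then show "macaulay_fun (Suc d) ((k choose Suc d) + b) = (Suc k choose Suc (Suc d)) + macaulay_fun d b"
    "green_fun (Suc d) ((k choose Suc d) + b) = ((k - 1) choose Suc d) + green_fun d b"
    by (simp_all add: macaulay_fun.simps(2) green_fun.simps(2) Let_def)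
qed

lemma macaulay_fun_0 [simp]: "macaulay_fun d 0 = 0" "green_fun d 0 = 0"
proof (induction d)
  case (Suc d)
  have "macaulay_top (Suc d) 0 = d"
    by (rule macaulay_top_unique) simp_all
  with Suc show "macaulay_fun (Suc d) 0 = 0" "green_fun (Suc d) 0 = 0"
    by (simp_all add: macaulay_fun.simps(2) green_fun.simps(2) Let_def)
qed simp_all

lemma macaulay_fun_less:
  "a < (k choose d) \<Longrightarrow> macaulay_fun d a < (Suc k choose Suc d)"
proof (induction d arbitrary: a k)
  case (Suc d)
  define t where "t = macaulay_top (Suc d) a"
  obtain a' where a': "a = (t choose Suc d) + a'" "a' < (t choose d)"
    using macaulay_top_decomp[of a d] unfolding t_def by metis
  have "t < k" using macaulay_top_less[OF Suc.prems] by (simp add: t_def)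
  have "macaulay_fun (Suc d) a = (Suc t choose Suc (Suc d)) + macaulay_fun d a'"
    using macaulay_fun_decomp(1)[OF a'(2)] a'(1) by simp
  also have "\<dots> < (Suc t choose Suc (Suc d)) + (Suc t choose Suc d)"
    using Suc.IH[OF a'(2)] by simp
  also have "\<dots> = (Suc (Suc t) choose Suc (Suc d))" by simp
  also have "\<dots> \<le> (Suc k choose Suc (Suc d))"
    using \<open>t < k\<close> by (intro binomial_right_mono) simp
  finally show ?case .
qed simp

lemma macaulay_fun_mono:
  "a \<le> b \<Longrightarrow> macaulay_fun d a \<le> macaulay_fun d b"
proof (induction d arbitrary: a b)
  case (Suc d)
  define s where "s = macaulay_top (Suc d) a"
  define t where "t = macaulay_top (Suc d) b"
  obtain a' where a': "a = (s choose Suc d) + a'" "a' < (s choose d)"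
    using macaulay_top_decomp[of a d] unfolding s_def by metis
  obtain b' where b': "b = (t choose Suc d) + b'" "b' < (t choose d)"
    using macaulay_top_decomp[of b d] unfolding t_def by metis
  have "s < Suc t"
    using macaulay_top_bounds(1)[where d = d and a = a] macaulay_top_bounds(2)[where d = d and a = b] Suc.prems
    unfolding s_def t_def by (meson choose_lessD le_less_trans)
  have b_eq: "macaulay_fun (Suc d) b = (Suc t choose Suc (Suc d)) + macaulay_fun d b'"
    using macaulay_fun_decomp(1)[OF b'(2)] b'(1) by simp
  show ?case
  proof (cases "s = t")
    case True
    then have "a' \<le> b'" using a' b' Suc.prems by simp
    then show ?thesis
      using macaulay_fun_decomp(1)[OF a'(2)] a'(1) Suc.IH b_eq True by simp
  next
    case False
    then have "Suc s \<le> t" using \<open>s < Suc t\<close> by simp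
    have "macaulay_fun (Suc d) a < (Suc (Suc s) choose Suc (Suc d))"
      using macaulay_top_bounds(2)[where d = d and a = a] by (intro macaulay_fun_less) (simp add: s_def)
    also have "\<dots> \<le> (Suc t choose Suc (Suc d))"
      using \<open>Suc s \<le> t\<close> by (intro binomial_right_mono) simp
    finally show ?thesis using b_eq by simp
  qed
qed simp

lemma green_fun_less:
  "a < (k choose d) \<Longrightarrow> d < k \<Longrightarrow> green_fun d a < ((k - 1) choose d)"
proof (induction d arbitrary: a k)
  case (Suc d)
  define t where "t = macaulay_top (Suc d) a"
  obtain a' where a': "a = (t choose Suc d) + a'" "a' < (t choose d)"
    using macaulay_top_decomp[of a d] unfolding t_def by metis
  have tk: "t < k" using macaulay_top_less[OF Suc.prems(1)] by (simp add: t_def)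
  have dt: "d \<le> t" using macaulay_top_ge by (simp add: t_def)
  show ?case
  proof (cases "d < t")
    case True
    then obtain s where s: "t = Suc s" by (cases t) auto
    have "green_fun (Suc d) a = ((t - 1) choose Suc d) + green_fun d a'"
      using macaulay_fun_decomp(2)[OF a'(2)] a'(1) by simp
    also have "\<dots> < ((t - 1) choose Suc d) + ((t - 1) choose d)"
      using Suc.IH[OF a'(2) True] by simp
    also have "\<dots> = (t choose Suc d)" using s by simp
    also have "\<dots> \<le> ((k - 1) choose Suc d)"
      using tk by (intro binomial_right_mono) simp
    finally show ?thesis .
  next
    case False
    then have "a = 0" using a' dt by simp
    then show ?thesis using Suc.prems by simp
  qed
qed simp

text \<open>Termwise this is Pascal's rule: \<open>(k choose (d + 1)) + (k choose d) = (k + 1) choose (d + 1)\<close>.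
  Some \<open>k\<close> satisfies the hypothesis unless \<open>d = 0\<close> and \<open>a > 0\<close>.\<close>

lemma macaulay_fun_green:
  "a < (k choose d) \<Longrightarrow> macaulay_fun d (green_fun d a) + a = macaulay_fun d a"
proof (induction d arbitrary: a k)
  case (Suc d)
  define t where "t = macaulay_top (Suc d) a"
  obtain a' where a': "a = (t choose Suc d) + a'" "a' < (t choose d)"
    using macaulay_top_decomp[of a d] unfolding t_def by metis
  have dt: "d \<le> t" using macaulay_top_ge by (simp add: t_def)
  show ?case
  proof (cases "d < t")
    case True
    then obtain s where s: "t = Suc s" by (cases t) auto
    have "green_fun (Suc d) a = (s choose Suc d) + green_fun d a'"
      using macaulay_fun_decomp(2)[OF a'(2)] a'(1) s by simp
    moreover have "green_fun d a' < (s choose d)"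
      using green_fun_less[OF a'(2) True] s by simp
    ultimately have "macaulay_fun (Suc d) (green_fun (Suc d) a) =
        (Suc s choose Suc (Suc d)) + macaulay_fun d (green_fun d a')"
      using macaulay_fun_decomp(1) by simp
    then show ?thesis
      using Suc.IH[OF a'(2)] macaulay_fun_decomp(1)[OF a'(2)] a'(1) s by simp
  next
    case False
    then have "a = 0" using a' dt by simp
    then show ?thesis by simp
  qed
qed simp

lemma green_fun_lower_bound:
  "a < (k choose Suc d) \<Longrightarrow> a \<le> green_fun (Suc d) a + ((k - 1) choose d)"
proof (induction d arbitrary: a k)
  case 0
  then show ?case
    using macaulay_fun_decomp(2)[of 0 a 0] by simp
next
  case (Suc d)
  define t where "t = macaulay_top (Suc (Suc d)) a"
  obtain a' where a': "a = (t choose Suc (Suc d)) + a'" "a' < (t choose Suc d)"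
    using macaulay_top_decomp[of a "Suc d"] unfolding t_def by metis
  have tk: "t < k" using macaulay_top_less[OF Suc.prems] by (simp add: t_def)
  obtain s where s: "t = Suc s"
    using macaulay_top_ge[of "Suc d" a] by (cases t) (auto simp: t_def)
  have "green_fun (Suc (Suc d)) a = (s choose Suc (Suc d)) + green_fun (Suc d) a'"
    using macaulay_fun_decomp(2)[OF a'(2)] a'(1) s by simp
  moreover have "a' \<le> green_fun (Suc d) a' + (s choose d)"
    using Suc.IH[OF a'(2)] s by simp
  moreover have "t choose Suc d \<le> ((k - 1) choose Suc d)"
    using tk by (intro binomial_right_mono) simp
  ultimately show ?case using a'(1) s by simp
qed

text \<open>In contrapositive form: if \<open>a \<le> c\<^sup>\<langle>\<^sup>d\<^sup>\<rangle>\<close> then \<open>a - c\<close> is at most Green's bound of \<open>a\<close> in degree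
  \<open>d + 1\<close>.  This turns Macaulay's bound in one degree into Green's bound in the next.\<close>

lemma macaulay_fun_less_of_green:
  "c + green_fun (Suc d) a < a \<Longrightarrow> macaulay_fun d c < a"
proof (induction d arbitrary: a c)
  case (Suc d)
  define t where "t = macaulay_top (Suc (Suc d)) a"
  obtain a' where a': "a = (t choose Suc (Suc d)) + a'" "a' < (t choose Suc d)"
    using macaulay_top_decomp[of a "Suc d"] unfolding t_def by metis
  obtain s where s: "t = Suc s"
    using macaulay_top_ge[of "Suc d" a] by (cases t) (auto simp: t_def)
  have g: "green_fun (Suc (Suc d)) a = (s choose Suc (Suc d)) + green_fun (Suc d) a'"
    using macaulay_fun_decomp(2)[OF a'(2)] a'(1) s by simp
  show ?case
  proof (cases "c < (s choose Suc d)")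
    case True
    then show ?thesis using macaulay_fun_less[OF True] a' s by simp
  next
    case False
    then obtain c' where c': "c = (s choose Suc d) + c'" by (metis le_add_diff_inverse not_less)
    have less: "c' + green_fun (Suc d) a' < a'"
      using Suc.prems g a' s c' by simp
    have "c' < (s choose d)"
      using green_fun_lower_bound[OF a'(2)] less s by simp
    then have "macaulay_fun (Suc d) c = (Suc s choose Suc (Suc d)) + macaulay_fun d c'"
      using macaulay_fun_decomp(1) c' by simp
    then show ?thesis using Suc.IH[OF less] a' s by simp
  qed
qed simp

text \<open>Every expansion of \<open>a\<close> is the greedy one, hence the value \<open>a\<^sup>\<langle>\<^sup>d\<^sup>\<rangle>\<close> does not depend on its choice.\<close>

lemma macaulay_expansion_bounds:
  "macaulay_expansion (Suc d) a i k \<Longrightarrow>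
     (k (Suc d) choose Suc d) \<le> a \<and> a < (Suc (k (Suc d)) choose Suc d) \<and>
     (\<Sum>l=i..Suc d. (k l + 1) choose (l + 1)) = macaulay_fun (Suc d) a"
proof (induction d arbitrary: a)
  case 0
  then have "i = 1" "a = k 1" by (auto simp: macaulay_expansion_def)
  then show ?case using macaulay_fun_decomp(1)[of 0 "k 1" 0] by simp
next
  case (Suc d)
  let ?t = "k (Suc (Suc d))"
  have i: "1 \<le> i" "i \<le> Suc (Suc d)" "i \<le> k i" and inc: "\<And>l. l \<in> {i..<Suc (Suc d)} \<Longrightarrow> k l < k (Suc l)"
    and a: "a = (\<Sum>l=i..Suc (Suc d). k l choose l)"
    using Suc.prems by (auto simp: macaulay_expansion_def)
  show ?case
  proof (cases "i = Suc (Suc d)")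
    case True
    then have "a = (?t choose Suc (Suc d)) + 0" "0 < (?t choose Suc d)"
      using a i by simp_all
    then show ?thesis using macaulay_fun_decomp(1)[of 0 ?t "Suc d"] True
      by simp
  next
    case False
    then have i_le: "i \<le> Suc d" using i by simp
    define b where "b = (\<Sum>l=i..Suc d. k l choose l)"
    have ab: "a = (?t choose Suc (Suc d)) + b"
      using a i_le by (simp add: b_def)
    have "macaulay_expansion (Suc d) b i k"
      using i i_le inc by (auto simp: macaulay_expansion_def b_def)
    from Suc.IH[OF this] have b: "b < (Suc (k (Suc d)) choose Suc d)"
      "(\<Sum>l=i..Suc d. (k l + 1) choose (l + 1)) = macaulay_fun (Suc d) b" by simp_all
    have "Suc (k (Suc d)) \<le> ?t" using inc[of "Suc d"] i_le by simp
    then have "b < (?t choose Suc d)"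
      using b(1) binomial_right_mono[of "Suc (k (Suc d))" ?t "Suc d"] by simp
    then show ?thesis
      using macaulay_fun_decomp(1)[of b ?t "Suc d"] ab b(2) i_le
      by simp
  qed
qed

lemma macaulay_expansion_exists:
  "0 < a \<Longrightarrow> \<exists>i k. macaulay_expansion (Suc d) a i k"
proof (induction d arbitrary: a)
  case 0
  then have "macaulay_expansion (Suc 0) a 1 (\<lambda>_. a)" by (simp add: macaulay_expansion_def)
  then show ?case by blast
next
  case (Suc d)
  define t where "t = macaulay_top (Suc (Suc d)) a"
  obtain a' where a': "a = (t choose Suc (Suc d)) + a'" "a' < (t choose Suc d)"
    using macaulay_top_decomp[of a "Suc d"] unfolding t_def by metis
  show ?case
  proof (cases "a' = 0")
    case True
    then have "Suc (Suc d) \<le> t" using a' Suc.prems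
      by (metis add.right_neutral binomial_eq_0 less_irrefl not_less)
    then have "macaulay_expansion (Suc (Suc d)) a (Suc (Suc d)) (\<lambda>_. t)"
      using True a' by (simp add: macaulay_expansion_def)
    then show ?thesis by blast
  next
    case False
    then obtain i k where ik: "macaulay_expansion (Suc d) a' i k" using Suc.IH by blast
    have "k (Suc d) < t"
      using macaulay_expansion_bounds[OF ik] a'(2) choose_lessD le_less_trans by blast
    moreover have "(\<Sum>l=i..Suc d. (if l = Suc (Suc d) then t else k l) choose l) = a'"
      using ik by (auto simp: macaulay_expansion_def intro!: sum.cong)
    ultimately have "macaulay_expansion (Suc (Suc d)) a i (k(Suc (Suc d) := t))"
      using ik a'(1) by (auto simp: macaulay_expansion_def less_Suc_eq)
    then show ?thesis by blast
  qed
qed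

lemma macaulay_upper_eq: "macaulay_upper a (Suc d) = macaulay_fun (Suc d) a"
proof (cases "a = 0")
  case True
  then show ?thesis by (simp add: macaulay_upper_def)
next
  case False
  then obtain i k where "macaulay_expansion (Suc d) a i k"
    using macaulay_expansion_exists by blast
  then have "(THE b. \<exists>i k. macaulay_expansion (Suc d) a i k \<and>
      b = (\<Sum>l=i..Suc d. (k l + 1) choose (l + 1))) = macaulay_fun (Suc d) a"
    using macaulay_expansion_bounds by (intro the_equality) metis+
  then show ?thesis using False by (simp add: macaulay_upper_def)
qed

section \<open>Macaulay's theorem for stable sets of monomials\<close>

text \<open>Exponent functions of the monomials of degree \<open>d\<close> in the variables \<open>V\<close>.\<close>

definition exps :: "'v::finite set \<Rightarrow> nat \<Rightarrow> ('v \<Rightarrow> nat) set" where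
  "exps V d = {u. (\<forall>v. v \<notin> V \<longrightarrow> u v = 0) \<and> sum u UNIV = d}"

text \<open>The shadow of a set of monomials: all quotients of its members by a variable.\<close>

definition shadow :: "('v \<Rightarrow> nat) set \<Rightarrow> ('v \<Rightarrow> nat) set" where
  "shadow A = {w. \<exists>v. w(v := Suc (w v)) \<in> A}"

text \<open>Stability: a variable dividing a member may be replaced by any smaller index in \<open>V\<close>.\<close>

definition stable :: "'v::linorder set \<Rightarrow> ('v \<Rightarrow> nat) set \<Rightarrow> bool" where
  "stable V A \<longleftrightarrow> (\<forall>u\<in>A. \<forall>i\<in>V. \<forall>j. i < j \<and> 0 < u j \<longrightarrow> u(j := u j - 1, i := Suc (u i)) \<in> A)"

lemma sum_fun_upd: "sum (u(v := a)) UNIV + u v = sum u UNIV + (a::nat)" for u :: "'v::finite \<Rightarrow> nat"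
proof -
  have "sum (u(v := a)) UNIV = a + sum u (UNIV - {v})"
    by (subst sum.remove[of UNIV v]) (auto intro!: sum.cong)
  moreover have "sum u UNIV = u v + sum u (UNIV - {v})"
    by (rule sum.remove) auto
  ultimately show ?thesis by simp
qed

lemma sum_fun_upd_inc: "sum (u(v := Suc (u v))) UNIV = Suc (sum u UNIV)" for u :: "'v::finite \<Rightarrow> nat"
  using sum_fun_upd[of u v "Suc (u v)"] by simp

lemma sum_fun_upd_swap:
  fixes u :: "'v::finite \<Rightarrow> nat"
  assumes "i \<noteq> j" "a + b = u i + u j"
  shows "sum (u(i := a, j := b)) UNIV = sum u UNIV"
  using sum_fun_upd[of u i a] sum_fun_upd[of "u(i := a)" j b] assms by simp

lemma finite_exps: "finite (exps V d)"
proof (rule finite_subset)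
  show "exps V d \<subseteq> PiE UNIV (\<lambda>_. {..d})"
    by (auto simp: exps_def intro: member_le_sum)
qed (auto intro: finite_PiE)

lemma shadow_exps: "A \<subseteq> exps V (Suc d) \<Longrightarrow> shadow A \<subseteq> exps V d"
proof
  fix w assume A: "A \<subseteq> exps V (Suc d)" and "w \<in> shadow A"
  then obtain v where v: "w(v := Suc (w v)) \<in> exps V (Suc d)" by (auto simp: shadow_def)
  then have "w u = 0" if "u \<notin> V" for u
    using that by (cases "u = v") (auto simp: exps_def dest: spec[of _ u])
  moreover have "sum w UNIV = d" using v sum_fun_upd_inc[of w v] unfolding exps_def by force
  ultimately show "w \<in> exps V d" by (simp add: exps_def)
qed

lemma card_split_inc:
  fixes A :: "('v \<Rightarrow> nat) set"
  assumes "finite A"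
  shows "card A = card {w. w(x := Suc (w x)) \<in> A} + card {u \<in> A. u x = 0}"
proof -
  have "bij_betw (\<lambda>w. w(x := Suc (w x))) {w. w(x := Suc (w x)) \<in> A} {u \<in> A. u x \<noteq> 0}"
    by (rule bij_betw_byWitness[where f' = "\<lambda>u. u(x := u x - 1)"]) auto
  then have "card {w. w(x := Suc (w x)) \<in> A} = card {u \<in> A. u x \<noteq> 0}"
    by (rule bij_betw_same_card)
  moreover have "card A = card ({u \<in> A. u x \<noteq> 0} \<union> {u \<in> A. u x = 0})"
    by (rule arg_cong[where f = card]) auto
  moreover have "\<dots> = card {u \<in> A. u x \<noteq> 0} + card {u \<in> A. u x = 0}"
    using assms by (intro card_Un_disjoint) auto
  ultimately show ?thesis by simp
qed

text \<open>For a stable set, dividing by the first variable already gives the whole shadow.\<close>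

lemma shadow_stable_eq:
  assumes "stable V A" "A \<subseteq> exps V d" "x \<in> V" "\<And>v. v \<in> V \<Longrightarrow> x \<le> v"
  shows "shadow A = {w. w(x := Suc (w x)) \<in> A}"
proof (intro set_eqI iffI)
  fix w assume "w \<in> shadow A"
  then obtain v where v: "w(v := Suc (w v)) \<in> A" by (auto simp: shadow_def)
  then have "v \<in> V" using assms(2) by (force simp: exps_def)
  show "w \<in> {w. w(x := Suc (w x)) \<in> A}"
  proof (cases "v = x")
    case False
    then have "x < v" using assms(4)[OF \<open>v \<in> V\<close>] by simp
    then have "(w(v := Suc (w v)))(v := (w(v := Suc (w v))) v - 1, x := Suc ((w(v := Suc (w v))) x)) \<in> A"
      using assms(1,3) v unfolding stable_def by (metis fun_upd_same zero_less_Suc)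
    then show ?thesis using False by simp
  qed (use v in simp)
qed (auto simp: shadow_def)

lemma stable_shadow:
  assumes "stable V A" "A \<subseteq> exps V d" "x \<in> V" "\<And>v. v \<in> V \<Longrightarrow> x \<le> v"
  shows "stable V (shadow A)"
  unfolding stable_def
proof (intro ballI allI impI)
  fix u i j assume u: "u \<in> shadow A" "i \<in> V" "i < j \<and> 0 < u j"
  define w where "w = u(x := Suc (u x))"
  have "w \<in> A" using u shadow_stable_eq[OF assms] by (simp add: w_def)
  have "j \<noteq> x" using assms(4)[OF u(2)] u(3) by auto
  then have "0 < w j" using u by (simp add: w_def)
  then have "w(j := w j - 1, i := Suc (w i)) \<in> A"
    using assms(1) u(2,3) \<open>w \<in> A\<close> unfolding stable_def by blast
  moreover have "w(j := w j - 1, i := Suc (w i)) = (u(j := u j - 1, i := Suc (u i)))(x := Suc ((u(j := u j - 1, i := Suc (u i))) x))"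
    using \<open>j \<noteq> x\<close> by (auto simp: w_def fun_eq_iff)
  ultimately show "u(j := u j - 1, i := Suc (u i)) \<in> shadow A"
    unfolding shadow_def mem_Collect_eq by (intro exI[of _ x]) (simp only:)
qed

text \<open>Green's bound in degree \<open>e + 1\<close>, given Macaulay's bound in the step from degree \<open>e\<close>.  For
  \<open>e = 0\<close> it only says that a nonempty stable set of variables contains the first one.\<close>

lemma green_bound_stable:
  assumes B: "stable V B" "B \<subseteq> exps V (Suc e)" and x: "x \<in> V" "\<And>v. v \<in> V \<Longrightarrow> x \<le> v"
    and mac: "1 \<le> e \<Longrightarrow> card B \<le> macaulay_fun e (card (shadow B))"
  shows "card {u \<in> B. u x = 0} \<le> green_fun (Suc e) (card B)"
proof -
  have fin: "finite B" using B(2) finite_exps finite_subset by blast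
  have eq: "card B = card (shadow B) + card {u \<in> B. u x = 0}"
    using card_split_inc[OF fin, of x] shadow_stable_eq[OF B x] by simp
  show ?thesis
  proof (cases "e = 0")
    case True
    show ?thesis
    proof (cases "B = {}")
      case False
      then obtain u where u: "u \<in> B" by blast
      then have "sum u UNIV = 1" using B(2) True by (auto simp: exps_def)
      then obtain v where "u v > 0"
        by (metis gr0I sum.neutral zero_neq_one)
      then have "u(v := u v - 1) \<in> shadow B"
        using u by (auto simp: shadow_def intro!: exI[of _ v])
      moreover have "finite (shadow B)"
        using shadow_exps[OF B(2)] finite_exps finite_subset by blast
      ultimately have "card (shadow B) \<ge> 1"
        by (metis One_nat_def Suc_leI card_gt_0_iff empty_iff)
      moreover have "green_fun (Suc 0) (card B) = card B - 1"
        using macaulay_fun_decomp(2)[of 0 "card B" 0] by simp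
      ultimately show ?thesis using eq True by simp
    qed simp
  next
    case False
    then have "\<not> card (shadow B) + green_fun (Suc e) (card B) < card B"
      using mac macaulay_fun_less_of_green[of "card (shadow B)" e "card B"] by auto
    then show ?thesis using eq by simp
  qed
qed

text \<open>With \<open>B\<close> the shadow of \<open>A\<close> and \<open>A\<^sub>0\<close>, \<open>B\<^sub>0\<close> the members without the first variable,
  \<open>|A| = |B| + |A\<^sub>0|\<close> and the shadow of \<open>A\<^sub>0\<close> lies in \<open>B\<^sub>0\<close>.  Induction on the variables bounds
  \<open>|A\<^sub>0|\<close> by \<open>|B\<^sub>0|\<^sup>\<langle>\<^sup>d\<^sup>\<rangle>\<close>, and Green's bound controls \<open>|B\<^sub>0|\<close>.\<close>

lemma macaulay_bound_stable:
  fixes V :: "'v::{finite,linorder} set"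
  shows "1 \<le> d \<Longrightarrow> A \<subseteq> exps V (Suc d) \<Longrightarrow> stable V A \<Longrightarrow>
    card A \<le> macaulay_fun d (card (shadow A))"
proof (induction V arbitrary: d A rule: finite_linorder_min_induct[OF finite, case_names empty insert])
  case (empty d A)
  then have "A = {}" by (auto simp: exps_def)
  then show ?case by simp
next
  case (insert x V d A)
  let ?V = "insert x V"
  have x: "x \<in> ?V" "\<And>v. v \<in> ?V \<Longrightarrow> x \<le> v" using insert.hyps by (auto simp: less_imp_le)
  show ?case using insert.prems
  proof (induction d arbitrary: A)
    case (Suc e)
    let ?d = "Suc e"
    define B where "B = shadow A"
    define A0 where "A0 = {u \<in> A. u x = 0}"
    have finA: "finite A" using Suc.prems(2) finite_exps finite_subset by blast
    have B: "stable ?V B" "B \<subseteq> exps ?V (Suc e)"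
      using stable_shadow[OF Suc.prems(3,2) x] shadow_exps[OF Suc.prems(2)] by (simp_all add: B_def)
    have finB: "finite B" using B(2) finite_exps finite_subset by blast
    have "A0 \<subseteq> exps V (Suc ?d)"
    proof
      fix u assume "u \<in> A0"
      then have "u \<in> exps ?V (Suc ?d)" "u x = 0" using Suc.prems(2) by (auto simp: A0_def)
      then have "u v = 0" if "v \<notin> V" for v
        using that by (cases "v = x") (auto simp: exps_def)
      then show "u \<in> exps V (Suc ?d)" using \<open>u \<in> exps ?V (Suc ?d)\<close> by (simp add: exps_def)
    qed
    moreover have "stable V A0"
      unfolding stable_def
    proof (intro ballI allI impI)
      fix u i j assume u: "u \<in> A0" "i \<in> V" "i < j \<and> 0 < u j"
      then have "i \<noteq> x" "j \<noteq> x" using insert.hyps by (auto simp: A0_def)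
      moreover have "u(j := u j - 1, i := Suc (u i)) \<in> A"
        using u Suc.prems(3) unfolding stable_def A0_def by blast
      ultimately show "u(j := u j - 1, i := Suc (u i)) \<in> A0"
        using u by (auto simp: A0_def)
    qed
    ultimately have "card A0 \<le> macaulay_fun ?d (card (shadow A0))"
      by (intro insert.IH) auto
    also have "shadow A0 \<subseteq> {u \<in> B. u x = 0}"
    proof
      fix w assume "w \<in> shadow A0"
      then obtain v where v: "w(v := Suc (w v)) \<in> A" "(w(v := Suc (w v))) x = 0"
        by (auto simp: shadow_def A0_def)
      then have "w x = 0" by (cases "v = x") auto
      then show "w \<in> {u \<in> B. u x = 0}" using v by (auto simp: B_def shadow_def)
    qed
    then have "macaulay_fun ?d (card (shadow A0)) \<le> macaulay_fun ?d (card {u \<in> B. u x = 0})"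
      using finB by (intro macaulay_fun_mono card_mono) auto
    also have "\<dots> \<le> macaulay_fun ?d (green_fun ?d (card B))"
      using B x Suc.IH[of B] by (intro macaulay_fun_mono green_bound_stable) auto
    finally have "card A0 \<le> macaulay_fun ?d (green_fun ?d (card B))" .
    moreover have "card A = card B + card A0"
      using card_split_inc[OF finA, of x] shadow_stable_eq[OF Suc.prems(3,2) x]
      by (simp add: A0_def B_def)
    moreover have "macaulay_fun ?d (green_fun ?d (card B)) + card B = macaulay_fun ?d (card B)"
      using macaulay_top_bounds(2)[where a = "card B" and d = e] by (rule macaulay_fun_green)
    ultimately show ?case by (simp add: B_def)
  qed simp
qed

section \<open>Compression\<close>

text \<open>The monomials that agree outside \<open>i\<close> and \<open>j\<close> and have a fixed total degree in these two
  variables are listed by their exponent \<open>b\<close> of \<open>j\<close>.  The fiber collects the exponents that occur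
  in \<open>A\<close>; the argument \<open>w\<close> represents the class and has exponent \<open>0\<close> at \<open>j\<close>.\<close>

definition fiber :: "'v \<Rightarrow> 'v \<Rightarrow> ('v \<Rightarrow> nat) set \<Rightarrow> ('v \<Rightarrow> nat) \<Rightarrow> nat set" where
  "fiber i j A w = {b. b \<le> w i \<and> w(i := w i - b, j := b) \<in> A}"

text \<open>Compression replaces each fiber by the initial segment \<open>{0, \<dots>, c - 1}\<close> of the same size \<open>c\<close>.\<close>

definition compress :: "'v \<Rightarrow> 'v \<Rightarrow> ('v \<Rightarrow> nat) set \<Rightarrow> ('v \<Rightarrow> nat) set" where
  "compress i j A = {u. u j < card (fiber i j A (u(i := u i + u j, j := 0)))}"

lemma finite_fiber: "finite (fiber i j A w)"
  by (rule finite_subset[of _ "{..w i}"]) (auto simp: fiber_def)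

lemma card_fiber_le: "card (fiber i j A w) \<le> Suc (w i)"
  using card_mono[of "{..w i}" "fiber i j A w"] by (auto simp: fiber_def)

lemma fiber_compress:
  assumes "i \<noteq> j" "w j = 0"
  shows "fiber i j (compress i j A) w = {..<card (fiber i j A w)}"
proof (rule set_eqI)
  fix b
  let ?u = "w(i := w i - b, j := b)"
  have "?u(i := ?u i + ?u j, j := 0) = w" if "b \<le> w i"
    using assms that by (auto simp: fun_eq_iff)
  then have "b \<le> w i \<Longrightarrow> ?u \<in> compress i j A \<longleftrightarrow> b < card (fiber i j A w)"
    by (simp add: compress_def)
  then show "b \<in> fiber i j (compress i j A) w \<longleftrightarrow> b \<in> {..<card (fiber i j A w)}"
    using card_fiber_le[of i j A w] by (auto simp: fiber_def[of i j "compress i j A"])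
qed

lemma compress_subset_exps:
  assumes "i \<noteq> j" "A \<subseteq> exps UNIV d"
  shows "compress i j A \<subseteq> exps UNIV d"
proof
  fix u assume u: "u \<in> compress i j A"
  let ?w = "u(i := u i + u j, j := 0)"
  have "fiber i j A ?w \<noteq> {}" using u by (auto simp: compress_def)
  then obtain b where b: "b \<le> u i + u j" "?w(i := u i + u j - b, j := b) \<in> A"
    using assms(1) by (auto simp: fiber_def)
  have "sum (u(i := u i + u j - b, j := b)) UNIV = sum u UNIV"
    using b(1) assms(1) by (intro sum_fun_upd_swap) auto
  moreover have "?w(i := u i + u j - b, j := b) = u(i := u i + u j - b, j := b)"
    using assms(1) by auto
  ultimately show "u \<in> exps UNIV d" using b assms(2) by (auto simp: exps_def)
qed

lemma bij_betw_fiber: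
  assumes "i \<noteq> j" "A \<subseteq> exps UNIV d"
  shows "bij_betw (\<lambda>(w, b). w(i := w i - b, j := b))
    (SIGMA w:{w \<in> exps UNIV d. w j = 0}. fiber i j A w) A"
proof (rule bij_betw_byWitness[where f' = "\<lambda>u. (u(i := u i + u j, j := 0), u j)"])
  show "(\<lambda>u. (u(i := u i + u j, j := 0), u j)) ` A \<subseteq> (SIGMA w:{w \<in> exps UNIV d. w j = 0}. fiber i j A w)"
  proof
    fix p assume "p \<in> (\<lambda>u. (u(i := u i + u j, j := 0), u j)) ` A"
    then obtain u where u: "u \<in> A" "p = (u(i := u i + u j, j := 0), u j)" by blast
    have "sum (u(i := u i + u j, j := 0)) UNIV = sum u UNIV"
      using assms(1) by (intro sum_fun_upd_swap) auto
    moreover have "u(i := u i, j := u j) \<in> A" using u by simp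
    ultimately show "p \<in> (SIGMA w:{w \<in> exps UNIV d. w j = 0}. fiber i j A w)"
      using u assms by (auto simp: exps_def fiber_def fun_upd_twist)
  qed
next
  show "\<forall>p\<in>(SIGMA w:{w \<in> exps UNIV d. w j = 0}. fiber i j A w).
      (\<lambda>u. (u(i := u i + u j, j := 0), u j)) ((\<lambda>(w, b). w(i := w i - b, j := b)) p) = p"
  proof
    fix p assume "p \<in> (SIGMA w:{w \<in> exps UNIV d. w j = 0}. fiber i j A w)"
    then obtain w b where p: "p = (w, b)" "w j = 0" "b \<le> w i" by (auto simp: fiber_def)
    let ?u = "w(i := w i - b, j := b)"
    have "?u(i := ?u i + ?u j, j := 0) = w" using assms(1) p by (auto simp: fun_eq_iff)
    then show "(\<lambda>u. (u(i := u i + u j, j := 0), u j)) ((\<lambda>(w, b). w(i := w i - b, j := b)) p) = p"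
      using p by simp
  qed
  show "\<forall>u\<in>A. (\<lambda>(w, b). w(i := w i - b, j := b)) (u(i := u i + u j, j := 0), u j) = u"
    using assms(1) by (auto simp: fun_eq_iff)
  show "(\<lambda>(w, b). w(i := w i - b, j := b)) ` (SIGMA w:{w \<in> exps UNIV d. w j = 0}. fiber i j A w) \<subseteq> A"
    by (auto simp: fiber_def)
qed

lemma sum_fiber:
  fixes f :: "('v::finite \<Rightarrow> nat) \<Rightarrow> nat"
  assumes "i \<noteq> j" "A \<subseteq> exps UNIV d"
  shows "sum f A = (\<Sum>w\<in>{w \<in> exps UNIV d. w j = 0}. \<Sum>b\<in>fiber i j A w. f (w(i := w i - b, j := b)))"
proof -
  have "sum f A = (\<Sum>p\<in>(SIGMA w:{w \<in> exps UNIV d. w j = 0}. fiber i j A w).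
      f (case p of (w, b) \<Rightarrow> w(i := w i - b, j := b)))"
    using sum.reindex_bij_betw[OF bij_betw_fiber[OF assms], of f] by simp
  also have "\<dots> = (\<Sum>w\<in>{w \<in> exps UNIV d. w j = 0}. \<Sum>b\<in>fiber i j A w. f (w(i := w i - b, j := b)))"
    by (subst sum.Sigma) (auto simp: finite_exps finite_fiber case_prod_unfold)
  finally show ?thesis .
qed

lemma card_compress:
  fixes A :: "('v::finite \<Rightarrow> nat) set"
  assumes "i \<noteq> j" "A \<subseteq> exps UNIV d"
  shows "card (compress i j A) = card A"
proof -
  have "card (fiber i j (compress i j A) w) = card (fiber i j A w)" if "w j = 0" for w
    using fiber_compress[of i j w A, OF assms(1) that] by simp
  then show ?thesis
    using sum_fiber[OF assms, of "\<lambda>_. 1"] sum_fiber[OF assms(1) compress_subset_exps[OF assms], of "\<lambda>_. 1"]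
    by (auto intro!: sum.cong)
qed

text \<open>The shadow of \<open>T\<close> within two variables has at least \<open>card T\<close> elements unless \<open>T\<close> is everything.
  The injection closes the gap at a missing exponent \<open>b0\<close>.\<close>

lemma card_shadow_fiber:
  assumes "T \<subseteq> {..Suc s}" "T' \<subseteq> {..s}" "\<And>b. b \<in> T \<Longrightarrow> b \<le> s \<Longrightarrow> b \<in> T'" "\<And>b. Suc b \<in> T \<Longrightarrow> b \<in> T'"
  shows "min (card T) (Suc s) \<le> card T'"
proof (cases "T = {..Suc s}")
  case True
  then have "T' = {..s}" using assms by auto
  then show ?thesis by simp
next
  case False
  then obtain b0 where b0: "b0 \<le> Suc s" "b0 \<notin> T" using assms(1) by auto
  let ?f = "\<lambda>b. if b < b0 then b else b - 1"
  have "?f b \<in> T'" if "b \<in> T" for b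
  proof (cases "b < b0")
    case False
    with that b0 have "b0 < b" by (metis linorder_neqE_nat)
    then show ?thesis using that assms(4)[of "b - 1"] by simp
  qed (use that assms(3) b0 in auto)
  moreover have "inj_on ?f T"
  proof (rule inj_onI)
    fix a b assume "a \<in> T" "b \<in> T" "?f a = ?f b"
    moreover from this have "a \<noteq> b0" "b \<noteq> b0" using b0 by auto
    ultimately show "a = b" by (auto split: if_splits)
  qed
  moreover have "finite T'" using assms(2) finite_subset by blast
  moreover from calculation have "?f ` T \<subseteq> T'" by blast
  ultimately have "card T \<le> card T'" by (intro card_inj_on_le[of ?f])
  then show ?thesis by simp
qed

lemma shadow_compress_subset:
  assumes "i \<noteq> j"
  shows "shadow (compress i j A) \<subseteq> compress i j (shadow A)"
proof
  fix w assume "w \<in> shadow (compress i j A)"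
  then obtain v where v: "w(v := Suc (w v)) \<in> compress i j A" by (auto simp: shadow_def)
  let ?u = "w(v := Suc (w v))"
  define s where "s = w i + w j"
  define N where "N = w(i := s, j := 0)"
  show "w \<in> compress i j (shadow A)"
  proof (cases "v = i \<or> v = j")
    case False
    then have less: "w j < card (fiber i j A (N(v := Suc (N v))))"
    proof -
      have "?u(i := ?u i + ?u j, j := 0) = N(v := Suc (N v))"
        using False by (auto simp: fun_eq_iff N_def s_def)
      moreover have "?u j = w j" using False by auto
      ultimately show ?thesis using v unfolding compress_def mem_Collect_eq by (simp only:)
    qed
    have "b \<in> fiber i j (shadow A) N" if "b \<in> fiber i j A (N(v := Suc (N v)))" for b
    proof -
      have "(N(v := Suc (N v)))(i := s - b, j := b) = (N(i := s - b, j := b))(v := Suc ((N(i := s - b, j := b)) v))"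
        using False by (auto simp: fun_eq_iff)
      moreover have "(N(v := Suc (N v))) i = s" "N i = s" using False assms by (auto simp: N_def)
      ultimately have "b \<le> s" "(N(i := s - b, j := b))(v := Suc ((N(i := s - b, j := b)) v)) \<in> A"
        using that unfolding fiber_def by simp_all
      then show ?thesis
        using \<open>N i = s\<close> unfolding fiber_def shadow_def mem_Collect_eq by (simp only:) blast
    qed
    then have "fiber i j A (N(v := Suc (N v))) \<subseteq> fiber i j (shadow A) N" by blast
    from card_mono[OF finite_fiber this] less show ?thesis
      by (simp add: compress_def N_def s_def)
  next
    case True
    define M where "M = w(i := Suc s, j := 0)"
    have less: "?u j < card (fiber i j A M)"
    proof -
      have "?u(i := ?u i + ?u j, j := 0) = M"
        using True assms by (auto simp: fun_eq_iff M_def s_def)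
      then show ?thesis using v unfolding compress_def mem_Collect_eq by (simp only:)
    qed
    have "min (card (fiber i j A M)) (Suc s) \<le> card (fiber i j (shadow A) N)"
    proof (rule card_shadow_fiber)
      fix b
      have eq: "N(i := s - b, j := b) = w(i := s - b, j := b)" "M(i := Suc s - b, j := b) = w(i := Suc s - b, j := b)" for b
        using assms by (auto simp: N_def M_def)
      {
        assume "b \<in> fiber i j A M" "b \<le> s"
        then have "(w(i := s - b, j := b))(i := Suc ((w(i := s - b, j := b)) i)) \<in> A"
        proof -
          have "(w(i := s - b, j := b))(i := Suc ((w(i := s - b, j := b)) i)) = M(i := Suc s - b, j := b)"
            using assms \<open>b \<le> s\<close> by (auto simp: fun_eq_iff M_def)
          moreover have "M(i := Suc s - b, j := b) \<in> A"
            using \<open>b \<in> fiber i j A M\<close> assms by (simp add: fiber_def M_def)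
          ultimately show ?thesis by (simp only:)
        qed
        then have "w(i := s - b, j := b) \<in> shadow A" unfolding shadow_def by blast
        then show "b \<in> fiber i j (shadow A) N"
          using \<open>b \<le> s\<close> eq(1)[of b] assms by (simp add: fiber_def N_def)
      }
      {
        assume "Suc b \<in> fiber i j A M"
        then have b: "b \<le> s" "(w(i := s - b, j := b))(j := Suc ((w(i := s - b, j := b)) j)) \<in> A"
          using assms eq(2)[of "Suc b"] by (simp_all add: fiber_def M_def)
        then have "w(i := s - b, j := b) \<in> shadow A" unfolding shadow_def by blast
        then show "b \<in> fiber i j (shadow A) N"
          using \<open>b \<le> s\<close> eq(1)[of b] assms by (simp add: fiber_def N_def)
      }
    qed (use assms in \<open>auto simp: fiber_def N_def M_def\<close>)
    moreover have "w j < card (fiber i j A M)" "w j < Suc s"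
      using less True by (auto simp: s_def split: if_splits)
    ultimately show ?thesis by (simp add: compress_def N_def s_def)
  qed
qed

lemma card_shadow_compress_le:
  fixes A :: "('v::finite \<Rightarrow> nat) set"
  assumes "i \<noteq> j" "A \<subseteq> exps UNIV (Suc d)"
  shows "card (shadow (compress i j A)) \<le> card (shadow A)"
proof -
  have sh: "shadow A \<subseteq> exps UNIV d" by (rule shadow_exps[OF assms(2)])
  have "finite (compress i j (shadow A))"
    using compress_subset_exps[OF assms(1) sh] finite_exps finite_subset by blast
  then show ?thesis
    using card_mono[OF _ shadow_compress_subset[OF assms(1)]] card_compress[OF assms(1) sh] by metis
qed

lemma sum_lessThan_card_less:
  fixes T :: "nat set"
  assumes "finite T" "T \<noteq> {..<card T}"
  shows "\<Sum>{..<card T} < \<Sum>T"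
proof -
  have "\<not> T \<subseteq> {..<card T}"
    using assms card_subset_eq[of "{..<card T}" T] by auto
  then obtain t where t: "t \<in> T" "card T \<le> t" by (meson lessThan_iff not_less subsetI)
  have "\<not> {..<card T} \<subseteq> T"
    using assms card_subset_eq[of T "{..<card T}"] by auto
  then obtain t0 where t0: "t0 < card T" "t0 \<notin> T" by (meson lessThan_iff subsetI)
  define T' where "T' = insert t0 (T - {t})"
  have "card T' = card T"
    using assms(1) t t0 by (auto simp: T'_def card_insert_if card_Diff_singleton)
  then have "\<Sum>{..<card T} \<le> \<Sum>T'"
    using card_sum_le_nat_sum[of T'] by (simp add: lessThan_atLeast0)
  also have "\<Sum>T' = t0 + \<Sum>(T - {t})" using assms(1) t0 by (simp add: T'_def)
  also have "\<dots> < t + \<Sum>(T - {t})" using t t0 by simp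
  also have "\<dots> = \<Sum>T" using assms(1) t sum.remove[of T t "\<lambda>x. x"] by simp
  finally show ?thesis .
qed

text \<open>A measure that strictly decreases under every compression that is not the identity.\<close>

definition weight :: "('v::{finite,linorder} \<Rightarrow> nat) \<Rightarrow> nat" where
  "weight u = (\<Sum>v\<in>UNIV. card {..<v} * u v)"

lemma weight_shift:
  fixes w :: "'v::{finite,linorder} \<Rightarrow> nat"
  assumes "i < j" "w j = 0" "b \<le> w i"
  shows "weight (w(i := w i - b, j := b)) = weight w + (card {..<j} - card {..<i}) * b"
proof -
  have split: "weight u = card {..<i} * u i + (card {..<j} * u j + (\<Sum>v\<in>UNIV - {i} - {j}. card {..<v} * u v))" for u
    unfolding weight_def using assms(1) by (subst sum.remove[of _ i], simp, simp, subst sum.remove[of _ j]) auto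
  have "(\<Sum>v\<in>UNIV - {i} - {j}. card {..<v} * (w(i := w i - b, j := b)) v) = (\<Sum>v\<in>UNIV - {i} - {j}. card {..<v} * w v)"
    by (intro sum.cong) auto
  moreover have "card {..<i} \<le> card {..<j}" using assms(1) by (intro card_mono) auto
  then have "card {..<i} * (w i - b) + card {..<j} * b = card {..<i} * w i + (card {..<j} - card {..<i}) * b"
    using assms(3) by (simp add: diff_mult_distrib diff_mult_distrib2 mult_le_mono)
  ultimately show ?thesis using split[of w] split[of "w(i := w i - b, j := b)"] assms by auto
qed

lemma weight_compress_less:
  fixes A :: "('v::{finite,linorder} \<Rightarrow> nat) set"
  assumes "i < j" "A \<subseteq> exps UNIV d" "compress i j A \<noteq> A"
  shows "sum weight (compress i j A) < sum weight A"
proof -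
  have ij: "i \<noteq> j" using assms(1) by simp
  let ?W = "{w \<in> exps UNIV d. w j = 0}"
  let ?\<delta> = "card {..<j} - card {..<i}"
  have \<delta>: "0 < ?\<delta>" using assms(1) by (auto intro!: psubset_card_mono)
  have sum_eq: "sum weight B = (\<Sum>w\<in>?W. card (fiber i j B w) * weight w + ?\<delta> * \<Sum>(fiber i j B w))"
    if "B \<subseteq> exps UNIV d" for B
    unfolding sum_fiber[OF ij that]
  proof (rule sum.cong[OF refl])
    fix w assume "w \<in> ?W"
    then have "(\<Sum>b\<in>fiber i j B w. weight (w(i := w i - b, j := b))) = (\<Sum>b\<in>fiber i j B w. weight w + ?\<delta> * b)"
      using assms(1) by (intro sum.cong weight_shift) (auto simp: fiber_def)
    then show "(\<Sum>b\<in>fiber i j B w. weight (w(i := w i - b, j := b))) =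
      card (fiber i j B w) * weight w + ?\<delta> * \<Sum>(fiber i j B w)"
      by (simp add: sum.distrib sum_distrib_left)
  qed
  have sub: "compress i j A \<subseteq> exps UNIV d" by (rule compress_subset_exps[OF ij assms(2)])
  have "\<exists>w\<in>?W. fiber i j A w \<noteq> {..<card (fiber i j A w)}"
  proof (rule ccontr)
    assume "\<not> ?thesis"
    then have "fiber i j (compress i j A) w = fiber i j A w" if "w \<in> ?W" for w
      using fiber_compress[OF ij, of w A] that by auto
    then have "(SIGMA w:?W. fiber i j (compress i j A) w) = (SIGMA w:?W. fiber i j A w)"
      by (intro Sigma_cong) auto
    moreover note bij_betw_imp_surj_on[OF bij_betw_fiber[OF ij assms(2)]]
      bij_betw_imp_surj_on[OF bij_betw_fiber[OF ij sub]]
    ultimately show False using assms(3) by (simp only:)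
  qed
  then obtain w0 where w0: "w0 \<in> ?W" "fiber i j A w0 \<noteq> {..<card (fiber i j A w0)}" by blast
  show ?thesis
    unfolding sum_eq[OF sub] sum_eq[OF assms(2)]
  proof (rule sum_strict_mono_ex1)
    show "\<forall>w\<in>?W. card (fiber i j (compress i j A) w) * weight w + ?\<delta> * \<Sum>(fiber i j (compress i j A) w)
        \<le> card (fiber i j A w) * weight w + ?\<delta> * \<Sum>(fiber i j A w)"
    proof
      fix w assume "w \<in> ?W"
      then have "fiber i j (compress i j A) w = {..<card (fiber i j A w)}"
        using fiber_compress[OF ij] by blast
      moreover have "\<Sum>{..<card (fiber i j A w)} \<le> \<Sum>(fiber i j A w)"
        using card_sum_le_nat_sum[of "fiber i j A w"] by (simp add: lessThan_atLeast0)
      ultimately show "card (fiber i j (compress i j A) w) * weight w + ?\<delta> * \<Sum>(fiber i j (compress i j A) w)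
        \<le> card (fiber i j A w) * weight w + ?\<delta> * \<Sum>(fiber i j A w)" by simp
    qed
    show "\<exists>w\<in>?W. card (fiber i j (compress i j A) w) * weight w + ?\<delta> * \<Sum>(fiber i j (compress i j A) w)
        < card (fiber i j A w) * weight w + ?\<delta> * \<Sum>(fiber i j A w)"
      using w0 fiber_compress[OF ij, of w0 A] sum_lessThan_card_less[OF finite_fiber w0(2)] \<delta>
      by (intro bexI[of _ w0]) auto
  qed (simp add: finite_exps)
qed

lemma stable_of_compressed:
  fixes A :: "('v::{finite,linorder} \<Rightarrow> nat) set"
  assumes "\<And>i j. i < j \<Longrightarrow> compress i j A = A"
  shows "stable UNIV A"
  unfolding stable_def
proof (intro ballI allI impI)
  fix u :: "'v \<Rightarrow> nat" and i j assume u: "u \<in> A" "i < j \<and> 0 < u j"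
  let ?u = "u(j := u j - 1, i := Suc (u i))"
  have "u j < card (fiber i j A (u(i := u i + u j, j := 0)))"
    using assms[of i j] u unfolding compress_def by blast
  then have "u j - 1 < card (fiber i j A (u(i := u i + u j, j := 0)))" by simp
  moreover have "?u(i := ?u i + ?u j, j := 0) = u(i := u i + u j, j := 0)" "?u j = u j - 1"
    using u by (auto simp: fun_eq_iff)
  ultimately have "?u \<in> compress i j A" unfolding compress_def mem_Collect_eq by (simp only:)
  then show "?u \<in> A" using assms u by simp
qed

text \<open>Among the sets of the same size with no larger shadow, one of least weight is fixed by all
  compressions, hence stable.\<close>

theorem macaulay_bound:
  fixes A :: "('v::{finite,linorder} \<Rightarrow> nat) set"
  assumes "1 \<le> d" "A \<subseteq> exps UNIV (Suc d)"
  shows "card A \<le> macaulay_fun d (card (shadow A))"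
proof -
  let ?P = "\<lambda>B :: ('v \<Rightarrow> nat) set. B \<subseteq> exps UNIV (Suc d) \<and> card B = card A \<and> card (shadow B) \<le> card (shadow A)"
  obtain B where B: "?P B" and least: "\<And>C. ?P C \<Longrightarrow> sum weight B \<le> sum weight C"
    using assms(2) ex_has_least_nat[of ?P A "sum weight"] by blast
  have "compress i j B = B" if "i < j" for i j
  proof (rule ccontr)
    assume "compress i j B \<noteq> B"
    then have "sum weight (compress i j B) < sum weight B"
      using weight_compress_less that B by blast
    moreover have "i \<noteq> j" "B \<subseteq> exps UNIV (Suc d)" using that B by auto
    then have "?P (compress i j B)"
      using compress_subset_exps[of i j B "Suc d"] card_compress[of i j B "Suc d"]
        card_shadow_compress_le[of i j B d] B
      by simp
    ultimately show False using least[of "compress i j B"] by simp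
  qed
  then have "card B \<le> macaulay_fun d (card (shadow B))"
    using stable_of_compressed macaulay_bound_stable assms(1) B by blast
  also have "\<dots> \<le> macaulay_fun d (card (shadow A))"
    using B by (intro macaulay_fun_mono) simp
  finally show ?thesis using B by simp
qed

section \<open>Evaluation and substitution\<close>

abbreviation (input) keys where "keys \<equiv> Poly_Mapping.keys"
abbreviation (input) lookup where "lookup \<equiv> Poly_Mapping.lookup"
abbreviation (input) single where "single \<equiv> Poly_Mapping.single"

lemma sum_single_lookup: "(\<Sum>m\<in>keys p. single m (lookup p m)) = p"
  for p :: "'a \<Rightarrow>\<^sub>0 'b::comm_monoid_add"
proof (rule poly_mapping_eqI)
  fix m
  show "lookup (\<Sum>m\<in>keys p. single m (lookup p m)) m = lookup p m"
    by (simp add: lookup_sum lookup_single when_def in_keys_iff)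
qed

lemma mpoly_induct_single [case_names zero add]:
  fixes P :: "('a \<Rightarrow>\<^sub>0 'b::comm_monoid_add) \<Rightarrow> bool"
  assumes "P 0" "\<And>m c p. P p \<Longrightarrow> P (single m c + p)"
  shows "P p"
proof -
  have "P (\<Sum>m\<in>S. single m (f m))" if "finite S" for S f
    using that assms by induction simp_all
  from this[of "keys p" "lookup p"] show ?thesis by (simp add: sum_single_lookup)
qed

lemma sum_keys_superset:
  assumes "finite S" "keys p \<subseteq> S" "\<And>m. f m 0 = 0"
  shows "(\<Sum>m\<in>keys p. f m (lookup p m)) = (\<Sum>m\<in>S. f m (lookup p m))"
  using assms by (intro sum.mono_neutral_left) (auto simp: in_keys_iff)

lemma lookup_single_mult:
  fixes f :: "('v::linorder, 'k::field) mpoly"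
  shows "lookup (single w c * f) (w + m) = c * lookup f m"
proof (induction f rule: mpoly_induct_single)
  case (add n d p)
  then show ?case by (simp add: distrib_left lookup_add mult_single lookup_single when_def)
qed simp

lemma keys_single_mult:
  fixes f :: "('v::linorder, 'k::field) mpoly"
  assumes "c \<noteq> 0"
  shows "keys (single w c * f) = (+) w ` keys f"
proof
  show "keys (single w c * f) \<subseteq> (+) w ` keys f"
    using keys_mult[of "single w c" f] assms by auto
  show "(+) w ` keys f \<subseteq> keys (single w c * f)"
    using assms by (auto simp: in_keys_iff lookup_single_mult)
qed

text \<open>Evaluation at \<open>\<sigma>\<close> with coefficients mapped by \<open>\<phi>\<close>; evaluation in the field and substitution of
  polynomials are both instances.\<close>

definition poly_ev :: "('k::field \<Rightarrow> 'r::comm_ring_1) \<Rightarrow> ('v \<Rightarrow> 'r) \<Rightarrow> ('v, 'k) mpoly \<Rightarrow> 'r" where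
  "poly_ev \<phi> \<sigma> p = (\<Sum>m\<in>keys p. \<phi> (lookup p m) * (\<Prod>v\<in>keys m. \<sigma> v ^ lookup m v))"

lemma prod_keys_eq: "(\<Prod>v\<in>keys m. \<sigma> v ^ lookup m v) = (\<Prod>v\<in>UNIV. \<sigma> v ^ lookup m v)"
  for \<sigma> :: "'v::finite \<Rightarrow> 'r::comm_ring_1"
  by (intro prod.mono_neutral_left) (auto simp: in_keys_iff)

locale coeff_hom =
  fixes \<phi> :: "'k::field \<Rightarrow> 'r::comm_ring_1"
  assumes hom_add: "\<phi> (a + b) = \<phi> a + \<phi> b"
    and hom_mult: "\<phi> (a * b) = \<phi> a * \<phi> b"
    and hom_one: "\<phi> 1 = 1"
begin

lemma hom_zero: "\<phi> 0 = 0" using hom_add[of 0 0] by simp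

lemma ev_zero: "poly_ev \<phi> \<sigma> 0 = 0" by (simp add: poly_ev_def)

lemma ev_add: "poly_ev \<phi> \<sigma> (p + q) = poly_ev \<phi> \<sigma> p + poly_ev \<phi> \<sigma> q"
proof -
  let ?S = "keys p \<union> keys q"
  let ?f = "\<lambda>m c. \<phi> c * (\<Prod>v\<in>keys m. \<sigma> v ^ lookup m v)"
  have S: "poly_ev \<phi> \<sigma> r = (\<Sum>m\<in>?S. ?f m (lookup r m))" if "keys r \<subseteq> ?S" for r
    unfolding poly_ev_def by (rule sum_keys_superset) (use that hom_zero in auto)
  show ?thesis
    by (simp add: S keys_add lookup_add hom_add distrib_right sum.distrib)
qed

lemma ev_single: "poly_ev \<phi> \<sigma> (single m c) = \<phi> c * (\<Prod>v\<in>keys m. \<sigma> v ^ lookup m v)"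
  by (cases "c = 0") (simp_all add: poly_ev_def hom_zero)

lemma ev_single_UNIV: "poly_ev \<phi> \<sigma> (single m c) = \<phi> c * (\<Prod>v\<in>UNIV. \<sigma> v ^ lookup m v)"
  for \<sigma> :: "'v::finite \<Rightarrow> 'r"
  by (simp add: ev_single prod_keys_eq)

lemma ev_mult:
  fixes p q :: "('v::finite, 'k) mpoly"
  shows "poly_ev \<phi> \<sigma> (p * q) = poly_ev \<phi> \<sigma> p * poly_ev \<phi> \<sigma> q"
proof (induction p rule: mpoly_induct_single)
  case (add m c p)
  have "poly_ev \<phi> \<sigma> (single m c * q) = poly_ev \<phi> \<sigma> (single m c) * poly_ev \<phi> \<sigma> q"
  proof (induction q rule: mpoly_induct_single)
    case (add n d q)
    then show ?case
      by (simp add: distrib_left ev_add mult_single ev_single_UNIV lookup_add power_add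
          prod.distrib hom_mult algebra_simps)
  qed (simp add: ev_zero)
  with add show ?case by (simp add: distrib_right ev_add)
qed (simp add: ev_zero)

lemma ev_one: "poly_ev \<phi> \<sigma> 1 = 1"
  using ev_single[of \<sigma> 0 1] by (simp add: hom_one)

lemma ev_var: "poly_ev \<phi> \<sigma> (mpoly_var v) = \<sigma> v"
  by (simp add: mpoly_var_def ev_single hom_one)

lemma ev_const: "poly_ev \<phi> \<sigma> (mpoly_const c) = \<phi> c"
  by (simp add: mpoly_const_def ev_single)

end

lemma mpoly_const_add: "mpoly_const (a + b) = mpoly_const a + mpoly_const b"
  and mpoly_const_mult: "mpoly_const (a * b) = mpoly_const a * mpoly_const b"
  and mpoly_const_one: "mpoly_const 1 = 1"
  by (simp_all add: mpoly_const_def single_add mult_single)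

interpretation eval: coeff_hom "\<lambda>x. x :: 'k::field"
  by unfold_locales simp_all

interpretation subst: coeff_hom mpoly_const
  by unfold_locales (simp_all add: mpoly_const_add mpoly_const_mult mpoly_const_one)

lemma mpoly_eval_eq_poly_ev: "mpoly_eval a = poly_ev (\<lambda>x. x) a"
  by (rule ext) (simp add: mpoly_eval_def poly_ev_def)

lemma mpoly_subst_eq_poly_ev: "mpoly_subst \<sigma> = poly_ev mpoly_const \<sigma>"
  by (rule ext) (simp add: mpoly_subst_def poly_ev_def)

lemmas mpoly_eval_simps = eval.ev_zero[folded mpoly_eval_eq_poly_ev] eval.ev_add[folded mpoly_eval_eq_poly_ev]
  eval.ev_mult[folded mpoly_eval_eq_poly_ev] eval.ev_one[folded mpoly_eval_eq_poly_ev]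
  eval.ev_var[folded mpoly_eval_eq_poly_ev] eval.ev_const[folded mpoly_eval_eq_poly_ev]

lemmas mpoly_subst_simps = subst.ev_zero[folded mpoly_subst_eq_poly_ev] subst.ev_add[folded mpoly_subst_eq_poly_ev]
  subst.ev_mult[folded mpoly_subst_eq_poly_ev] subst.ev_one[folded mpoly_subst_eq_poly_ev]
  subst.ev_var[folded mpoly_subst_eq_poly_ev] subst.ev_const[folded mpoly_subst_eq_poly_ev]

lemmas mpoly_eval_single = eval.ev_single[folded mpoly_eval_eq_poly_ev]
lemmas mpoly_subst_single = subst.ev_single[folded mpoly_subst_eq_poly_ev]

lemma mpoly_subst_sum: "mpoly_subst \<sigma> (sum f A) = (\<Sum>x\<in>A. mpoly_subst \<sigma> (f x))"
  by (induction A rule: infinite_finite_induct) (simp_all add: mpoly_subst_simps)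

lemma mpoly_eval_sum: "mpoly_eval a (sum f A) = (\<Sum>x\<in>A. mpoly_eval a (f x))"
  by (induction A rule: infinite_finite_induct) (simp_all add: mpoly_eval_simps)

lemma mpoly_subst_power: "mpoly_subst \<sigma> (p ^ n) = mpoly_subst \<sigma> p ^ n"
  for p :: "('v::finite, 'k::field) mpoly"
  by (induction n) (simp_all add: mpoly_subst_simps)

lemma mpoly_subst_prod: "mpoly_subst \<sigma> (prod f A) = (\<Prod>x\<in>A. mpoly_subst \<sigma> (f x))"
  for f :: "'a \<Rightarrow> ('v::finite, 'k::field) mpoly"
  by (induction A rule: infinite_finite_induct) (simp_all add: mpoly_subst_simps)

lemma mpoly_eval_power: "mpoly_eval a (p ^ n) = mpoly_eval a p ^ n"
  for p :: "('v::finite, 'k::field) mpoly"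
  by (induction n) (simp_all add: mpoly_eval_simps)

lemma mpoly_eval_prod: "mpoly_eval a (prod f A) = (\<Prod>x\<in>A. mpoly_eval a (f x))"
  for f :: "'a \<Rightarrow> ('v::finite, 'k::field) mpoly"
  by (induction A rule: infinite_finite_induct) (simp_all add: mpoly_eval_simps)

lemma mpoly_subst_subst:
  fixes p :: "('v::finite, 'k::field) mpoly" and \<sigma> :: "'v \<Rightarrow> ('w::finite, 'k) mpoly"
  shows "mpoly_subst \<tau> (mpoly_subst \<sigma> p) = mpoly_subst (\<lambda>v. mpoly_subst \<tau> (\<sigma> v)) p"
  by (induction p rule: mpoly_induct_single)
    (simp_all add: mpoly_subst_simps mpoly_subst_single mpoly_subst_prod mpoly_subst_power)

lemma mpoly_eval_subst:
  fixes p :: "('v::finite, 'k::field) mpoly" and \<sigma> :: "'v \<Rightarrow> ('w::finite, 'k) mpoly"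
  shows "mpoly_eval a (mpoly_subst \<sigma> p) = mpoly_eval (\<lambda>v. mpoly_eval a (\<sigma> v)) p"
  by (induction p rule: mpoly_induct_single)
    (simp_all add: mpoly_subst_simps mpoly_eval_simps mpoly_subst_single mpoly_eval_single mpoly_eval_prod mpoly_eval_power)

lemma mpoly_subst_var: "mpoly_subst mpoly_var p = p" for p :: "('v::finite, 'k::field) mpoly"
proof (induction p rule: mpoly_induct_single)
  case (add m c p)
  have pow: "mpoly_var v ^ n = (single (single v n) 1 :: ('v, 'k) mpoly)" for v n
    by (induction n) (simp_all add: mpoly_var_def mult_single flip: single_add)
  have "(\<Prod>v\<in>S. mpoly_var v ^ lookup m v) = (single (\<Sum>v\<in>S. single v (lookup m v)) 1 :: ('v, 'k) mpoly)" for S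
    by (induction S rule: infinite_finite_induct) (simp_all add: pow mult_single)
  then have "mpoly_subst mpoly_var (single m c) = single m c"
    by (simp add: mpoly_subst_single sum_single_lookup mpoly_const_def mult_single)
  with add show ?case by (simp add: mpoly_subst_simps)
qed (simp add: mpoly_subst_simps)

section \<open>Homogeneous ideals and linear changes of coordinates\<close>

lemma mdeg_eq: "mdeg m = (\<Sum>v\<in>UNIV. lookup m v)" for m :: "'v::finite \<Rightarrow>\<^sub>0 nat"
  unfolding mdeg_def by (intro sum.mono_neutral_left) (auto simp: in_keys_iff)

lemma mdeg_add: "mdeg (m + n) = mdeg m + mdeg n" for m :: "'v::finite \<Rightarrow>\<^sub>0 nat"
  by (simp add: mdeg_eq lookup_add sum.distrib)

lemma mdeg_single [simp]: "mdeg (single v n) = n"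
  by (cases "n = 0") (simp_all add: mdeg_def)

lemma mdeg_zero [simp]: "mdeg 0 = 0" by (simp add: mdeg_def)

lemma finite_mdeg: "finite {m :: 'v::finite \<Rightarrow>\<^sub>0 nat. mdeg m = t}"
proof (rule finite_imageD[where f = lookup])
  show "finite (lookup ` {m :: 'v \<Rightarrow>\<^sub>0 nat. mdeg m = t})"
  proof (rule finite_subset)
    show "lookup ` {m :: 'v \<Rightarrow>\<^sub>0 nat. mdeg m = t} \<subseteq> PiE UNIV (\<lambda>_. {..t})"
      by (auto simp: mdeg_eq intro: member_le_sum)
  qed (auto intro: finite_PiE)
  show "inj_on lookup {m :: 'v \<Rightarrow>\<^sub>0 nat. mdeg m = t}"
    by (rule inj_onI) (rule poly_mapping_eqI, simp)
qed

lemma keys_scale_subset: "keys (mpoly_scale c p) \<subseteq> keys p"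
proof -
  have "a = 0" if "a \<in> keys (mpoly_const c)" for a :: "'a \<Rightarrow>\<^sub>0 nat"
    using that by (cases "c = 0") (simp_all add: mpoly_const_def)
  then show ?thesis using keys_mult[of "mpoly_const c" p] by (fastforce simp: mpoly_scale_def)
qed

lemma lookup_scale: "lookup (mpoly_scale c p) m = c * lookup p m"
  for p :: "('v::linorder, 'k::field) mpoly"
  using lookup_single_mult[of 0 c p m] by (simp add: mpoly_scale_def mpoly_const_def)

lemma subspace_keys: "mpoly_vs.subspace {p :: ('a, 'b::field) mpoly. keys p \<subseteq> N}"
  unfolding mpoly_vs.subspace_def
proof (intro conjI ballI allI)
  fix p q :: "('a, 'b) mpoly" assume "p \<in> {p. keys p \<subseteq> N}" "q \<in> {p. keys p \<subseteq> N}"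
  then show "p + q \<in> {p. keys p \<subseteq> N}" using keys_add[of p q] by auto
next
  fix c p assume "p \<in> {p :: ('a, 'b) mpoly. keys p \<subseteq> N}"
  then show "mpoly_scale c p \<in> {p. keys p \<subseteq> N}" using keys_scale_subset[of c p] by auto
qed simp

lemma forms_eq: "forms t = {p. keys p \<subseteq> {m. mdeg m = t}}"
  by (auto simp: forms_def)

lemma subspace_forms: "mpoly_vs.subspace (forms t)"
  unfolding forms_eq by (rule subspace_keys)

lemma forms_mult: "f \<in> forms s \<Longrightarrow> g \<in> forms t \<Longrightarrow> f * g \<in> forms (s + t)"
  for f :: "('v::finite, 'k::field) mpoly"
  using keys_mult[of f g] by (fastforce simp: forms_def mdeg_add)

lemma forms_one: "1 \<in> forms 0" by (simp add: forms_def)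

lemma forms_var: "mpoly_var v \<in> forms 1"
  by (simp add: forms_def mpoly_var_def)

lemma forms_single: "single m c \<in> forms (mdeg m)"
  by (auto simp: forms_def)

lemma forms_prod: "(\<And>x. x \<in> A \<Longrightarrow> f x \<in> forms (d x)) \<Longrightarrow> prod f A \<in> forms (sum d A)"
  for f :: "'a \<Rightarrow> ('v::finite, 'k::field) mpoly"
  by (induction A rule: infinite_finite_induct) (auto simp: forms_one intro: forms_mult)

lemma forms_power: "f \<in> forms d \<Longrightarrow> f ^ n \<in> forms (n * d)"
  for f :: "('v::finite, 'k::field) mpoly"
  by (induction n) (auto simp: forms_one intro: forms_mult)

text \<open>The homogeneous component of degree \<open>t\<close>.\<close>

definition hpart :: "nat \<Rightarrow> ('v, 'k::field) mpoly \<Rightarrow> ('v, 'k) mpoly" where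
  "hpart t p = (\<Sum>m\<in>{m \<in> keys p. mdeg m = t}. single m (lookup p m))"

lemma lookup_hpart: "lookup (hpart t p) m = (if mdeg m = t then lookup p m else 0)"
  by (simp add: hpart_def lookup_sum lookup_single when_def in_keys_iff)

lemma hpart_forms: "hpart t p \<in> forms t"
  by (auto simp: forms_def in_keys_iff lookup_hpart split: if_splits)

lemma hpart_add: "hpart t (p + q) = hpart t p + hpart t q"
  by (rule poly_mapping_eqI) (simp add: lookup_hpart lookup_add)

lemma hpart_zero: "hpart t 0 = 0"
  by (rule poly_mapping_eqI) (simp add: lookup_hpart)

lemma hpart_of_form: "f \<in> forms s \<Longrightarrow> hpart t f = (if s = t then f else 0)"
  by (rule poly_mapping_eqI) (auto simp: lookup_hpart forms_def in_keys_iff)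

lemma hpart_single: "hpart t (single m c) = (if mdeg m = t then single m c else 0)"
  by (rule hpart_of_form[OF forms_single])

lemma sum_hpart_superset:
  assumes "finite T" "mdeg ` keys p \<subseteq> T" shows "(\<Sum>t\<in>T. hpart t p) = p"
proof (rule poly_mapping_eqI)
  fix m
  have "(\<Sum>t\<in>T. if mdeg m = t then lookup p m else 0) = (if mdeg m \<in> T then lookup p m else 0)"
    using assms(1) by simp
  moreover have "mdeg m \<in> T" if "lookup p m \<noteq> 0"
    using that assms(2) by (meson image_subset_iff in_keys_iff)
  ultimately show "lookup (\<Sum>t\<in>T. hpart t p) m = lookup p m"
    by (auto simp: lookup_sum lookup_hpart)
qed

lemma sum_hpart: "(\<Sum>t\<in>mdeg ` keys p. hpart t p) = p"
  by (rule sum_hpart_superset) simp_all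

lemma hpart_single_mult:
  "hpart t (single m c * f) = (if mdeg m \<le> t then single m c * hpart (t - mdeg m) f else 0)"
  for f :: "('v::finite, 'k::field) mpoly"
proof (induction f rule: mpoly_induct_single)
  case (add n d p)
  have "hpart t (single (m + n) (c * d)) = (if mdeg m + mdeg n = t then single (m + n) (c * d) else 0)"
    by (simp add: hpart_single mdeg_add)
  moreover have "hpart (t - mdeg m) (single n d) = (if mdeg n = t - mdeg m then single n d else 0)"
    by (rule hpart_single)
  ultimately show ?case using add by (auto simp: distrib_left hpart_add mult_single)
qed (simp add: hpart_zero)

text \<open>An ideal that contains the homogeneous components of its elements.\<close>

definition hom_ideal :: "('v, 'k::field) mpoly set \<Rightarrow> bool" where
  "hom_ideal I \<longleftrightarrow> mpoly_id.subspace I \<and> (\<forall>f\<in>I. \<forall>t. hpart t f \<in> I)"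

lemma ideal_imp_subspace: "mpoly_id.subspace I \<Longrightarrow> mpoly_vs.subspace I"
  unfolding mpoly_id.subspace_def mpoly_vs.subspace_def mpoly_scale_def by auto

lemma hom_ideal_span:
  fixes S :: "('v::finite, 'k::field) mpoly set"
  assumes "S \<subseteq> (\<Union>t. forms t)"
  shows "hom_ideal (mpoly_id.span S)"
  unfolding hom_ideal_def
proof (intro conjI ballI)
  fix f assume "f \<in> mpoly_id.span S"
  then show "\<forall>t. hpart t f \<in> mpoly_id.span S"
  proof (induction rule: mpoly_id.span_induct_alt)
    case base
    then show ?case by (simp add: hpart_zero mpoly_id.span_zero)
  next
    case (step c x y)
    have "hpart t (c * x) \<in> mpoly_id.span S" for t
    proof (induction c rule: mpoly_induct_single)
      case (add m d p)
      obtain s where "x \<in> forms s" using assms step(1) by auto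
      then have "hpart (t - mdeg m) x \<in> mpoly_id.span S"
        using step(1) by (simp add: hpart_of_form mpoly_id.span_zero mpoly_id.span_base)
      then show ?case
        using add by (auto simp: distrib_right hpart_add hpart_single_mult
            intro!: mpoly_id.span_add mpoly_id.span_scale mpoly_id.span_zero)
    qed (simp add: hpart_zero mpoly_id.span_zero)
    with step show ?case by (auto simp: hpart_add intro: mpoly_id.span_add)
  qed
qed (rule mpoly_id.subspace_span)

lemma hom_ideal_subscheme_ideal: "hom_ideal (subscheme_ideal X)"
  for X :: "'v::finite \<Rightarrow> ('v, 'k::field) mpoly set"
  unfolding subscheme_ideal_def by (rule hom_ideal_span) auto

text \<open>The linear form substituted for the \<open>j\<close>-th variable.\<close>

definition lin_forms :: "'k::field ^ 'v ^ 'v \<Rightarrow> 'v::finite \<Rightarrow> ('v, 'k) mpoly" where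
  "lin_forms g j = (\<Sum>i\<in>UNIV. mpoly_const (g $ i $ j) * mpoly_var i)"

lemma lin_change_eq: "lin_change g = mpoly_subst (lin_forms g)"
  by (simp add: lin_change_def lin_forms_def[abs_def])

lemmas lin_change_simps = mpoly_subst_simps[of "lin_forms g" for g, folded lin_change_eq]

lemma lin_change_lin_change:
  fixes g h :: "'k::field ^ 'v::finite ^ 'v"
  shows "lin_change g (lin_change h p) = lin_change (g ** h) p"
proof -
  have "mpoly_subst (lin_forms g) (lin_forms h j) = lin_forms (g ** h) j" for j
  proof -
    have "mpoly_subst (lin_forms g) (lin_forms h j)
      = (\<Sum>i\<in>UNIV. \<Sum>k\<in>UNIV. mpoly_const (h $ i $ j) * (mpoly_const (g $ k $ i) * mpoly_var k))"
    proof -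
      have "mpoly_subst (lin_forms g) (lin_forms h j) = (\<Sum>i\<in>UNIV. mpoly_const (h $ i $ j) * lin_forms g i)"
        unfolding lin_forms_def[of h] by (simp only: mpoly_subst_sum mpoly_subst_simps)
      then show ?thesis by (simp only: lin_forms_def sum_distrib_left)
    qed
    also have "\<dots> = (\<Sum>k\<in>UNIV. \<Sum>i\<in>UNIV. mpoly_const (g $ k $ i * h $ i $ j) * mpoly_var k)"
      by (subst sum.swap) (simp only: mpoly_const_mult mult_ac)
    also have "\<dots> = lin_forms (g ** h) j"
    proof -
      have c: "mpoly_const (sum f A) = (\<Sum>x\<in>A. mpoly_const (f x))" for f :: "'v \<Rightarrow> 'k" and A
        by (induction A rule: infinite_finite_induct) (simp_all add: mpoly_const_add subst.hom_zero)
      show ?thesis unfolding lin_forms_def matrix_matrix_mult_def by (simp add: c sum_distrib_right)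
    qed
    finally show ?thesis .
  qed
  then show ?thesis by (simp add: lin_change_eq mpoly_subst_subst)
qed

lemma lin_change_mat_1: "lin_change (mat 1) p = p"
  for p :: "('v::finite, 'k::field) mpoly"
proof -
  have "lin_forms (mat 1 :: 'k ^ 'v ^ 'v) j = mpoly_var j" for j
  proof -
    have "lin_forms (mat 1 :: 'k ^ 'v ^ 'v) j = (\<Sum>i\<in>UNIV. if i = j then mpoly_var i else 0)"
      unfolding lin_forms_def by (intro sum.cong) (auto simp: mat_def mpoly_const_one subst.hom_zero)
    then show ?thesis by simp
  qed
  then have "lin_forms (mat 1 :: 'k ^ 'v ^ 'v) = mpoly_var" by (rule ext)
  then show ?thesis by (simp add: lin_change_eq mpoly_subst_var)
qed

lemma lin_change_inverse:
  fixes g :: "'k::field ^ 'v::finite ^ 'v"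
  assumes "invertible g"
  obtains h where "invertible h" "\<And>p. lin_change g (lin_change h p) = p" "\<And>p. lin_change h (lin_change g p) = p"
proof -
  obtain h where "g ** h = mat 1" "h ** g = mat 1"
    using assms unfolding invertible_def by blast
  then show ?thesis using that[of h] by (auto simp: lin_change_lin_change lin_change_mat_1 invertible_def)
qed

lemma forms_lin_forms: "lin_forms g j \<in> forms 1"
proof -
  have "mpoly_const (g $ i $ j) * mpoly_var i \<in> forms 1" for i
    using mpoly_vs.subspace_scale[OF subspace_forms forms_var] by (simp add: mpoly_scale_def)
  then show ?thesis unfolding lin_forms_def by (intro mpoly_vs.subspace_sum[OF subspace_forms]) auto
qed

lemma linear_lin_change: "Vector_Spaces.linear mpoly_scale mpoly_scale (lin_change g)"
  for g :: "'k::field ^ 'v::finite ^ 'v"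
  by unfold_locales (simp_all only: lin_change_simps mpoly_scale_def)

lemma lin_change_single_form:
  "lin_change g (single m c) \<in> forms (mdeg m)"
proof -
  have "(\<Prod>v\<in>UNIV. lin_forms g v ^ lookup m v) \<in> forms (\<Sum>v\<in>UNIV. lookup m v * 1)"
    by (intro forms_prod forms_power forms_lin_forms)
  then have "(\<Prod>v\<in>keys m. lin_forms g v ^ lookup m v) \<in> forms (mdeg m)"
    by (simp add: prod_keys_eq mdeg_eq)
  from mpoly_vs.subspace_scale[OF subspace_forms this] show ?thesis
    by (simp add: lin_change_eq mpoly_subst_single mpoly_scale_def)
qed

lemma lin_change_forms:
  assumes "f \<in> forms t" shows "lin_change g f \<in> forms t"
proof -
  have "lin_change g f = (\<Sum>m\<in>keys f. lin_change g (single m (lookup f m)))"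
    by (subst sum_single_lookup[of f, symmetric]) (simp add: lin_change_eq mpoly_subst_sum)
  moreover have "lin_change g (single m (lookup f m)) \<in> forms t" if "m \<in> keys f" for m
    using lin_change_single_form[of g m] assms that by (auto simp: forms_def)
  ultimately show ?thesis
    by (simp only:) (rule mpoly_vs.subspace_sum[OF subspace_forms])
qed

lemma hpart_lin_change: "hpart t (lin_change g f) = lin_change g (hpart t f)"
proof (induction f rule: mpoly_induct_single)
  case (add m c p)
  have "hpart t (lin_change g (single m c)) = lin_change g (hpart t (single m c))"
    using hpart_of_form[OF lin_change_single_form, of t g m c] lin_change_simps(1)[of g]
    unfolding hpart_single by (cases "mdeg m = t") (simp_all only: if_True if_False refl)
  with add show ?case by (simp only: lin_change_simps hpart_add)
qed (simp only: hpart_zero lin_change_simps)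

lemma hom_ideal_lin_change:
  assumes "hom_ideal I" "invertible g"
  shows "hom_ideal (lin_change g ` I)"
proof -
  obtain h where h: "\<And>p. lin_change g (lin_change h p) = p"
    using lin_change_inverse[OF assms(2)] by metis
  have I: "mpoly_id.subspace I" using assms(1) by (simp add: hom_ideal_def)
  have "mpoly_id.subspace (lin_change g ` I)"
    unfolding mpoly_id.subspace_def
  proof (intro conjI allI ballI)
    show "0 \<in> lin_change g ` I"
      using mpoly_id.subspace_0[OF I] by (auto simp: lin_change_simps intro!: image_eqI[of _ _ 0])
  next
    fix x y assume "x \<in> lin_change g ` I" "y \<in> lin_change g ` I"
    then show "x + y \<in> lin_change g ` I"
      using mpoly_id.subspace_add[OF I] by (auto simp: lin_change_simps(2)[symmetric])
  next
    fix c x assume "x \<in> lin_change g ` I"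
    then obtain y where y: "y \<in> I" "x = lin_change g y" by blast
    then have "c * x = lin_change g (lin_change h c * y)" by (simp add: lin_change_simps h)
    then show "c * x \<in> lin_change g ` I" using y mpoly_id.subspace_scale[OF I] by blast
  qed
  then show ?thesis using assms(1) by (auto simp: hom_ideal_def hpart_lin_change)
qed

section \<open>Leading monomials\<close>

text \<open>The exponent of the leading monomial; it is meaningful only for nonzero polynomials.\<close>

definition lead :: "('v::linorder, 'k::field) mpoly \<Rightarrow> 'v \<Rightarrow>\<^sub>0 nat" where
  "lead f = Max (keys f)"

text \<open>The leading monomials of the nonzero elements of \<open>V\<close>.\<close>

definition leads :: "('v::linorder, 'k::field) mpoly set \<Rightarrow> ('v \<Rightarrow>\<^sub>0 nat) set" where
  "leads V = {lead f |f. f \<in> V \<and> f \<noteq> 0}"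

lemma keys_nonempty: "f \<noteq> 0 \<Longrightarrow> keys f \<noteq> {}"
  by simp

lemma lead_in_keys: "f \<noteq> 0 \<Longrightarrow> lead f \<in> keys f"
  by (simp add: lead_def)

lemma lookup_lead: "f \<noteq> 0 \<Longrightarrow> lookup f (lead f) \<noteq> 0"
  using lead_in_keys in_keys_iff by metis

lemma lead_ge: "m \<in> keys f \<Longrightarrow> m \<le> lead f"
  by (simp add: lead_def)

lemma lead_eqI: "lookup f u \<noteq> 0 \<Longrightarrow> (\<And>m. m \<in> keys f \<Longrightarrow> m \<le> u) \<Longrightarrow> lead f = u"
  unfolding lead_def by (intro Max_eqI) (simp_all add: in_keys_iff)

lemma lead_single: "c \<noteq> 0 \<Longrightarrow> lead (single m c) = m"
  by (simp add: lead_def)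

lemma lead_single_mult:
  fixes f :: "('v::linorder, 'k::field) mpoly"
  assumes "f \<noteq> 0"
  shows "single w 1 * f \<noteq> 0" "lead (single w 1 * f) = w + lead f"
proof -
  have k: "lookup (single w 1 * f) (w + lead f) \<noteq> 0"
    using assms by (simp add: lookup_single_mult lookup_lead)
  then show "single w 1 * f \<noteq> 0" by auto
  show "lead (single w 1 * f) = w + lead f"
    using k by (rule lead_eqI) (auto simp: keys_single_mult intro: add_left_mono lead_ge)
qed

lemma leads_single_mult:
  assumes "mpoly_id.subspace I" "u \<in> leads I" shows "w + u \<in> leads I"
proof -
  obtain f where "f \<in> I" "f \<noteq> 0" "u = lead f" using assms(2) by (auto simp: leads_def)
  moreover from this have "single w 1 * f \<in> I" using mpoly_id.subspace_scale[OF assms(1)] by blast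
  ultimately show ?thesis
    using lead_single_mult[of f w] unfolding leads_def mem_Collect_eq by metis
qed

lemma leads_subset_keys: "V \<subseteq> {f. keys f \<subseteq> N} \<Longrightarrow> leads V \<subseteq> N"
  using lead_in_keys unfolding leads_def by fastforce

text \<open>Polynomials with distinct leading monomials are independent: look at the largest monomial
  whose coefficient in a relation is nonzero.\<close>

lemma independent_echelon:
  fixes b :: "('v::linorder \<Rightarrow>\<^sub>0 nat) \<Rightarrow> ('v, 'k::field) mpoly"
  assumes "finite L" "\<And>u. u \<in> L \<Longrightarrow> b u \<noteq> 0 \<and> lead (b u) = u"
  shows "mpoly_vs.independent (b ` L)"
proof (rule mpoly_vs.independent_if_scalars_zero)
  have inj: "inj_on b L" using assms(2) by (metis inj_onI)
  fix c x assume sum: "(\<Sum>x\<in>b ` L. mpoly_scale (c x) x) = 0" and x: "x \<in> b ` L"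
  let ?C = "{u \<in> L. c (b u) \<noteq> 0}"
  show "c x = 0"
  proof (rule ccontr)
    assume "c x \<noteq> 0"
    then have ne: "?C \<noteq> {}" using x by auto
    define u where "u = Max ?C"
    have fin: "finite ?C" using assms(1) by simp
    have u: "u \<in> L" "c (b u) \<noteq> 0" using Max_in[OF fin ne] by (auto simp: u_def)
    have other: "c (b w) * lookup (b w) u = 0" if "w \<in> L - {u}" for w
    proof (cases "c (b w) = 0")
      case False
      then have "w \<le> u" using Max_ge[OF fin, of w] that by (auto simp: u_def)
      then have "w < u" using that by auto
      then have "u \<notin> keys (b w)" using assms(2)[of w] that lead_ge[of u "b w"] by auto
      then show ?thesis by (simp add: in_keys_iff)
    qed simp
    have "0 = lookup (\<Sum>x\<in>b ` L. mpoly_scale (c x) x) u" using sum by simp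
    also have "\<dots> = (\<Sum>w\<in>L. c (b w) * lookup (b w) u)"
      by (simp add: lookup_sum lookup_scale sum.reindex[OF inj])
    also have "\<dots> = c (b u) * lookup (b u) u + (\<Sum>w\<in>L - {u}. c (b w) * lookup (b w) u)"
      by (rule sum.remove[OF assms(1) u(1)])
    also have "(\<Sum>w\<in>L - {u}. c (b w) * lookup (b w) u) = 0"
      using other by (rule sum.neutral[OF ballI])
    finally show False using u assms(2)[OF u(1)] lookup_lead[of "b u"] by simp
  qed
qed (use assms(1) in simp)

text \<open>Choosing one element for each leading monomial of \<open>V\<close> gives a basis; an element of \<open>V\<close> is
  reduced by cancelling its leading term.\<close>

lemma span_echelon:
  fixes V :: "('v::linorder, 'k::field) mpoly set"
  assumes "finite N" and V: "V \<subseteq> {f. keys f \<subseteq> N}" "mpoly_vs.subspace V"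
    and b: "\<And>u. u \<in> leads V \<Longrightarrow> b u \<in> V \<and> b u \<noteq> 0 \<and> lead (b u) = u"
  shows "V \<subseteq> mpoly_vs.span (b ` leads V)"
proof
  fix f assume "f \<in> V"
  then show "f \<in> mpoly_vs.span (b ` leads V)"
  proof (induction "card {m \<in> N. m \<le> lead f}" arbitrary: f rule: less_induct)
    case less
    show ?case
    proof (cases "f = 0")
      case False
      define u where "u = lead f"
      have u: "u \<in> leads V" using less.prems False by (auto simp: leads_def u_def)
      define c where "c = lookup f u / lookup (b u) u"
      define g where "g = f - mpoly_scale c (b u)"
      have bu: "lookup (b u) u \<noteq> 0" using b[OF u] lookup_lead by metis
      have g_lookup: "lookup g m = lookup f m - c * lookup (b u) m" for m
        by (simp add: g_def lookup_minus lookup_scale)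
      have "lookup g u = 0" using bu by (simp add: g_lookup c_def)
      have keys_g: "m < u" if "m \<in> keys g" for m
      proof -
        have "m \<in> keys f \<or> m \<in> keys (b u)" using that by (auto simp: in_keys_iff g_lookup)
        then have "m \<le> u" using lead_ge[of m f] lead_ge[of m "b u"] b[OF u] by (auto simp: u_def)
        moreover have "m \<noteq> u" using that \<open>lookup g u = 0\<close> by (auto simp: in_keys_iff)
        ultimately show ?thesis by simp
      qed
      have gV: "g \<in> V" unfolding g_def
        using less.prems b[OF u] V(2) by (auto intro!: mpoly_vs.subspace_diff mpoly_vs.subspace_scale)
      have "g \<in> mpoly_vs.span (b ` leads V)"
      proof (cases "g = 0")
        case False
        have gu: "lead g < lead f" using keys_g[OF lead_in_keys[OF False]] by (simp add: u_def)
        have "lead f \<in> N" using u leads_subset_keys[OF V(1)] u_def by blast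
        then have "{m \<in> N. m \<le> lead g} \<noteq> {m \<in> N. m \<le> lead f}"
          using gu by (metis (mono_tags, lifting) mem_Collect_eq not_le order_refl)
        moreover have "{m \<in> N. m \<le> lead g} \<subseteq> {m \<in> N. m \<le> lead f}"
          using order_trans[OF _ less_imp_le[OF gu]] by blast
        ultimately have "card {m \<in> N. m \<le> lead g} < card {m \<in> N. m \<le> lead f}"
          using \<open>finite N\<close> by (intro psubset_card_mono psubsetI) simp_all
        then show ?thesis using gV by (rule less.hyps)
      qed (simp add: mpoly_vs.span_zero)
      moreover have "f = g + mpoly_scale c (b u)" by (simp add: g_def)
      ultimately show ?thesis
        using u by (metis imageI mpoly_vs.span_add mpoly_vs.span_scale mpoly_vs.span_base)
    qed (simp add: mpoly_vs.span_zero)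
  qed
qed

lemma dim_eq_card_leads:
  fixes V :: "('v::linorder, 'k::field) mpoly set"
  assumes "finite N" "V \<subseteq> {f. keys f \<subseteq> N}" "mpoly_vs.subspace V"
  shows "mpoly_vs.dim V = card (leads V)"
proof -
  have "\<forall>u\<in>leads V. \<exists>f. f \<in> V \<and> f \<noteq> 0 \<and> lead f = u" by (auto simp: leads_def)
  then obtain b where b: "\<And>u. u \<in> leads V \<Longrightarrow> b u \<in> V \<and> b u \<noteq> 0 \<and> lead (b u) = u"
    by metis
  have fin: "finite (leads V)" using leads_subset_keys[OF assms(2)] assms(1) finite_subset by blast
  show ?thesis
  proof (rule mpoly_vs.dim_unique)
    show "b ` leads V \<subseteq> V" using b by blast
    show "V \<subseteq> mpoly_vs.span (b ` leads V)" using assms b by (rule span_echelon)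
    show "mpoly_vs.independent (b ` leads V)" using fin b by (intro independent_echelon) auto
    show "card (b ` leads V) = card (leads V)" using b by (intro card_image inj_onI) metis
  qed
qed

lemma finite_basis_exists:
  fixes V :: "('v::linorder, 'k::field) mpoly set"
  assumes "finite N" "V \<subseteq> {f. keys f \<subseteq> N}" "mpoly_vs.subspace V"
  obtains B where "finite B" "B \<subseteq> V" "mpoly_vs.span B = V"
proof -
  have "\<forall>u\<in>leads V. \<exists>f. f \<in> V \<and> f \<noteq> 0 \<and> lead f = u" by (auto simp: leads_def)
  then obtain b where b: "\<And>u. u \<in> leads V \<Longrightarrow> b u \<in> V \<and> b u \<noteq> 0 \<and> lead (b u) = u"
    by metis
  have fin: "finite (leads V)" using leads_subset_keys[OF assms(2)] assms(1) finite_subset by blast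
  have sub: "b ` leads V \<subseteq> V" using b by blast
  have "V \<subseteq> mpoly_vs.span (b ` leads V)" using assms b by (rule span_echelon)
  then have "mpoly_vs.span (b ` leads V) = V"
    using mpoly_vs.span_minimal[OF sub assms(3)] by blast
  with that[of "b ` leads V"] fin sub show ?thesis by blast
qed

section \<open>Monomial ideals and their Hilbert functions\<close>

text \<open>The linear span of a set of monomials; it is an ideal when the set is closed under
  multiplication by monomials.\<close>

definition monom_span :: "('v \<Rightarrow>\<^sub>0 nat) set \<Rightarrow> ('v, 'k::field) mpoly set" where
  "monom_span L = {p. keys p \<subseteq> L}"

lemma subspace_monom_span: "mpoly_vs.subspace (monom_span L)"
  unfolding monom_span_def by (rule subspace_keys)

lemma forms_eq_monom_span: "forms t = monom_span {m. mdeg m = t}"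
  by (simp add: forms_eq monom_span_def)

lemma monom_span_Int: "monom_span L \<inter> monom_span M = monom_span (L \<inter> M)"
  by (auto simp: monom_span_def)

lemma leads_monom_span: "leads (monom_span L :: ('v::linorder, 'k::field) mpoly set) = L"
proof
  show "leads (monom_span L :: ('v, 'k) mpoly set) \<subseteq> L"
    by (rule leads_subset_keys) (simp add: monom_span_def)
  show "L \<subseteq> leads (monom_span L :: ('v, 'k) mpoly set)"
  proof
    fix u assume "u \<in> L"
    then have "single u (1::'k) \<in> monom_span L" by (simp add: monom_span_def)
    moreover have "single u (1::'k) \<noteq> 0" by (metis keys_eq_empty keys_single one_neq_zero insert_not_empty)
    ultimately show "u \<in> leads (monom_span L :: ('v, 'k) mpoly set)"
      unfolding leads_def using lead_single[of "1::'k" u] by force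
  qed
qed

lemma ideal_monom_span:
  assumes "\<And>u w. u \<in> L \<Longrightarrow> w + u \<in> L"
  shows "mpoly_id.subspace (monom_span L)"
  unfolding mpoly_id.subspace_def
proof (intro conjI ballI allI)
  fix c p assume "p \<in> (monom_span L :: ('a, 'b) mpoly set)"
  then show "c * p \<in> monom_span L"
    using keys_mult[of c p] assms by (fastforce simp: monom_span_def)
next
  fix p q :: "('a, 'b) mpoly" assume "p \<in> monom_span L" "q \<in> monom_span L"
  then show "p + q \<in> monom_span L" using keys_add[of p q] by (auto simp: monom_span_def)
qed (simp add: monom_span_def)

lemma monom_span_subset_ideal:
  assumes "mpoly_id.subspace I" "\<And>u. u \<in> L \<Longrightarrow> single u 1 \<in> I"
  shows "monom_span L \<subseteq> I"
proof
  fix p :: "('a, 'b) mpoly" assume p: "p \<in> monom_span L"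
  have "single m (lookup p m) \<in> I" if "m \<in> keys p" for m
  proof -
    have "single 0 (lookup p m) * single m 1 \<in> I"
      using mpoly_id.subspace_scale[OF assms(1)] assms(2) that p by (auto simp: monom_span_def)
    then show ?thesis by (simp add: mult_single)
  qed
  then have "(\<Sum>m\<in>keys p. single m (lookup p m)) \<in> I"
    by (rule mpoly_id.subspace_sum[OF assms(1)])
  then show "p \<in> I" by (simp add: sum_single_lookup)
qed

lemma initial_ideal_eq:
  assumes "mpoly_id.subspace I"
  shows "initial_ideal I = monom_span (leads I)"
proof -
  have eq: "{initial_monom f |f. f \<in> I \<and> f \<noteq> 0} = (\<lambda>u. single u 1) ` leads I"
    by (auto simp: leads_def initial_monom_def lead_def)
  have up: "\<And>u w. u \<in> leads I \<Longrightarrow> w + u \<in> leads I"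
    using leads_single_mult[OF assms] by blast
  show ?thesis
    unfolding initial_ideal_def eq
  proof (rule antisym)
    show "mpoly_id.span ((\<lambda>u. single u 1) ` leads I) \<subseteq> monom_span (leads I)"
      by (rule mpoly_id.span_minimal[OF _ ideal_monom_span[OF up]]) (auto simp: monom_span_def)
    show "monom_span (leads I) \<subseteq> mpoly_id.span ((\<lambda>u. single u 1) ` leads I)"
      by (rule monom_span_subset_ideal) (auto intro: mpoly_id.span_base)
  qed
qed

lemma leads_Int_forms:
  fixes I :: "('v::{finite,linorder}, 'k::field) mpoly set"
  assumes "hom_ideal I"
  shows "leads (I \<inter> forms t) = {u \<in> leads I. mdeg u = t}"
proof
  show "leads (I \<inter> forms t) \<subseteq> {u \<in> leads I. mdeg u = t}"
    using lead_in_keys by (fastforce simp: leads_def forms_def)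
  show "{u \<in> leads I. mdeg u = t} \<subseteq> leads (I \<inter> forms t)"
  proof
    fix u assume "u \<in> {u \<in> leads I. mdeg u = t}"
    then obtain f where f: "f \<in> I" "f \<noteq> 0" "u = lead f" "mdeg u = t" by (auto simp: leads_def)
    have "hpart t f \<in> I \<inter> forms t" using assms f(1) hpart_forms by (auto simp: hom_ideal_def)
    moreover have u: "lookup (hpart t f) u \<noteq> 0"
      using f lookup_lead[OF f(2)] by (simp add: lookup_hpart)
    moreover have "m \<le> u" if "m \<in> keys (hpart t f)" for m
    proof -
      have "m \<in> keys f" using that by (auto simp: in_keys_iff lookup_hpart split: if_splits)
      then show ?thesis using lead_ge f(3) by blast
    qed
    then have "lead (hpart t f) = u" by (rule lead_eqI[OF u])
    moreover have "hpart t f \<noteq> 0" using u by auto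
    ultimately show "u \<in> leads (I \<inter> forms t)" unfolding leads_def by blast
  qed
qed

text \<open>The monomials outside \<open>L\<close> represent a basis of the quotient.  Any other set of representatives
  is mapped bijectively by the projection \<open>\<pi>\<close>, which forgets the monomials in \<open>L\<close>, to a basis of the
  span of these monomials, so it has the same size.\<close>

lemma hilbert_fun_monom_span:
  fixes L :: "('v::{finite,linorder} \<Rightarrow>\<^sub>0 nat) set"
  shows "hilbert_fun (monom_span L :: ('v, 'k::field) mpoly set) t = card {u. mdeg u = t \<and> u \<notin> L}"
proof -
  let ?V = "forms t :: ('v, 'k) mpoly set"
  let ?W = "monom_span L \<inter> forms t :: ('v, 'k) mpoly set"
  let ?M = "{u :: 'v \<Rightarrow>\<^sub>0 nat. mdeg u = t \<and> u \<notin> L}"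
  let ?Q = "monom_span ?M :: ('v, 'k) mpoly set"
  have finM: "finite ?M" using finite_mdeg[of t] by (rule finite_subset[rotated]) auto
  have subW: "?W = monom_span (L \<inter> {u. mdeg u = t})"
    by (simp add: forms_eq_monom_span monom_span_Int)
  have dimQ: "mpoly_vs.dim ?Q = card ?M"
    using dim_eq_card_leads[OF finM _ subspace_monom_span[of ?M], where 'k = 'k]
    by (simp add: leads_monom_span monom_span_def[symmetric])
  define \<pi> :: "('v, 'k) mpoly \<Rightarrow> ('v, 'k) mpoly" where
    "\<pi> p = (\<Sum>m\<in>keys p - L. single m (lookup p m))" for p
  have lookup_\<pi>: "lookup (\<pi> p) m = (if m \<in> L then 0 else lookup p m)" for p m
    by (simp add: \<pi>_def lookup_sum lookup_single when_def in_keys_iff)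
  have lin: "Vector_Spaces.linear mpoly_scale mpoly_scale \<pi>"
    by unfold_locales (rule poly_mapping_eqI, simp add: lookup_\<pi> lookup_add lookup_scale)+
  then interpret \<pi>: Vector_Spaces.linear mpoly_scale mpoly_scale \<pi> .
  have \<pi>_V: "\<pi> p \<in> ?Q" "p - \<pi> p \<in> ?W" if "p \<in> ?V" for p
    using that by (auto simp: forms_def monom_span_def in_keys_iff lookup_\<pi> lookup_minus split: if_splits)
  have \<pi>_W: "\<pi> p = 0" if "p \<in> ?W" for p
    using that by (intro poly_mapping_eqI) (auto simp: lookup_\<pi> monom_span_def in_keys_iff)
  have \<pi>_Q: "\<pi> p = p" if "p \<in> ?Q" for p
    using that by (intro poly_mapping_eqI) (auto simp: lookup_\<pi> monom_span_def in_keys_iff)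
  have ex: "\<exists>B. finite B \<and> card B = card ?M \<and> B \<subseteq> ?V \<and> mpoly_vs.independent B \<and>
      mpoly_vs.span B \<inter> ?W = {0} \<and> ?V = {b + w |b w. b \<in> mpoly_vs.span B \<and> w \<in> ?W}"
  proof (intro exI conjI)
    let ?b = "\<lambda>u. single u (1::'k)"
    let ?B = "?b ` ?M"
    have ne: "?b u \<noteq> 0 \<and> lead (?b u) = u" for u :: "'v \<Rightarrow>\<^sub>0 nat"
      using lead_single[of "1::'k" u] by (metis keys_eq_empty keys_single one_neq_zero insert_not_empty)
    show "finite ?B" using finM by simp
    show "card ?B = card ?M" using ne by (intro card_image inj_onI) metis
    show "?B \<subseteq> ?V" by (auto simp: forms_def)
    show "mpoly_vs.independent ?B" using finM ne by (intro independent_echelon) auto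
    have "?Q \<subseteq> mpoly_vs.span (?b ` leads ?Q)"
    proof (rule span_echelon[OF finM _ subspace_monom_span])
      show "?Q \<subseteq> {f. keys f \<subseteq> ?M}" by (simp add: monom_span_def)
      show "?b u \<in> ?Q \<and> ?b u \<noteq> 0 \<and> lead (?b u) = u" if "u \<in> leads ?Q" for u
        using that ne[of u] unfolding leads_monom_span by (simp add: monom_span_def)
    qed
    moreover have "mpoly_vs.span ?B \<subseteq> ?Q"
      by (intro mpoly_vs.span_minimal subspace_monom_span) (auto simp: monom_span_def)
    ultimately have span: "mpoly_vs.span ?B = ?Q" by (simp add: leads_monom_span)
    show "mpoly_vs.span ?B \<inter> ?W = {0}"
      unfolding span
    proof (intro equalityI subsetI)
      fix p assume "p \<in> ?Q \<inter> ?W"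
      then show "p \<in> {0}" using \<pi>_W[of p] \<pi>_Q[of p] by (metis IntE singletonI)
    qed (simp add: monom_span_def forms_def)
    show "?V = {b + w |b w. b \<in> mpoly_vs.span ?B \<and> w \<in> ?W}"
      unfolding span
    proof (intro set_eqI iffI)
      fix p assume "p \<in> ?V"
      then have "p = \<pi> p + (p - \<pi> p)" "\<pi> p \<in> ?Q" "p - \<pi> p \<in> ?W" using \<pi>_V by auto
      then show "p \<in> {b + w |b w. b \<in> ?Q \<and> w \<in> ?W}" by blast
    next
      fix p assume "p \<in> {b + w |b w. b \<in> ?Q \<and> w \<in> ?W}"
      then obtain b w where "p = b + w" "b \<in> ?V" "w \<in> ?V"
        by (auto simp: monom_span_def forms_def)
      then show "p \<in> ?V" using mpoly_vs.subspace_add[OF subspace_forms] by blast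
    qed
  qed
  have uniq: "k = card ?M" if exB: "\<exists>B. finite B \<and> card B = k \<and> B \<subseteq> ?V \<and> mpoly_vs.independent B \<and>
      mpoly_vs.span B \<inter> ?W = {0} \<and> ?V = {b + w |b w. b \<in> mpoly_vs.span B \<and> w \<in> ?W}" for k
  proof -
    obtain B where B: "finite B" "card B = k" "B \<subseteq> ?V" "mpoly_vs.independent B"
      "mpoly_vs.span B \<inter> ?W = {0}" and V: "?V = {b + w |b w. b \<in> mpoly_vs.span B \<and> w \<in> ?W}"
      using exB by (elim exE conjE) (rule that)
    have span_V: "mpoly_vs.span B \<subseteq> ?V" using B(3) subspace_forms by (rule mpoly_vs.span_minimal)
    have inj: "inj_on \<pi> (mpoly_vs.span B)"
      unfolding \<pi>.inj_on_iff_eq_0[OF mpoly_vs.subspace_span]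
    proof (intro ballI impI)
      fix p assume p: "p \<in> mpoly_vs.span B" "\<pi> p = 0"
      then have "p \<in> ?W" using \<pi>_V(2)[of p] span_V by auto
      then show "p = 0" using B(5) p(1) by blast
    qed
    have "mpoly_vs.dim ?Q = k"
    proof (rule mpoly_vs.dim_unique)
      show "\<pi> ` B \<subseteq> ?Q" using B(3) \<pi>_V by blast
      show "?Q \<subseteq> mpoly_vs.span (\<pi> ` B)"
      proof
        fix q assume q: "q \<in> ?Q"
        then have "q \<in> ?V" by (auto simp: monom_span_def forms_def)
        then have "q \<in> {b + w |b w. b \<in> mpoly_vs.span B \<and> w \<in> ?W}"
          by (rule subsetD[OF equalityD1[OF V]])
        then obtain b w where bw: "q = b + w" "b \<in> mpoly_vs.span B" "w \<in> ?W" by blast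
        then have "q = \<pi> b" using \<pi>_Q[OF q] \<pi>_W[of w] \<pi>.add[of b w] by simp
        then show "q \<in> mpoly_vs.span (\<pi> ` B)" unfolding \<pi>.span_image using bw(2) by blast
      qed
      show "mpoly_vs.independent (\<pi> ` B)" using B(4) inj by (rule \<pi>.independent_injective_image)
      show "card (\<pi> ` B) = k"
        using B(2) inj mpoly_vs.span_superset[of B] by (metis card_image inj_on_subset)
    qed
    then show ?thesis using dimQ by simp
  qed
  show ?thesis
    unfolding hilbert_fun_def quotient_dim_def by (rule the_equality, rule ex, rule uniq)
qed

lemma ideal_colon_monom_span:
  fixes L :: "('v::linorder \<Rightarrow>\<^sub>0 nat) set"
  shows "ideal_colon (monom_span L) (single w (1::'k::field)) = monom_span {u. w + u \<in> L}"
proof -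
  have "g * single w 1 \<in> monom_span L \<longleftrightarrow> g \<in> monom_span {u. w + u \<in> L}" for g :: "('v, 'k) mpoly"
    by (subst mult.commute) (auto simp: monom_span_def keys_single_mult)
  then show ?thesis by (auto simp: ideal_colon_def)
qed

lemma mpoly_var_power: "mpoly_var v ^ n = single (single v n) 1"
  by (induction n) (simp_all add: mpoly_var_def mult_single flip: single_add)

section \<open>Polynomial functions and lines\<close>

text \<open>A ring of functions on a parameter space that contains the constants.\<close>

locale function_ring =
  fixes R :: "('p \<Rightarrow> 'k::field) set"
  assumes const_mem: "(\<lambda>_. c) \<in> R"
    and add_mem: "f \<in> R \<Longrightarrow> g \<in> R \<Longrightarrow> (\<lambda>x. f x + g x) \<in> R"
    and mult_mem: "f \<in> R \<Longrightarrow> g \<in> R \<Longrightarrow> (\<lambda>x. f x * g x) \<in> R"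
begin

lemma diff_mem: "f \<in> R \<Longrightarrow> g \<in> R \<Longrightarrow> (\<lambda>x. f x - g x) \<in> R"
  using add_mem[of f "\<lambda>x. (-1) * g x"] mult_mem[OF const_mem, of g "-1"] by simp

lemma sum_mem: "(\<And>i. i \<in> A \<Longrightarrow> f i \<in> R) \<Longrightarrow> (\<lambda>x. \<Sum>i\<in>A. f i x) \<in> R"
  by (induction A rule: infinite_finite_induct) (simp_all add: const_mem add_mem)

lemma prod_mem: "(\<And>i. i \<in> A \<Longrightarrow> f i \<in> R) \<Longrightarrow> (\<lambda>x. \<Prod>i\<in>A. f i x) \<in> R"
  by (induction A rule: infinite_finite_induct) (simp_all add: const_mem mult_mem)

lemma power_mem: "f \<in> R \<Longrightarrow> (\<lambda>x. f x ^ n) \<in> R"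
  by (induction n) (simp_all add: const_mem mult_mem)

lemma det_mem:
  fixes M :: "'p \<Rightarrow> 'k ^ 'v::finite ^ 'v"
  assumes "\<And>i j. (\<lambda>x. M x $ i $ j) \<in> R"
  shows "(\<lambda>x. det (M x)) \<in> R"
  unfolding det_def by (intro sum_mem mult_mem prod_mem const_mem assms)

end

text \<open>The polynomial functions on a parameter space with coordinates \<open>e x w\<close>.\<close>

definition poly_functions :: "('p \<Rightarrow> 'w \<Rightarrow> 'k::field) \<Rightarrow> ('p \<Rightarrow> 'k) set" where
  "poly_functions e = {\<lambda>x. mpoly_eval (e x) F |F. True}"

lemma function_ring_poly_functions: "function_ring (poly_functions e)"
  for e :: "'p \<Rightarrow> 'w::finite \<Rightarrow> 'k::field"
proof
  fix c
  show "(\<lambda>_. c) \<in> poly_functions e"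
    unfolding poly_functions_def by (intro CollectI exI[of _ "mpoly_const c"]) (simp add: mpoly_eval_simps)
next
  fix f g assume "f \<in> poly_functions e" "g \<in> poly_functions e"
  then obtain F G where "f = (\<lambda>x. mpoly_eval (e x) F)" "g = (\<lambda>x. mpoly_eval (e x) G)"
    by (auto simp: poly_functions_def)
  then have "(\<lambda>x. f x + g x) = (\<lambda>x. mpoly_eval (e x) (F + G))" "(\<lambda>x. f x * g x) = (\<lambda>x. mpoly_eval (e x) (F * G))"
    by (simp_all add: mpoly_eval_simps)
  then show "(\<lambda>x. f x + g x) \<in> poly_functions e" "(\<lambda>x. f x * g x) \<in> poly_functions e"
    unfolding poly_functions_def by blast+
qed

lemma coordinate_poly_function: "(\<lambda>x. e x w) \<in> poly_functions e"
  for e :: "'p \<Rightarrow> 'w::finite \<Rightarrow> 'k::field"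
  unfolding poly_functions_def by (intro CollectI exI[of _ "mpoly_var w"]) (simp add: mpoly_eval_simps)

text \<open>Restriction along a map \<open>l\<close> whose coordinates belong to \<open>R\<close>.\<close>

lemma poly_functions_comp:
  fixes e :: "'p \<Rightarrow> 'w::finite \<Rightarrow> 'k::field"
  assumes "function_ring R" "\<And>w. (\<lambda>s. e (l s) w) \<in> R" "f \<in> poly_functions e"
  shows "(\<lambda>s. f (l s)) \<in> R"
proof -
  interpret function_ring R by fact
  obtain F where "f = (\<lambda>x. mpoly_eval (e x) F)" using assms(3) by (auto simp: poly_functions_def)
  moreover have "(\<lambda>s. mpoly_eval (e (l s)) F) \<in> R"
    unfolding mpoly_eval_def by (intro sum_mem mult_mem prod_mem power_mem const_mem assms)
  ultimately show ?thesis by simp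
qed

definition univariate_functions :: "('k::field \<Rightarrow> 'k) set" where
  "univariate_functions = {f. \<exists>q. \<forall>s. f s = poly q s}"

lemma function_ring_univariate: "function_ring (univariate_functions :: ('k::field \<Rightarrow> 'k) set)"
proof
  fix c :: 'k
  show "(\<lambda>_. c) \<in> univariate_functions"
    unfolding univariate_functions_def by (intro CollectI exI[of _ "[:c:]"]) simp
next
  fix f g :: "'k \<Rightarrow> 'k" assume "f \<in> univariate_functions" "g \<in> univariate_functions"
  then obtain p q where "\<And>s. f s = poly p s" "\<And>s. g s = poly q s"
    by (auto simp: univariate_functions_def)
  then have "\<And>s. f s + g s = poly (p + q) s" "\<And>s. f s * g s = poly (p * q) s" by simp_all
  then show "(\<lambda>s. f s + g s) \<in> univariate_functions" "(\<lambda>s. f s * g s) \<in> univariate_functions"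
    unfolding univariate_functions_def by blast+
qed

lemma affine_univariate: "(\<lambda>s. a + s * b) \<in> univariate_functions"
  unfolding univariate_functions_def by (intro CollectI exI[of _ "[:a, b:]"]) simp

lemma finite_zeros_univariate:
  assumes "f \<in> univariate_functions" "f s0 \<noteq> 0"
  shows "finite {s. f s = 0}"
proof -
  obtain q where q: "\<And>s. f s = poly q s" using assms(1) by (auto simp: univariate_functions_def)
  then have "q \<noteq> 0" using assms(2) by auto
  then show ?thesis using poly_roots_finite q by simp
qed

lemma univariate_common_nonzero:
  fixes f g h :: "'k::field \<Rightarrow> 'k"
  assumes "infinite (UNIV :: 'k set)"
    and "f \<in> univariate_functions" "f a \<noteq> 0" "g \<in> univariate_functions" "g b \<noteq> 0"
    and "h \<in> univariate_functions" "h c \<noteq> 0"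
  obtains s where "f s \<noteq> 0" "g s \<noteq> 0" "h s \<noteq> 0"
proof -
  have "finite ({s. f s = 0} \<union> {s. g s = 0} \<union> {s. h s = 0})"
    using finite_zeros_univariate[OF assms(2,3)] finite_zeros_univariate[OF assms(4,5)]
      finite_zeros_univariate[OF assms(6,7)] by simp
  from ex_new_if_finite[OF assms(1) this]
  obtain s where "s \<notin> {s. f s = 0} \<union> {s. g s = 0} \<union> {s. h s = 0}" ..
  then show ?thesis by (intro that[of s]) simp_all
qed

text \<open>Families of polynomials, indexed by the parameter space, that are fixed finite sums of
  monomials with coefficients in \<open>R\<close>.  The number of terms being bounded makes products manageable.\<close>

inductive poly_family :: "('p \<Rightarrow> 'k::field) set \<Rightarrow> ('p \<Rightarrow> ('v, 'k) mpoly) \<Rightarrow> bool" for R where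
  zero: "poly_family R (\<lambda>_. 0)"
| add: "c \<in> R \<Longrightarrow> poly_family R v \<Longrightarrow> poly_family R (\<lambda>x. single m (c x) + v x)"

context function_ring begin

lemma poly_family_single: "c \<in> R \<Longrightarrow> poly_family R (\<lambda>x. single m (c x))"
  using poly_family.add[OF _ poly_family.zero, of c R m] by simp

lemma poly_family_add: "poly_family R v \<Longrightarrow> poly_family R w \<Longrightarrow> poly_family R (\<lambda>x. v x + w x)"
proof (induction rule: poly_family.induct)
  case (add c v m)
  then have "poly_family R (\<lambda>x. single m (c x) + (v x + w x))" by (intro poly_family.add) auto
  then show ?case by (simp add: add.assoc)
qed simp

lemma poly_family_sum: "(\<And>i. i \<in> A \<Longrightarrow> poly_family R (f i)) \<Longrightarrow> poly_family R (\<lambda>x. \<Sum>i\<in>A. f i x)"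
  by (induction A rule: infinite_finite_induct) (simp_all add: poly_family.zero poly_family_add)

lemma poly_family_mult: "poly_family R v \<Longrightarrow> poly_family R w \<Longrightarrow> poly_family R (\<lambda>x. v x * w x)"
proof (induction rule: poly_family.induct)
  case (add c v m)
  have "poly_family R (\<lambda>x. single m (c x) * w x)"
    using add.prems
  proof (induction rule: poly_family.induct)
    case (add d w n)
    have "poly_family R (\<lambda>x. single (m + n) (c x * d x) + single m (c x) * w x)"
      using add \<open>c \<in> R\<close> by (intro poly_family.add mult_mem)
    then show ?case by (simp add: distrib_left mult_single)
  qed (simp add: poly_family.zero)
  then have "poly_family R (\<lambda>x. single m (c x) * w x + v x * w x)"
    using add by (intro poly_family_add)
  then show ?case by (simp add: distrib_right)
qed (simp add: poly_family.zero)

lemma poly_family_const: "poly_family R (\<lambda>_. p)"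
proof (induction p rule: mpoly_induct_single)
  case (add m c p)
  then show ?case by (intro poly_family_add poly_family_single const_mem)
qed (rule poly_family.zero)

lemma poly_family_prod: "(\<And>i. i \<in> A \<Longrightarrow> poly_family R (f i)) \<Longrightarrow> poly_family R (\<lambda>x. \<Prod>i\<in>A. f i x)"
  by (induction A rule: infinite_finite_induct) (simp_all add: poly_family_const poly_family_mult)

lemma poly_family_power: "poly_family R f \<Longrightarrow> poly_family R (\<lambda>x. f x ^ n)"
  by (induction n) (simp_all add: poly_family_const poly_family_mult)

lemma lookup_poly_family: "poly_family R v \<Longrightarrow> (\<lambda>x. lookup (v x) n) \<in> R"
proof (induction rule: poly_family.induct)
  case (add c v m)
  have "(\<lambda>x. lookup (single m (c x)) n) \<in> R"
    using \<open>c \<in> R\<close> const_mem[of 0] by (cases "m = n") (simp_all add: lookup_single when_def)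
  then show ?case using add by (simp add: lookup_add add_mem)
qed (simp add: const_mem)

end

section \<open>Generic Gaussian elimination\<close>

lemma leads_span_insert:
  fixes f :: "('v::linorder, 'k::field) mpoly"
  assumes f: "lookup f c \<noteq> 0" "keys f \<subseteq> {..c}" and B: "B \<subseteq> {p. keys p \<subseteq> {..<c}}"
  shows "leads (mpoly_vs.span (insert f B)) = insert c (leads (mpoly_vs.span B))"
proof
  have small: "keys p \<subseteq> {..<c}" if "p \<in> mpoly_vs.span B" for p
    using mpoly_vs.span_minimal[OF B subspace_keys] that by blast
  have lead_c: "lead (mpoly_scale k f + w) = c" "mpoly_scale k f + w \<noteq> 0"
    if "k \<noteq> 0" "w \<in> mpoly_vs.span B" for k w
  proof -
    have w: "keys w \<subseteq> {..<c}" using small that(2) by blast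
    then have "lookup w c = 0" using in_keys_iff[of c w] by auto
    then have l: "lookup (mpoly_scale k f + w) c \<noteq> 0"
      using f(1) that(1) by (simp add: lookup_add lookup_scale)
    then show "mpoly_scale k f + w \<noteq> 0" by auto
    have "m \<le> c" if "m \<in> keys (mpoly_scale k f + w)" for m
      using that keys_add[of "mpoly_scale k f" w] keys_scale_subset[of k f] f(2) w
      by (meson UnE atMost_iff lessThan_iff less_imp_le subsetD)
    with l show "lead (mpoly_scale k f + w) = c" by (rule lead_eqI)
  qed
  show "leads (mpoly_vs.span (insert f B)) \<subseteq> insert c (leads (mpoly_vs.span B))"
  proof
    fix u assume "u \<in> leads (mpoly_vs.span (insert f B))"
    then obtain x where x: "x \<in> mpoly_vs.span (insert f B)" "x \<noteq> 0" "u = lead x"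
      by (auto simp: leads_def)
    then obtain k where k: "x - mpoly_scale k f \<in> mpoly_vs.span B"
      unfolding mpoly_vs.span_insert by blast
    show "u \<in> insert c (leads (mpoly_vs.span B))"
    proof (cases "k = 0")
      case True
      then have "x \<in> mpoly_vs.span B" using k by simp
      then show ?thesis using x by (auto simp: leads_def)
    next
      case False
      from lead_c(1)[OF this k] show ?thesis using x by simp
    qed
  qed
  have "c \<in> leads (mpoly_vs.span (insert f B))"
  proof -
    have "mpoly_scale 1 f + 0 \<in> mpoly_vs.span (insert f B)" by (simp add: mpoly_vs.span_base)
    then show ?thesis
      using lead_c[OF one_neq_zero mpoly_vs.span_zero] unfolding leads_def mem_Collect_eq by metis
  qed
  moreover have "leads (mpoly_vs.span B) \<subseteq> leads (mpoly_vs.span (insert f B))"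
    using mpoly_vs.span_mono[of B "insert f B"] unfolding leads_def by blast
  ultimately show "insert c (leads (mpoly_vs.span B)) \<subseteq> leads (mpoly_vs.span (insert f B))" by blast
qed

lemma (in vector_space) span_eliminate:
  assumes "a \<noteq> 0"
  shows "span (insert f ((\<lambda>v. a *s v - c v *s f) ` B)) = span (insert f B)"
proof (rule antisym; rule span_minimal[OF _ subspace_span])
  show "insert f ((\<lambda>v. a *s v - c v *s f) ` B) \<subseteq> span (insert f B)"
    by (auto intro!: span_diff span_scale intro: span_base)
  have "v \<in> span (insert f ((\<lambda>v. a *s v - c v *s f) ` B))" if "v \<in> B" for v
  proof -
    have "(a *s v - c v *s f) + c v *s f \<in> span (insert f ((\<lambda>v. a *s v - c v *s f) ` B))"
      using that by (intro span_add span_scale) (auto intro: span_base)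
    then have "a *s v \<in> span (insert f ((\<lambda>v. a *s v - c v *s f) ` B))" by simp
    then have "(1 / a) *s (a *s v) \<in> span (insert f ((\<lambda>v. a *s v - c v *s f) ` B))"
      by (rule span_scale)
    moreover have "(1 / a) *s (a *s v) = v" using assms by simp
    ultimately show ?thesis by (simp only:)
  qed
  then show "insert f B \<subseteq> span (insert f ((\<lambda>v. a *s v - c v *s f) ` B))"
    by (auto intro: span_base)
qed

text \<open>Where \<open>F\<close> does not vanish, the set of leading monomials of the span of the vectors \<open>v x\<close> does
  not depend on \<open>x\<close>.  The pivot \<open>c\<close> is the largest monomial that occurs at any point of \<open>G\<close> with
  \<open>F0 x \<noteq> 0\<close>; its coefficient in a suitable vector \<open>v1\<close> becomes a factor of \<open>F\<close>, and eliminating it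
  from the other vectors without division keeps the coefficients in \<open>R\<close>.  The factor \<open>F0\<close> allows
  the conditions for several families to be accumulated.\<close>

lemma (in function_ring) generic_leads:
  fixes vs :: "('p \<Rightarrow> ('v::linorder, 'k) mpoly) list"
  assumes "finite N"
    and "\<And>v m. v \<in> set vs \<Longrightarrow> (\<lambda>x. lookup (v x) m) \<in> R"
    and "\<And>v x. v \<in> set vs \<Longrightarrow> keys (v x) \<subseteq> N"
    and "F0 \<in> R" "x0 \<in> G" "F0 x0 \<noteq> 0"
  shows "\<exists>F\<in>R. \<exists>L. (\<exists>x\<in>G. F x \<noteq> 0) \<and>
    (\<forall>x\<in>G. F x \<noteq> 0 \<longrightarrow> F0 x \<noteq> 0 \<and> leads (mpoly_vs.span ((\<lambda>v. v x) ` set vs)) = L)"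
  using assms(2-)
proof (induction "length vs" arbitrary: vs F0 x0 rule: less_induct)
  case less
  show ?case
  proof (cases "\<exists>v\<in>set vs. \<exists>x\<in>G. F0 x \<noteq> 0 \<and> v x \<noteq> 0")
    case False
    have "leads (mpoly_vs.span ((\<lambda>v. v x) ` set vs)) = {}" if "x \<in> G" "F0 x \<noteq> 0" for x
    proof -
      have "(\<lambda>v. v x) ` set vs \<subseteq> {0}" using False that by auto
      then have "mpoly_vs.span ((\<lambda>v. v x) ` set vs) \<subseteq> {0}"
        by (rule mpoly_vs.span_minimal) (simp add: mpoly_vs.subspace_def)
      then show ?thesis by (auto simp: leads_def)
    qed
    then show ?thesis using less.prems by blast
  next
    case True
    define C where "C = {m. \<exists>v\<in>set vs. \<exists>x\<in>G. F0 x \<noteq> 0 \<and> m \<in> keys (v x)}"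
    have finC: "finite C"
      using less.prems(2) by (intro finite_subset[OF _ \<open>finite N\<close>]) (auto simp: C_def)
    have "C \<noteq> {}" using True keys_nonempty unfolding C_def by blast
    define c where "c = Max C"
    have "c \<in> C" unfolding c_def using finC \<open>C \<noteq> {}\<close> by (rule Max_in)
    then obtain v1 x1 where v1: "v1 \<in> set vs" and x1: "x1 \<in> G" "F0 x1 \<noteq> 0" "lookup (v1 x1) c \<noteq> 0"
      by (auto simp: C_def in_keys_iff)
    define e where "e v x = mpoly_scale (lookup (v1 x) c) (v x) - mpoly_scale (lookup (v x) c) (v1 x)"
      for v :: "'p \<Rightarrow> ('v, 'k) mpoly" and x
    define vs' where "vs' = map e (remove1 v1 vs)"
    have set_vs: "set vs = insert v1 (set (remove1 v1 vs))"
    proof (rule set_eqI)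
      fix v show "v \<in> set vs \<longleftrightarrow> v \<in> insert v1 (set (remove1 v1 vs))"
        using v1 by (cases "v = v1") simp_all
    qed
    have len: "length vs' < length vs"
      using v1 length_pos_if_in_set[OF v1] by (simp add: vs'_def length_remove1)
    have lookup_e: "lookup (e v x) m = lookup (v1 x) c * lookup (v x) m - lookup (v x) c * lookup (v1 x) m" for v x m
      by (simp add: e_def lookup_minus lookup_scale)
    have "\<exists>F\<in>R. \<exists>L. (\<exists>x\<in>G. F x \<noteq> 0) \<and> (\<forall>x\<in>G. F x \<noteq> 0 \<longrightarrow> F0 x * lookup (v1 x) c \<noteq> 0 \<and>
        leads (mpoly_vs.span ((\<lambda>v. v x) ` set vs')) = L)"
    proof (rule less.hyps[OF len _ _ _ x1(1)])
      fix v m assume "v \<in> set vs'"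
      then obtain w where w: "w \<in> set vs" "v = e w" using set_vs by (auto simp: vs'_def)
      then show "(\<lambda>x. lookup (v x) m) \<in> R"
        using less.prems(1) v1 by (auto simp: lookup_e intro!: diff_mem mult_mem)
    next
      fix v x assume "v \<in> set vs'"
      then obtain w where w: "w \<in> set vs" "v = e w" using set_vs by (auto simp: vs'_def)
      then have "m \<in> keys (w x) \<or> m \<in> keys (v1 x)" if "m \<in> keys (v x)" for m
        using that by (auto simp: in_keys_iff lookup_e)
      then show "keys (v x) \<subseteq> N" using less.prems(2) v1 w by blast
    next
      show "(\<lambda>x. F0 x * lookup (v1 x) c) \<in> R" using less.prems(1,3) v1 by (intro mult_mem)
    qed (use x1 in simp)
    then obtain F L where F: "F \<in> R" "\<exists>x\<in>G. F x \<noteq> 0" and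
      L: "\<And>x. x \<in> G \<Longrightarrow> F x \<noteq> 0 \<Longrightarrow> F0 x * lookup (v1 x) c \<noteq> 0 \<and> leads (mpoly_vs.span ((\<lambda>v. v x) ` set vs')) = L"
      by blast
    have "leads (mpoly_vs.span ((\<lambda>v. v x) ` set vs)) = insert c L" if x: "x \<in> G" "F x \<noteq> 0" for x
    proof -
      have F0: "F0 x \<noteq> 0" and v1c: "lookup (v1 x) c \<noteq> 0" using L[OF x] by auto
      have le_c: "keys (v x) \<subseteq> {..c}" if "v \<in> set vs" for v
      proof
        fix m assume "m \<in> keys (v x)"
        then have "m \<in> C" using that x F0 by (auto simp: C_def)
        then show "m \<in> {..c}" using finC by (simp add: c_def)
      qed
      define B where "B = (\<lambda>v. v x) ` set (remove1 v1 vs)"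
      have img: "(\<lambda>v. v x) ` set vs' = (\<lambda>w. mpoly_scale (lookup (v1 x) c) w - mpoly_scale (lookup w c) (v1 x)) ` B"
        by (auto simp: vs'_def e_def B_def image_image)
      have "(\<lambda>v. v x) ` set vs' \<subseteq> {p. keys p \<subseteq> {..<c}}"
      proof
        fix p assume "p \<in> (\<lambda>v. v x) ` set vs'"
        then obtain w where w: "w \<in> set vs" "p = e w x" using set_vs by (auto simp: vs'_def)
        have "m < c" if "m \<in> keys p" for m
        proof -
          have "m \<in> keys (w x) \<or> m \<in> keys (v1 x)" using that w by (auto simp: in_keys_iff lookup_e)
          then have "m \<le> c" using le_c[OF w(1)] le_c[OF v1] by blast
          moreover have "m \<noteq> c" using that w by (auto simp: in_keys_iff lookup_e)
          ultimately show ?thesis by simp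
        qed
        then show "p \<in> {p. keys p \<subseteq> {..<c}}" by blast
      qed
      then have "leads (mpoly_vs.span (insert (v1 x) ((\<lambda>v. v x) ` set vs'))) =
          insert c (leads (mpoly_vs.span ((\<lambda>v. v x) ` set vs')))"
        by (rule leads_span_insert[OF v1c le_c[OF v1]])
      moreover have "mpoly_vs.span (insert (v1 x) ((\<lambda>v. v x) ` set vs')) = mpoly_vs.span (insert (v1 x) B)"
        unfolding img using v1c by (rule mpoly_vs.span_eliminate)
      moreover have "insert (v1 x) B = (\<lambda>v. v x) ` set vs"
        unfolding B_def by (subst set_vs) simp
      ultimately show ?thesis using L[OF x] by simp
    qed
    then show ?thesis using F L by (intro bexI[OF _ F(1)] exI[of _ "insert c L"]) auto
  qed
qed

section \<open>Dickson's lemma\<close>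

lemma nat_seq_incseq_subseq:
  fixes f :: "nat \<Rightarrow> nat"
  obtains r where "strict_mono r" "incseq (f \<circ> r)"
proof -
  obtain s where s: "strict_mono s" "monoseq (\<lambda>n. f (s n))" using seq_monosub[of f] by blast
  show ?thesis
  proof (cases "incseq (f \<circ> s)")
    case False
    then have dec: "decseq (f \<circ> s)" using s(2) by (simp add: monoseq_iff comp_def)
    obtain N where N: "\<And>n. (f \<circ> s) N \<le> (f \<circ> s) n"
      using ex_has_least_nat[of "\<lambda>_. True" 0 "f \<circ> s"] by auto
    have const: "(f \<circ> s) (N + n) = (f \<circ> s) N" for n
      using N[of "N + n"] decseqD[OF dec, of N "N + n"] by simp
    have "incseq (f \<circ> (\<lambda>n. s (N + n)))"
      using const by (simp add: incseq_def)
    moreover have "strict_mono (\<lambda>n. s (N + n))" using s(1) by (simp add: strict_mono_def)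
    ultimately show ?thesis using that by blast
  qed (use that s in blast)
qed

text \<open>Every sequence of monomials has a subsequence on which the exponents with index
  in \<open>S\<close> are nondecreasing.\<close>

lemma dickson_subseq:
  fixes f :: "nat \<Rightarrow> 'v::finite \<Rightarrow> nat"
  shows "\<exists>r. strict_mono r \<and> (\<forall>v\<in>S. incseq (\<lambda>n. f (r n) v))"
proof (induction S rule: finite_induct[OF finite, case_names empty insert])
  case empty
  show ?case by (intro exI[of _ id]) (simp add: strict_mono_def)
next
  case (insert v S)
  then obtain r where r: "strict_mono r" "\<And>w. w \<in> S \<Longrightarrow> incseq (\<lambda>n. f (r n) w)" by blast
  obtain s where s: "strict_mono s" "incseq ((\<lambda>n. f (r n) v) \<circ> s)"
    using nat_seq_incseq_subseq .
  have "incseq (\<lambda>n. f ((r \<circ> s) n) w)" if "w \<in> insert v S" for w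
  proof (cases "w = v")
    case False
    then have "incseq (\<lambda>n. f (r n) w)" using r that by blast
    then show ?thesis using strict_mono_leD[OF s(1)] by (simp add: incseq_def)
  qed (use s(2) in \<open>simp add: comp_def\<close>)
  moreover have "strict_mono (r \<circ> s)" using r(1) s(1) by (rule strict_mono_o)
  ultimately show ?case by blast
qed

theorem dickson:
  fixes J :: "('v::finite \<Rightarrow>\<^sub>0 nat) set"
  shows "\<exists>D. finite D \<and> D \<subseteq> J \<and> (\<forall>u\<in>J. \<exists>d\<in>D. \<exists>w. u = w + d)"
proof -
  define le where "le a b \<longleftrightarrow> (\<forall>v. lookup a v \<le> lookup b v)" for a b :: "'v \<Rightarrow>\<^sub>0 nat"
  have le_add: "\<exists>w. b = w + a" if "le a b" for a b
    using that by (intro exI[of _ "b - a"] poly_mapping_eqI) (simp add: lookup_add lookup_minus le_def)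
  \<comment> \<open>the minimal elements of \<open>J\<close> under divisibility\<close>
  define D where "D = {d \<in> J. \<forall>a\<in>J. le a d \<longrightarrow> a = d}"
  have ex: "\<exists>d\<in>D. le d u" if "u \<in> J" for u
    using that
  proof (induction "mdeg u" arbitrary: u rule: less_induct)
    case less
    show ?case
    proof (cases "u \<in> D")
      case True
      then show ?thesis by (auto simp: le_def)
    next
      case False
      then obtain a where a: "a \<in> J" "le a u" "a \<noteq> u" using less.prems by (auto simp: D_def)
      then obtain v where "lookup a v \<noteq> lookup u v" by (metis poly_mapping_eqI)
      then have "lookup a v < lookup u v" using a(2) by (simp add: le_def le_neq_implies_less)
      then have "mdeg a < mdeg u"
        unfolding mdeg_eq using a(2) by (intro sum_strict_mono_ex1) (auto simp: le_def)
      then obtain d where "d \<in> D" "le d a" using less.hyps a(1) by blast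
      moreover have "le d u" using \<open>le d a\<close> a(2) unfolding le_def by (metis le_trans)
      ultimately show ?thesis by blast
    qed
  qed
  have "finite D"
  proof (rule ccontr)
    assume "infinite D"
    then obtain f :: "nat \<Rightarrow> 'v \<Rightarrow>\<^sub>0 nat" where f: "inj f" "range f \<subseteq> D"
      using infinite_countable_subset by blast
    obtain r where r: "strict_mono r" "\<And>v. incseq (\<lambda>n. lookup (f (r n)) v)"
      using dickson_subseq[of UNIV "\<lambda>n. lookup (f n)"] by blast
    have "le (f (r 0)) (f (r 1))"
      unfolding le_def using incseqD[OF r(2), of 0 1] by simp
    moreover have "f (r 0) \<in> J" "f (r 1) \<in> D" using f(2) by (auto simp: D_def)
    ultimately have "f (r 0) = f (r 1)" by (auto simp: D_def)
    then show False using f(1) strict_monoD[OF r(1), of 0 1] by (simp add: inj_eq)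
  qed
  moreover have "D \<subseteq> J" by (auto simp: D_def)
  moreover have "\<exists>d\<in>D. \<exists>w. u = w + d" if "u \<in> J" for u
    using ex[OF that] le_add by blast
  ultimately show ?thesis by blast
qed

section \<open>The generic initial ideal\<close>

text \<open>The polynomial functions in the entries of a square matrix.\<close>

definition matrix_functions :: "('k::field ^ 'v::finite ^ 'v \<Rightarrow> 'k) set" where
  "matrix_functions = poly_functions (\<lambda>g (i, j). g $ i $ j)"

lemma function_ring_matrix_functions: "function_ring matrix_functions"
  unfolding matrix_functions_def by (rule function_ring_poly_functions)

lemma entry_matrix_function: "(\<lambda>g. g $ i $ j) \<in> matrix_functions"
  using coordinate_poly_function[of "\<lambda>g (i, j). g $ i $ j" "(i, j)"] by (simp add: matrix_functions_def)

lemma poly_family_lin_change: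
  fixes f :: "('v::finite, 'k::field) mpoly"
  shows "poly_family matrix_functions (\<lambda>g. lin_change g f)"
proof -
  interpret function_ring "matrix_functions :: ('k ^ 'v ^ 'v \<Rightarrow> 'k) set"
    by (rule function_ring_matrix_functions)
  have lin: "poly_family matrix_functions (\<lambda>g :: 'k ^ 'v ^ 'v. lin_forms g j)" for j
    unfolding lin_forms_def mpoly_const_def
    by (intro poly_family_sum poly_family_mult poly_family_single poly_family_const entry_matrix_function)
  show ?thesis
    unfolding lin_change_eq mpoly_subst_def
    by (intro poly_family_sum poly_family_mult poly_family_prod poly_family_power poly_family_const lin)
qed

lemma lin_change_image_Int_forms:
  assumes "invertible g"
  shows "lin_change g ` I \<inter> forms t = lin_change g ` (I \<inter> forms t)"
proof
  obtain h where h: "\<And>p. lin_change h (lin_change g p) = p"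
    using lin_change_inverse[OF assms] by metis
  show "lin_change g ` I \<inter> forms t \<subseteq> lin_change g ` (I \<inter> forms t)"
  proof
    fix p assume p: "p \<in> lin_change g ` I \<inter> forms t"
    then obtain f where f: "f \<in> I" "p = lin_change g f" by blast
    then have "f \<in> forms t" using lin_change_forms[of p t h] p h by simp
    then show "p \<in> lin_change g ` (I \<inter> forms t)" using f by blast
  qed
  show "lin_change g ` (I \<inter> forms t) \<subseteq> lin_change g ` I \<inter> forms t"
    using lin_change_forms by blast
qed

lemma inj_lin_change: "invertible g \<Longrightarrow> inj (lin_change g)"
  using lin_change_inverse[of g] by (metis injI)

lemma dim_lin_change_image:
  assumes "invertible g"
  shows "mpoly_vs.dim (lin_change g ` V) = mpoly_vs.dim V"
proof -
  interpret lin: Vector_Spaces.linear mpoly_scale mpoly_scale "lin_change g" by (rule linear_lin_change)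
  obtain B where B: "B \<subseteq> V" "mpoly_vs.independent B" "V \<subseteq> mpoly_vs.span B" "card B = mpoly_vs.dim V"
    using mpoly_vs.basis_exists .
  show ?thesis
  proof (rule mpoly_vs.dim_unique)
    show "lin_change g ` B \<subseteq> lin_change g ` V" using B(1) by (rule image_mono)
    show "lin_change g ` V \<subseteq> mpoly_vs.span (lin_change g ` B)"
      unfolding lin.span_image using B(3) by (rule image_mono)
    show "mpoly_vs.independent (lin_change g ` B)"
      using B(2) inj_lin_change[OF assms] by (intro lin.independent_injective_image) (auto intro: inj_on_subset)
    show "card (lin_change g ` B) = mpoly_vs.dim V"
      using B(4) inj_lin_change[OF assms] by (metis card_image inj_on_subset subset_UNIV)
  qed
qed

lemma forms_subset_keys: "I \<inter> forms t \<subseteq> {f. keys f \<subseteq> {m. mdeg m = t}}"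
  by (auto simp: forms_eq)

lemma hom_ideal_Int_forms_subspace: "hom_ideal I \<Longrightarrow> mpoly_vs.subspace (I \<inter> forms t)"
  by (intro mpoly_vs.subspace_inter ideal_imp_subspace subspace_forms) (simp add: hom_ideal_def)

lemma generic_leads_degree:
  fixes I :: "('v::{finite,linorder}, 'k::field) mpoly set"
  assumes "hom_ideal I" "F0 \<in> matrix_functions" "\<exists>g. invertible g \<and> F0 g \<noteq> 0"
  shows "\<exists>F\<in>matrix_functions. \<exists>L. (\<exists>g. invertible g \<and> F g \<noteq> 0) \<and>
    (\<forall>g. invertible g \<and> F g \<noteq> 0 \<longrightarrow> F0 g \<noteq> 0 \<and> leads (lin_change g ` I \<inter> forms t) = L)"
proof -
  let ?N = "{m :: 'v \<Rightarrow>\<^sub>0 nat. mdeg m = t}"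
  obtain B where B: "finite B" "B \<subseteq> I \<inter> forms t" "mpoly_vs.span B = I \<inter> forms t"
    using finite_basis_exists[OF finite_mdeg forms_subset_keys hom_ideal_Int_forms_subspace[OF assms(1)]] .
  obtain bs where bs: "set bs = B" using B(1) finite_list by blast
  define vs where "vs = map (\<lambda>f (g :: (('k, 'v) vec, 'v) vec). lin_change g f) bs"
  have vs: "(\<lambda>v. v g) ` set vs = lin_change g ` B" for g
    by (simp add: vs_def bs[symmetric] image_image)
  obtain g0 where g0: "g0 \<in> {g. invertible g}" "F0 g0 \<noteq> 0" using assms(3) by blast
  have "\<exists>F\<in>matrix_functions. \<exists>L. (\<exists>g\<in>{g. invertible g}. F g \<noteq> 0) \<and> (\<forall>g\<in>{g. invertible g}. F g \<noteq> 0 \<longrightarrow>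
      F0 g \<noteq> 0 \<and> leads (mpoly_vs.span ((\<lambda>v. v g) ` set vs)) = L)"
  proof (rule function_ring.generic_leads[OF function_ring_matrix_functions finite_mdeg[of t] _ _ assms(2) g0])
    fix v m assume "v \<in> set vs"
    then obtain f where f: "f \<in> B" "v = (\<lambda>g. lin_change g f)" by (auto simp: vs_def bs)
    then show "(\<lambda>g. lookup (v g) m) \<in> matrix_functions"
      using function_ring.lookup_poly_family[OF function_ring_matrix_functions poly_family_lin_change[of f]] by simp
    fix g show "keys (v g) \<subseteq> ?N"
      using lin_change_forms[of f t g] f B(2) by (auto simp: forms_eq)
  qed
  moreover have "mpoly_vs.span ((\<lambda>v. v g) ` set vs) = lin_change g ` I \<inter> forms t" if "invertible g" for g
  proof -
    interpret lin: Vector_Spaces.linear mpoly_scale mpoly_scale "lin_change g" by (rule linear_lin_change)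
    show ?thesis unfolding vs lin.span_image B(3) lin_change_image_Int_forms[OF that] ..
  qed
  ultimately show ?thesis by auto
qed

text \<open>The conditions \<open>F t\<close> for the degrees \<open>t\<close> are chosen so that each implies the previous ones.  The
  resulting sets \<open>L t\<close> together form a set \<open>J\<close> closed under multiplication, generated in degrees at most
  some \<open>T\<close>.  Where \<open>F T\<close> does not vanish all of \<open>J\<close> consists of leading monomials, and there
  are no others because their number in each degree is the dimension of the component of the ideal.\<close>

theorem generic_leads_ideal:
  fixes I :: "('v::{finite,linorder}, 'k::field) mpoly set"
  assumes "hom_ideal I"
  obtains F L where "F \<in> matrix_functions" "\<exists>g. invertible g \<and> F g \<noteq> 0"
    "\<And>g. invertible g \<Longrightarrow> F g \<noteq> 0 \<Longrightarrow> leads (lin_change g ` I) = L"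
proof -
  define P where "P t = (\<lambda>(F, L). F \<in> matrix_functions \<and> (\<exists>g. invertible g \<and> F g \<noteq> 0) \<and>
      (\<forall>g. invertible g \<and> F g \<noteq> 0 \<longrightarrow> leads (lin_change g ` I \<inter> forms t) = L))"
    for t and x :: "((('k, 'v) vec, 'v) vec \<Rightarrow> 'k) \<times> ('v \<Rightarrow>\<^sub>0 nat) set"
  define Q where "Q = (\<lambda>(F, L :: ('v \<Rightarrow>\<^sub>0 nat) set) (F', L' :: ('v \<Rightarrow>\<^sub>0 nat) set).
      \<forall>g :: (('k, 'v) vec, 'v) vec. invertible g \<and> F' g \<noteq> (0 :: 'k) \<longrightarrow> F g \<noteq> (0 :: 'k))"
  have "\<exists>f. \<forall>t. P t (f t) \<and> Q (f t) (f (Suc t))"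
  proof (rule dependent_nat_choice)
    have "invertible (mat 1 :: (('k, 'v) vec, 'v) vec)"
      unfolding invertible_def by (intro exI[of _ "mat 1"]) simp
    then have "\<exists>g :: (('k, 'v) vec, 'v) vec. invertible g \<and> (1::'k) \<noteq> 0" by auto
    from generic_leads_degree[OF assms function_ring.const_mem[OF function_ring_matrix_functions] this, of 0]
    show "\<exists>x. P 0 x" by (auto simp: P_def)
  next
    fix x t assume "P t x"
    then have "fst x \<in> matrix_functions" "\<exists>g. invertible g \<and> fst x g \<noteq> 0"
      by (auto simp: P_def split: prod.splits)
    from generic_leads_degree[OF assms this, of "Suc t"]
    obtain F L where "F \<in> matrix_functions" "\<exists>g. invertible g \<and> F g \<noteq> 0"
      "\<And>g. invertible g \<and> F g \<noteq> 0 \<longrightarrow> fst x g \<noteq> 0 \<and> leads (lin_change g ` I \<inter> forms (Suc t)) = L"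
      by blast
    then have "P (Suc t) (F, L) \<and> Q x (F, L)" by (auto simp: P_def Q_def split: prod.splits)
    then show "\<exists>y. P (Suc t) y \<and> Q x y" ..
  qed
  then obtain f where f: "\<And>t. P t (f t)" "\<And>t. Q (f t) (f (Suc t))" by blast
  define F where "F t = fst (f t)" for t
  define L where "L t = snd (f t)" for t
  have F: "F t \<in> matrix_functions" "\<exists>g. invertible g \<and> F t g \<noteq> 0" for t
    using f(1)[of t] by (auto simp: P_def F_def split: prod.splits)
  have L_self: "leads (lin_change g ` I \<inter> forms t) = L t" if "invertible g" "F t g \<noteq> 0" for t g
    using f(1)[of t] that by (auto simp: P_def F_def L_def split: prod.splits)
  have step: "F t g \<noteq> 0" if "invertible g" "F (Suc t) g \<noteq> 0" for t g
    using f(2)[of t] that by (auto simp: Q_def F_def split: prod.splits)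
  have mono: "F s g \<noteq> 0" if "invertible g" "F t g \<noteq> 0" "s \<le> t" for s t g
    using that(3) by (induction rule: inc_induct) (rule that(2), rule step[OF that(1)])
  have L: "leads (lin_change g ` I \<inter> forms s) = L s" if "invertible g" "F t g \<noteq> 0" "s \<le> t" for s t g
    by (rule L_self[OF that(1) mono[OF that]])
  have L_eq: "L s = {u \<in> leads (lin_change g ` I). mdeg u = s}" if "invertible g" "F t g \<noteq> 0" "s \<le> t" for s t g
    using L[OF that] leads_Int_forms[OF hom_ideal_lin_change[OF assms that(1)]] by simp
  define J where "J = (\<Union>t. L t)"
  obtain D where D: "finite D" "D \<subseteq> J" "\<forall>u\<in>J. \<exists>d\<in>D. \<exists>w. u = w + d"
    using dickson[of J] by metis
  define T where "T = Max (insert 0 (mdeg ` D))"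
  have T: "mdeg d \<le> T" if "d \<in> D" for d using D(1) that by (simp add: T_def)
  have leads_J: "leads (lin_change g ` I) = J" if g: "invertible g" "F T g \<noteq> 0" for g
  proof -
    have idl: "hom_ideal (lin_change g ` I)" using assms g(1) by (rule hom_ideal_lin_change)
    have J_sub: "J \<subseteq> leads (lin_change g ` I)"
    proof
      fix u assume "u \<in> J"
      then obtain d w where d: "d \<in> D" "u = w + d" using D(3) by blast
      then obtain t where t: "d \<in> L t" using D(2) by (auto simp: J_def)
      obtain g' where "invertible g'" "F t g' \<noteq> 0" using F(2) by blast
      then have "mdeg d = t" using L_eq[of g' t t] t by simp
      then have "d \<in> leads (lin_change g ` I)" using L_eq[OF g T[OF d(1)]] t by simp
      then show "u \<in> leads (lin_change g ` I)"
        using idl d(2) by (auto simp: hom_ideal_def intro: leads_single_mult)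
    qed
    have "u \<in> J" if u: "u \<in> leads (lin_change g ` I)" for u
    proof -
      define t where "t = mdeg u"
      have card: "card (leads (lin_change g ` I \<inter> forms t)) = mpoly_vs.dim (I \<inter> forms t)" if "invertible g" for g
      proof -
        have "mpoly_vs.dim (lin_change g ` I \<inter> forms t) = card (leads (lin_change g ` I \<inter> forms t))"
          by (rule dim_eq_card_leads[OF finite_mdeg forms_subset_keys
                hom_ideal_Int_forms_subspace[OF hom_ideal_lin_change[OF assms that]]])
        then show ?thesis
          unfolding lin_change_image_Int_forms[OF that] dim_lin_change_image[OF that] by simp
      qed
      obtain g' where g': "invertible g'" "F t g' \<noteq> 0" using F(2) by blast
      have "L t \<subseteq> leads (lin_change g ` I \<inter> forms t)"
        using J_sub L_eq[OF g' order_refl] leads_Int_forms[OF idl] by (auto simp: J_def)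
      moreover have "card (L t) = card (leads (lin_change g ` I \<inter> forms t))"
        using card[OF g(1)] card[OF g'(1)] L[OF g' order_refl] by simp
      moreover have "finite (leads (lin_change g ` I \<inter> forms t))"
        using leads_subset_keys[OF forms_subset_keys] finite_mdeg finite_subset by blast
      ultimately have "L t = leads (lin_change g ` I \<inter> forms t)" by (metis card_subset_eq)
      then show ?thesis
        using u leads_Int_forms[OF idl] by (auto simp: J_def t_def)
    qed
    then show ?thesis using J_sub by blast
  qed
  show ?thesis by (rule that[OF F leads_J])
qed

lemma GL_open_principal:
  assumes "F \<in> matrix_functions"
  shows "GL_open {g. invertible g \<and> F g \<noteq> 0}"
proof -
  obtain P where "F = (\<lambda>g. mpoly_eval (\<lambda>(i, j). g $ i $ j) P)"
    using assms by (auto simp: matrix_functions_def poly_functions_def)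
  then show ?thesis unfolding GL_open_def by (intro exI[of _ "{P}"]) auto
qed

text \<open>On the line \<open>l\<close> through a point of each set the two conditions and the determinant are nonzero
  univariate polynomials, which have a common nonzero over an infinite field.\<close>

lemma GL_open_Int_nonempty:
  fixes U V :: "('k::field ^ 'v::finite ^ 'v) set"
  assumes "infinite (UNIV :: 'k set)" "GL_open U" "U \<noteq> {}" "GL_open V" "V \<noteq> {}"
  shows "U \<inter> V \<noteq> {}"
proof -
  have *: "\<exists>F g. F \<in> matrix_functions \<and> F g \<noteq> 0 \<and> invertible g \<and> (\<forall>g. invertible g \<and> F g \<noteq> 0 \<longrightarrow> g \<in> W)"
    if W: "GL_open W" "W \<noteq> {}" for W :: "('k ^ 'v ^ 'v) set"
  proof -
    obtain S where S: "W = {g. invertible g \<and> (\<exists>F\<in>S. mpoly_eval (\<lambda>(i, j). g $ i $ j) F \<noteq> 0)}"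
      using W(1) unfolding GL_open_def by (elim exE) (rule that)
    then obtain g F where gF: "invertible g" "F \<in> S" "mpoly_eval (\<lambda>(i, j). g $ i $ j) F \<noteq> 0"
      using W(2) by blast
    have "(\<lambda>g. mpoly_eval (\<lambda>(i, j). g $ i $ j) F) \<in> matrix_functions"
      by (auto simp: matrix_functions_def poly_functions_def)
    then show ?thesis using S gF by (intro exI[of _ "\<lambda>g. mpoly_eval (\<lambda>(i, j). g $ i $ j) F"] exI[of _ g]) auto
  qed
  obtain F g where F: "F \<in> matrix_functions" "F g \<noteq> 0" "invertible g" "\<And>g. invertible g \<Longrightarrow> F g \<noteq> 0 \<Longrightarrow> g \<in> U"
    using *[OF assms(2,3)] by blast
  obtain G h where G: "G \<in> matrix_functions" "G h \<noteq> 0" "\<And>g. invertible g \<Longrightarrow> G g \<noteq> 0 \<Longrightarrow> g \<in> V"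
    using *[OF assms(4,5)] by blast
  define l where "l s = (\<chi> i j. g $ i $ j + s * (h $ i $ j - g $ i $ j))" for s :: 'k
  have l: "l 0 = g" "l 1 = h" by (simp_all add: l_def vec_eq_iff)
  interpret function_ring "univariate_functions :: ('k \<Rightarrow> 'k) set" by (rule function_ring_univariate)
  have entry: "(\<lambda>s. l s $ i $ j) \<in> univariate_functions" for i j
    by (simp add: l_def affine_univariate)
  have comp: "(\<lambda>s. E (l s)) \<in> univariate_functions" if "E \<in> matrix_functions" for E
    by (rule poly_functions_comp[OF function_ring_univariate _ that[unfolded matrix_functions_def]])
      (auto intro: entry split: prod.splits)
  have det: "(\<lambda>s. det (l s)) \<in> univariate_functions" using entry by (rule det_mem)
  obtain s where "F (l s) \<noteq> 0" "G (l s) \<noteq> 0" "det (l s) \<noteq> 0"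
    by (rule univariate_common_nonzero[OF assms(1) comp[OF F(1)] _ comp[OF G(1)] _ det, of 0 1 0])
      (use l F G in \<open>simp_all add: invertible_det_nz\<close>)
  then show ?thesis using F(4) G(3) by (auto simp: invertible_det_nz)
qed

lemma gin_eq:
  fixes I :: "('v::{finite,linorder}, 'k::field) mpoly set"
  assumes "infinite (UNIV :: 'k set)" "hom_ideal I" "F \<in> matrix_functions" "\<exists>g. invertible g \<and> F g \<noteq> 0"
    and L: "\<And>g. invertible g \<Longrightarrow> F g \<noteq> 0 \<Longrightarrow> leads (lin_change g ` I) = L"
  shows "gin I = monom_span L"
proof -
  let ?U = "{g. invertible g \<and> F g \<noteq> 0}"
  have init: "initial_ideal (lin_change g ` I) = monom_span L" if "g \<in> ?U" for g
    using initial_ideal_eq[of "lin_change g ` I"] hom_ideal_lin_change[OF assms(2), of g] L[of g] that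
    by (simp add: hom_ideal_def)
  show ?thesis
    unfolding gin_def
  proof (rule the_equality)
    show "\<exists>U. GL_open U \<and> U \<noteq> {} \<and> (\<forall>g\<in>U. initial_ideal (lin_change g ` I) = monom_span L)"
      using GL_open_principal[OF assms(3)] assms(4) init by (intro exI[of _ ?U]) blast
  next
    fix J assume "\<exists>U. GL_open U \<and> U \<noteq> {} \<and> (\<forall>g\<in>U. initial_ideal (lin_change g ` I) = J)"
    then obtain U where U: "GL_open U" "U \<noteq> {}" "\<forall>g\<in>U. initial_ideal (lin_change g ` I) = J" by blast
    have "?U \<noteq> {}" using assms(4) by blast
    from GL_open_Int_nonempty[OF assms(1) U(1,2) GL_open_principal[OF assms(3)] this]
    obtain g where "g \<in> U" "g \<in> ?U" by blast
    then show "J = monom_span L" using U(3) init by metis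
  qed
qed

section \<open>Powers of the ideal of a coordinate point\<close>

text \<open>The index of \<open>x\<^sub>0\<close>.\<close>

abbreviation (input) first_var :: "'v::{finite,linorder}" where "first_var \<equiv> Min UNIV"

text \<open>The point \<open>(1 : 0 : \<dots> : 0)\<close>.\<close>

definition first_point :: "'k::field ^ 'v::{finite,linorder}" where
  "first_point = (\<chi> v. if v = first_var then 1 else 0)"

lemma first_point_nth: "first_point $ v = (if v = first_var then 1 else 0)"
  by (simp add: first_point_def)

lemma lookup_le_mdeg: "lookup u v \<le> mdeg u" for u :: "'v::finite \<Rightarrow>\<^sub>0 nat"
  unfolding mdeg_eq by (rule member_le_sum) simp_all

lemma mdeg_eq_lookup_iff: "lookup u v = mdeg u \<longleftrightarrow> u = single v (mdeg u)"
  for u :: "'v::finite \<Rightarrow>\<^sub>0 nat"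
proof
  assume eq: "lookup u v = mdeg u"
  have "mdeg u = lookup u v + sum (lookup u) (UNIV - {v})"
    unfolding mdeg_eq by (rule sum.remove) simp_all
  then have "sum (lookup u) (UNIV - {v}) = 0" using eq by simp
  then have "lookup u w = 0" if "w \<noteq> v" for w using that by simp
  then show "u = single v (mdeg u)"
    using eq by (intro poly_mapping_eqI) (auto simp: lookup_single when_def)
next
  assume "u = single v (mdeg u)"
  then show "lookup u v = mdeg u" by (metis lookup_single_eq)
qed

lemma eval_first_point:
  fixes f :: "('v::{finite,linorder}, 'k::field) mpoly"
  assumes "f \<in> forms t"
  shows "mpoly_eval (($) first_point) f = lookup f (single first_var t)"
proof -
  have "lookup f m * (\<Prod>v\<in>keys m. first_point $ v ^ lookup m v) =
      (if m = single first_var t then lookup f m else 0)" if "m \<in> keys f" for m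
  proof (cases "m = single first_var t")
    case True
    then show ?thesis by (simp add: prod_keys_eq first_point_nth lookup_single when_def)
  next
    case False
    have "mdeg m = t" using assms that by (simp add: forms_def)
    then have "m \<noteq> single first_var (lookup m first_var)" using False by (metis mdeg_single)
    then obtain v where v: "v \<noteq> first_var" "lookup m v \<noteq> 0"
      by (metis lookup_single_eq lookup_single_not_eq poly_mapping_eqI)
    then have "(\<Prod>v\<in>UNIV. (first_point :: ('k, 'v) vec) $ v ^ lookup m v) = 0"
      by (intro prod_zero) (auto simp: first_point_nth zero_power)
    then show ?thesis using False by (simp add: prod_keys_eq)
  qed
  then have "mpoly_eval (($) first_point) f = (\<Sum>m\<in>keys f. if m = single first_var t then lookup f m else 0)"
    unfolding mpoly_eval_def by (rule sum.cong[OF refl])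
  then show ?thesis by (simp add: in_keys_iff)
qed

text \<open>The monomials of degree at least \<open>m\<close> in the variables other than \<open>x\<^sub>0\<close>; these are the monomials
  that vanish to order \<open>m\<close> at \<open>(1 : 0 : \<dots> : 0)\<close>.\<close>

definition vanishing_monoms :: "nat \<Rightarrow> ('v::{finite,linorder} \<Rightarrow>\<^sub>0 nat) set" where
  "vanishing_monoms m = {u. m + lookup u first_var \<le> mdeg u}"

lemma vanishing_monoms_add:
  "u \<in> vanishing_monoms m \<Longrightarrow> w \<in> vanishing_monoms n \<Longrightarrow> u + w \<in> vanishing_monoms (m + n)"
  by (simp add: vanishing_monoms_def lookup_add mdeg_add)

lemma vanishing_monoms_0: "vanishing_monoms 0 = UNIV"
  by (simp add: vanishing_monoms_def lookup_le_mdeg)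

lemma ideal_vanishing_monoms: "mpoly_id.subspace (monom_span (vanishing_monoms m))"
  for m :: nat
proof (rule ideal_monom_span)
  fix u w :: "'a::{finite,linorder} \<Rightarrow>\<^sub>0 nat" assume "u \<in> vanishing_monoms m"
  then show "w + u \<in> vanishing_monoms m"
    using vanishing_monoms_add[of w 0 u m] by (simp add: vanishing_monoms_0)
qed

lemma point_ideal_first_point:
  "point_ideal (first_point :: 'k::field ^ 'v::{finite,linorder}) = monom_span (vanishing_monoms 1)"
proof
  show "point_ideal (first_point :: ('k, 'v) vec) \<subseteq> monom_span (vanishing_monoms 1)"
    unfolding point_ideal_def
  proof (rule mpoly_id.span_minimal[OF _ ideal_vanishing_monoms], rule subsetI)
    fix f :: "('v, 'k) mpoly" assume "f \<in> {f. (\<exists>t. f \<in> forms t) \<and> mpoly_eval (($) first_point) f = 0}"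
    then obtain t where t: "f \<in> forms t" "lookup f (single first_var t) = 0"
      using eval_first_point by fastforce
    have "u \<in> vanishing_monoms 1" if "u \<in> keys f" for u
    proof -
      have "mdeg u = t" "u \<noteq> single first_var t" using t that by (auto simp: forms_def in_keys_iff)
      then have "lookup u first_var \<noteq> mdeg u" using mdeg_eq_lookup_iff[of u first_var] by simp
      then show ?thesis using lookup_le_mdeg[of u first_var] by (simp add: vanishing_monoms_def)
    qed
    then show "f \<in> monom_span (vanishing_monoms 1)" by (auto simp: monom_span_def)
  qed
  show "monom_span (vanishing_monoms 1) \<subseteq> point_ideal (first_point :: ('k, 'v) vec)"
  proof (rule monom_span_subset_ideal)
    show "mpoly_id.subspace (point_ideal (first_point :: ('k, 'v) vec))"
      unfolding point_ideal_def by (rule mpoly_id.subspace_span)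
    fix u :: "'v \<Rightarrow>\<^sub>0 nat" assume "u \<in> vanishing_monoms 1"
    then have "lookup u first_var \<noteq> mdeg u" by (simp add: vanishing_monoms_def)
    then have "u \<noteq> single first_var (mdeg u)" using mdeg_eq_lookup_iff[of u first_var] by simp
    then have "mpoly_eval (($) first_point) (single u (1::'k)) = 0"
      by (simp add: eval_first_point[OF forms_single] lookup_single when_def)
    then show "single u 1 \<in> point_ideal (first_point :: ('k, 'v) vec)"
      unfolding point_ideal_def using forms_single[of u "1::'k"] by (intro mpoly_id.span_base) blast
  qed
qed

lemma ideal_power_first_point:
  "ideal_power (point_ideal (first_point :: 'k::field ^ 'v::{finite,linorder})) m = monom_span (vanishing_monoms m)"
proof (induction m)
  case 0
  show ?case by (simp add: vanishing_monoms_0 monom_span_def)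
next
  case (Suc m)
  have "ideal_prod (monom_span (vanishing_monoms 1)) (monom_span (vanishing_monoms m)) =
      (monom_span (vanishing_monoms (Suc m)) :: ('v, 'k) mpoly set)" (is "?P = ?M")
  proof
    show "?P \<subseteq> ?M"
      unfolding ideal_prod_def
    proof (rule mpoly_id.span_minimal[OF _ ideal_vanishing_monoms], rule subsetI)
      fix p assume "p \<in> {f * g |f g. f \<in> monom_span (vanishing_monoms 1) \<and> g \<in> (monom_span (vanishing_monoms m) :: ('v, 'k) mpoly set)}"
      then obtain f g where p: "p = f * g" "f \<in> monom_span (vanishing_monoms 1)"
        "g \<in> (monom_span (vanishing_monoms m) :: ('v, 'k) mpoly set)" by blast
      have "u \<in> vanishing_monoms (Suc m)" if u: "u \<in> keys p" for u
      proof -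
        obtain a b where "u = a + b" "a \<in> keys f" "b \<in> keys g" using u keys_mult[of f g] unfolding p(1) by blast
        then show ?thesis using p(2,3) vanishing_monoms_add[of a 1 b m] by (auto simp: monom_span_def)
      qed
      then show "p \<in> ?M" by (auto simp: monom_span_def)
    qed
    show "?M \<subseteq> ?P"
    proof (rule monom_span_subset_ideal)
      show "mpoly_id.subspace ?P" unfolding ideal_prod_def by (rule mpoly_id.subspace_span)
      fix u :: "'v \<Rightarrow>\<^sub>0 nat" assume u: "u \<in> vanishing_monoms (Suc m)"
      then have "lookup u first_var \<noteq> mdeg u" by (simp add: vanishing_monoms_def)
      then have "u \<noteq> single first_var (lookup u first_var)" by (metis mdeg_single)
      then obtain v where v: "v \<noteq> first_var" "lookup u v \<noteq> 0"
        by (metis lookup_single_eq lookup_single_not_eq poly_mapping_eqI)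
      define w where "w = u - single v 1"
      have uw: "u = single v 1 + w"
        using v(2) by (intro poly_mapping_eqI) (auto simp: w_def lookup_add lookup_minus lookup_single when_def)
      have "single v 1 \<in> vanishing_monoms 1" using v(1) by (simp add: vanishing_monoms_def lookup_single when_def)
      moreover have "w \<in> vanishing_monoms m"
        using u v(1) by (simp add: uw vanishing_monoms_def mdeg_add lookup_add lookup_single when_def)
      ultimately have "single (single v 1) (1::'k) \<in> monom_span (vanishing_monoms 1)"
        "single w (1::'k) \<in> monom_span (vanishing_monoms m)" by (simp_all add: monom_span_def)
      then have "single (single v 1) 1 * single w (1::'k) \<in> ?P"
        unfolding ideal_prod_def by (intro mpoly_id.span_base) blast
      then show "single u (1::'k) \<in> ?P" by (simp add: mult_single uw)
    qed
  qed
  then show ?case using Suc.IH by (simp add: point_ideal_first_point)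
qed

section \<open>Moving the general point\<close>

lemma lin_change_image_ideal_span:
  assumes "invertible g"
  shows "lin_change g ` mpoly_id.span S = mpoly_id.span (lin_change g ` S)"
proof
  obtain h where h: "invertible h" "\<And>p. lin_change g (lin_change h p) = p" "\<And>p. lin_change h (lin_change g p) = p"
    using lin_change_inverse[OF assms] by metis
  have sub: "lin_change g ` mpoly_id.span S \<subseteq> mpoly_id.span (lin_change g ` S)"
    if "\<And>p. lin_change h (lin_change g p) = p" for g h :: "'a ^ 'b ^ 'b" and S
  proof
    fix p assume "p \<in> lin_change g ` mpoly_id.span S"
    then obtain f where f: "f \<in> mpoly_id.span S" "p = lin_change g f" by blast
    have "lin_change g f \<in> mpoly_id.span (lin_change g ` S)"
      using f(1)
    proof (induction rule: mpoly_id.span_induct_alt)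
      case base
      show ?case by (simp add: lin_change_simps mpoly_id.span_zero)
    next
      case (step c x y)
      then show ?case
        by (simp add: lin_change_simps mpoly_id.span_add mpoly_id.span_scale mpoly_id.span_base)
    qed
    then show "p \<in> mpoly_id.span (lin_change g ` S)" using f(2) by simp
  qed
  show "lin_change g ` mpoly_id.span S \<subseteq> mpoly_id.span (lin_change g ` S)"
    using h(3) by (rule sub)
  have "lin_change h ` mpoly_id.span (lin_change g ` S) \<subseteq> mpoly_id.span (lin_change h ` lin_change g ` S)"
    using h(2) by (rule sub)
  also have "lin_change h ` lin_change g ` S = S" using h(3) by (simp add: image_image)
  finally have "lin_change g ` lin_change h ` mpoly_id.span (lin_change g ` S) \<subseteq> lin_change g ` mpoly_id.span S"
    by (rule image_mono)
  then show "mpoly_id.span (lin_change g ` S) \<subseteq> lin_change g ` mpoly_id.span S"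
    using h(2) by (simp add: image_image)
qed

text \<open>The linear change by \<open>g\<close> moves the point given by the first row of \<open>g\<close> to \<open>(1 : 0 : \<dots> : 0)\<close>.\<close>

lemma eval_lin_change_first_point:
  "mpoly_eval (($) first_point) (lin_change g f) = mpoly_eval (($) (g $ first_var)) f"
proof -
  have "mpoly_eval (($) first_point) (lin_forms g j) = g $ first_var $ j" for j
  proof -
    have "mpoly_eval (($) first_point) (lin_forms g j) = (\<Sum>i\<in>UNIV. if i = first_var then g $ i $ j else 0)"
      unfolding lin_forms_def mpoly_eval_sum by (intro sum.cong) (simp_all add: mpoly_eval_simps first_point_nth)
    then show ?thesis by simp
  qed
  then show ?thesis by (simp add: lin_change_eq mpoly_eval_subst)
qed

lemma lin_change_point_ideal:
  assumes "invertible g"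
  shows "lin_change g ` point_ideal (g $ first_var) = point_ideal first_point"
proof -
  obtain h where h: "\<And>p. lin_change g (lin_change h p) = p" using lin_change_inverse[OF assms] by metis
  have "lin_change g ` {f. (\<exists>t. f \<in> forms t) \<and> mpoly_eval (($) (g $ first_var)) f = 0} =
      {f. (\<exists>t. f \<in> forms t) \<and> mpoly_eval (($) first_point) f = 0}" (is "_ ` ?A = ?B")
  proof
    show "lin_change g ` ?A \<subseteq> ?B"
      using lin_change_forms by (auto simp: eval_lin_change_first_point)
    show "?B \<subseteq> lin_change g ` ?A"
    proof
      fix f assume f: "f \<in> ?B"
      then have "\<exists>t. lin_change h f \<in> forms t" using lin_change_forms by blast
      moreover have "mpoly_eval (($) (g $ first_var)) (lin_change h f) = 0"
        using f h eval_lin_change_first_point[of g "lin_change h f"] by simp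
      ultimately show "f \<in> lin_change g ` ?A" using h[of f] by (intro image_eqI[of _ _ "lin_change h f"]) auto
    qed
  qed
  then show ?thesis unfolding point_ideal_def lin_change_image_ideal_span[OF assms] by simp
qed

lemma lin_change_ideal_power:
  assumes "invertible g"
  shows "lin_change g ` ideal_power I m = ideal_power (lin_change g ` I) m"
proof (induction m)
  case 0
  have "surj (lin_change g)" using lin_change_inverse[OF assms] by (metis surjI)
  then show ?case by simp
next
  case (Suc m)
  have "lin_change g ` {f * h |f h. f \<in> I \<and> h \<in> ideal_power I m} =
      {f * h |f h. f \<in> lin_change g ` I \<and> h \<in> lin_change g ` ideal_power I m}"
    (is "?A = ?B")
  proof
    show "?A \<subseteq> ?B"
    proof
      fix p assume "p \<in> ?A"
      then obtain f h where "f \<in> I" "h \<in> ideal_power I m" "p = lin_change g f * lin_change g h"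
        by (auto simp: lin_change_simps)
      then show "p \<in> ?B" by blast
    qed
    show "?B \<subseteq> ?A"
    proof
      fix p assume "p \<in> ?B"
      then obtain f h where "f \<in> I" "h \<in> ideal_power I m" "p = lin_change g (f * h)"
        by (auto simp: lin_change_simps(3)[symmetric])
      then show "p \<in> ?A" by blast
    qed
  qed
  then show ?case by (simp add: ideal_prod_def lin_change_image_ideal_span[OF assms] Suc.IH)
qed

lemma eval_scale_form:
  fixes f :: "('v::finite, 'k::field) mpoly"
  assumes "f \<in> forms t"
  shows "mpoly_eval (($) (c *s a)) f = c ^ t * mpoly_eval (($) a) f"
  unfolding mpoly_eval_def sum_distrib_left
proof (rule sum.cong[OF refl])
  fix m assume "m \<in> keys f"
  then have "mdeg m = t" using assms by (simp add: forms_def)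
  then have "(\<Prod>v\<in>keys m. (c *s a) $ v ^ lookup m v) = c ^ t * (\<Prod>v\<in>keys m. a $ v ^ lookup m v)"
    by (simp add: power_mult_distrib prod.distrib mdeg_def flip: power_sum)
  then show "lookup f m * (\<Prod>v\<in>keys m. (c *s a) $ v ^ lookup m v) =
      c ^ t * (lookup f m * (\<Prod>v\<in>keys m. a $ v ^ lookup m v))" by simp
qed

lemma point_ideal_scale:
  assumes "c \<noteq> 0" shows "point_ideal (c *s a) = point_ideal a"
proof -
  have "{f. (\<exists>t. f \<in> forms t) \<and> mpoly_eval (($) (c *s a)) f = 0} = {f. (\<exists>t. f \<in> forms t) \<and> mpoly_eval (($) a) f = 0}"
    using assms eval_scale_form by fastforce
  then show ?thesis by (simp add: point_ideal_def)
qed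

lemma lex_first_var_mono:
  fixes u w :: "'v::{finite,linorder} \<Rightarrow>\<^sub>0 nat"
  assumes "w \<le> u" shows "lookup w first_var \<le> lookup u first_var"
proof (cases "w = u")
  case False
  then have "w < u" using assms by simp
  then obtain k where k: "lookup w k < lookup u k" "\<And>l. l < k \<Longrightarrow> lookup w l = lookup u l"
    by (auto simp: less_poly_mapping.rep_eq less_fun_def)
  show ?thesis
  proof (cases "k = first_var")
    case True
    then show ?thesis using k(1) by simp
  next
    case False
    then have "first_var < k" by (metis Min_le UNIV_I finite_code le_neq_trans)
    then show ?thesis using k(2) by simp
  qed
qed simp

text \<open>The leading monomial of a form has the largest \<open>x\<^sub>0\<close>-degree of all its monomials.  So the form
  vanishes to order \<open>m\<close> as soon as its leading monomial does.\<close>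

lemma leads_Int_vanishing:
  fixes I :: "('v::{finite,linorder}, 'k::field) mpoly set"
  assumes "hom_ideal I"
  shows "leads (I \<inter> monom_span (vanishing_monoms m) \<inter> forms t) =
    {u \<in> leads I. mdeg u = t \<and> u \<in> vanishing_monoms m}" (is "leads ?V = ?L")
proof
  show "leads ?V \<subseteq> ?L"
  proof
    fix u assume "u \<in> leads ?V"
    then obtain f where f: "f \<in> ?V" "f \<noteq> 0" "u = lead f" by (auto simp: leads_def)
    then have "u \<in> keys f" using lead_in_keys by blast
    with f show "u \<in> ?L" by (auto simp: leads_def monom_span_def forms_def)
  qed
  show "?L \<subseteq> leads ?V"
  proof
    fix u assume u: "u \<in> ?L"
    then have "u \<in> leads (I \<inter> forms t)" using leads_Int_forms[OF assms] by blast
    then obtain f where f: "f \<in> I" "f \<in> forms t" "f \<noteq> 0" "u = lead f" by (auto simp: leads_def)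
    have "w \<in> vanishing_monoms m" if "w \<in> keys f" for w
    proof -
      have "mdeg w = mdeg u" using f(2) u that by (auto simp: forms_def)
      moreover have "lookup w first_var \<le> lookup u first_var"
        using lead_ge[OF that] f(4) by (intro lex_first_var_mono) simp
      ultimately show ?thesis using u by (simp add: vanishing_monoms_def)
    qed
    then have "f \<in> ?V" using f by (auto simp: monom_span_def)
    then show "u \<in> leads ?V" using f by (auto simp: leads_def)
  qed
qed

lemma dim_Int_point_ideal_power:
  fixes I :: "('v::{finite,linorder}, 'k::field) mpoly set" and g :: "(('k, 'v) vec, 'v) vec"
  assumes "hom_ideal I" "invertible g" "leads (lin_change g ` I) = L"
  shows "mpoly_vs.dim (I \<inter> ideal_power (point_ideal (g $ first_var)) m \<inter> forms t) =
    card {u \<in> L. mdeg u = t \<and> u \<in> vanishing_monoms m}"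
proof -
  let ?P = "ideal_power (point_ideal (g $ first_var)) m"
  have idl: "hom_ideal (lin_change g ` I)" using assms(1,2) by (rule hom_ideal_lin_change)
  have inj: "inj (lin_change g)" by (rule inj_lin_change[OF assms(2)])
  have "lin_change g ` (I \<inter> ?P \<inter> forms t) = lin_change g ` (I \<inter> ?P) \<inter> forms t"
    by (rule lin_change_image_Int_forms[OF assms(2), symmetric])
  also have "\<dots> = lin_change g ` I \<inter> lin_change g ` ?P \<inter> forms t"
    unfolding image_Int[OF inj] ..
  also have "lin_change g ` ?P = monom_span (vanishing_monoms m)"
    unfolding lin_change_ideal_power[OF assms(2)] lin_change_point_ideal[OF assms(2)]
    by (rule ideal_power_first_point)
  finally have img: "lin_change g ` (I \<inter> ?P \<inter> forms t) =
      lin_change g ` I \<inter> monom_span (vanishing_monoms m) \<inter> forms t" (is "_ = ?W") .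
  have "mpoly_vs.subspace (lin_change g ` I \<inter> monom_span (vanishing_monoms m))"
    using idl by (intro mpoly_vs.subspace_inter ideal_imp_subspace subspace_monom_span) (simp add: hom_ideal_def)
  then have "mpoly_vs.dim ?W = card (leads ?W)"
    by (intro dim_eq_card_leads[OF finite_mdeg[of t] forms_subset_keys] mpoly_vs.subspace_inter[OF _ subspace_forms])
  then show ?thesis
    using dim_lin_change_image[OF assms(2), of "I \<inter> ?P \<inter> forms t"] leads_Int_vanishing[OF idl, of m t] assms(3) img by simp
qed

section \<open>The dimension for a general point\<close>

lemma proj_open_Int_nonempty:
  fixes U V :: "('k::field ^ 'v::finite) set"
  assumes "infinite (UNIV :: 'k set)" "proj_open U" "U \<noteq> {}" "proj_open V" "V \<noteq> {}"
  shows "U \<inter> V \<noteq> {}"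
proof -
  have *: "\<exists>F a. mpoly_eval (($) a) F \<noteq> 0 \<and> a \<noteq> 0 \<and> (\<forall>a. a \<noteq> 0 \<and> mpoly_eval (($) a) F \<noteq> 0 \<longrightarrow> a \<in> W)"
    if W: "proj_open W" "W \<noteq> {}" for W :: "('k ^ 'v) set"
  proof -
    obtain S where S: "W = {a. a \<noteq> 0 \<and> (\<exists>F\<in>S. mpoly_eval (($) a) F \<noteq> 0)}"
      using W(1) unfolding proj_open_def by (elim exE conjE) (rule that)
    then obtain a F where "a \<noteq> 0" "F \<in> S" "mpoly_eval (($) a) F \<noteq> 0"
      using W(2) by blast
    then show ?thesis using S by (intro exI[of _ F] exI[of _ a]) auto
  qed
  obtain F a where F: "mpoly_eval (($) a) F \<noteq> 0" "a \<noteq> 0" "\<And>a. a \<noteq> 0 \<Longrightarrow> mpoly_eval (($) a) F \<noteq> 0 \<Longrightarrow> a \<in> U"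
    using *[OF assms(2,3)] by metis
  obtain G b where G: "mpoly_eval (($) b) G \<noteq> 0" "\<And>a. a \<noteq> 0 \<Longrightarrow> mpoly_eval (($) a) G \<noteq> 0 \<Longrightarrow> a \<in> V"
    using *[OF assms(4,5)] by metis
  obtain v where v: "a $ v \<noteq> 0" using F(2) by (metis vec_eq_iff zero_index)
  define l where "l s = (\<chi> i. a $ i + s * (b $ i - a $ i))" for s :: 'k
  have l: "l 0 = a" "l 1 = b" by (simp_all add: l_def vec_eq_iff)
  have entry: "(\<lambda>s. l s $ i) \<in> univariate_functions" for i
    by (simp add: l_def affine_univariate)
  have comp: "(\<lambda>s. mpoly_eval (($) (l s)) E) \<in> univariate_functions" for E
    by (rule poly_functions_comp[OF function_ring_univariate, of "($)" l "\<lambda>a. mpoly_eval (($) a) E"])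
      (use entry in \<open>auto simp: poly_functions_def\<close>)
  obtain s where "mpoly_eval (($) (l s)) F \<noteq> 0" "mpoly_eval (($) (l s)) G \<noteq> 0" "l s $ v \<noteq> 0"
    by (rule univariate_common_nonzero[OF assms(1) comp[of F] _ comp[of G] _ entry[of v], of 0 1 0])
      (use l F G v in simp_all)
  moreover from this have "l s \<noteq> 0" by auto
  ultimately show ?thesis using F(3) G(2) by blast
qed

lemma adim_eq:
  assumes "infinite (UNIV :: 'k::field set)" "proj_open U" "U \<noteq> {}"
    and "\<And>a. a \<in> U \<Longrightarrow> mpoly_vs.dim (subscheme_ideal X \<inter> ideal_power (point_ideal a) m \<inter> forms t) = d"
  shows "adim (X :: 'v::finite \<Rightarrow> ('v, 'k) mpoly set) t m = d"
  unfolding adim_def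
proof (rule the_equality)
  show "\<exists>U. proj_open U \<and> U \<noteq> {} \<and> (\<forall>a\<in>U. mpoly_vs.dim (subscheme_ideal X \<inter> ideal_power (point_ideal a) m \<inter> forms t) = d)"
    using assms(2-4) by (intro exI[of _ U]) blast
next
  fix e assume "\<exists>U. proj_open U \<and> U \<noteq> {} \<and> (\<forall>a\<in>U. mpoly_vs.dim (subscheme_ideal X \<inter> ideal_power (point_ideal a) m \<inter> forms t) = e)"
  then obtain V where V: "proj_open V" "V \<noteq> {}"
    "\<forall>a\<in>V. mpoly_vs.dim (subscheme_ideal X \<inter> ideal_power (point_ideal a) m \<inter> forms t) = e" by blast
  obtain a where "a \<in> U" "a \<in> V"
    using proj_open_Int_nonempty[OF assms(1-3) V(1,2)] by blast
  then show "e = d" using V(3) assms(4) by metis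
qed

text \<open>A general point is, up to scaling, the \<open>r\<close>-th row of a general matrix: keep the other rows of
  one good matrix \<open>g0\<close> fixed.  The condition on the row need not be homogeneous; but if some
  homogeneous component of it is nonzero at \<open>a\<close>, then it is itself nonzero at some nonzero multiple
  of \<open>a\<close>, because \<open>K\<close> is infinite.\<close>

lemma generic_rows:
  fixes F :: "'k::field ^ 'v::finite ^ 'v \<Rightarrow> 'k"
  assumes "infinite (UNIV :: 'k set)" "F \<in> matrix_functions" "\<exists>g. invertible g \<and> F g \<noteq> 0"
  obtains U where "proj_open U" "U \<noteq> {}"
    "\<And>a. a \<in> U \<Longrightarrow> \<exists>c g. c \<noteq> 0 \<and> invertible g \<and> F g \<noteq> 0 \<and> g $ r = c *s a"
proof -
  obtain g0 where g0: "invertible g0" "F g0 \<noteq> 0" using assms(3) by blast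
  define M where "M a = (\<chi> i. if i = r then a else g0 $ i)" for a :: "'k ^ 'v"
  have M_row: "M a $ r = a" for a by (simp add: M_def)
  have M_g0: "M (g0 $ r) = g0" by (simp add: M_def vec_eq_iff)
  define R where "R = poly_functions (($) :: 'k ^ 'v \<Rightarrow> 'v \<Rightarrow> 'k)"
  have R: "function_ring R" unfolding R_def by (rule function_ring_poly_functions)
  interpret function_ring R by (rule R)
  have entry: "(\<lambda>a. M a $ i $ j) \<in> R" for i j
    using coordinate_poly_function[of "($) :: 'k ^ 'v \<Rightarrow> 'v \<Rightarrow> 'k" j] const_mem[of "g0 $ i $ j"]
    by (cases "i = r") (simp_all add: M_def R_def)
  have "(\<lambda>a. F (M a)) \<in> R"
    by (rule poly_functions_comp[OF R _ assms(2)[unfolded matrix_functions_def]])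
      (auto intro: entry split: prod.splits)
  then have "(\<lambda>a. F (M a) * det (M a)) \<in> R" using det_mem[of M, OF entry] by (rule mult_mem)
  then obtain P where P: "\<And>a. F (M a) * det (M a) = mpoly_eval (($) a) P"
    unfolding R_def poly_functions_def by (auto dest: fun_cong)
  let ?S = "range (\<lambda>t. hpart t P)"
  let ?U = "{a. a \<noteq> 0 \<and> (\<exists>F\<in>?S. mpoly_eval (($) a) F \<noteq> 0)}"
  have eval_sum: "mpoly_eval (($) a) P = (\<Sum>t\<in>mdeg ` keys P. mpoly_eval (($) a) (hpart t P))" for a :: "'k ^ 'v"
    by (subst sum_hpart[of P, symmetric]) (rule mpoly_eval_sum)
  show ?thesis
  proof (rule that[of ?U])
    show "proj_open ?U"
      unfolding proj_open_def using hpart_forms by (intro exI[of _ ?S]) blast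
    have "mpoly_eval (($) (g0 $ r)) P \<noteq> 0"
      using P[of "g0 $ r", symmetric] g0 by (simp add: M_g0 invertible_det_nz)
    then obtain t where "mpoly_eval (($) (g0 $ r)) (hpart t P) \<noteq> 0"
      unfolding eval_sum by (meson sum.neutral)
    moreover have "g0 $ r \<noteq> 0"
      using g0(1) det_zero_row(2)[of r g0] by (auto simp: invertible_det_nz row_def vec_eq_iff)
    ultimately show "?U \<noteq> {}" by blast
  next
    fix a assume "a \<in> ?U"
    then obtain t where t: "mpoly_eval (($) a) (hpart t P) \<noteq> 0" by blast
    \<comment> \<open>the restriction of \<open>P\<close> to the line of multiples of \<open>a\<close>\<close>
    define q where "q = (\<Sum>s\<in>mdeg ` keys P. monom (mpoly_eval (($) a) (hpart s P)) s)"
    have q: "mpoly_eval (($) (c *s a)) P = poly q c" for c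
      unfolding q_def eval_sum
      by (simp add: poly_sum poly_monom eval_scale_form[OF hpart_forms] mult.commute)
    have "t \<in> mdeg ` keys P"
    proof (rule ccontr)
      assume "t \<notin> mdeg ` keys P"
      then have "hpart t P = 0" by (intro poly_mapping_eqI) (auto simp: lookup_hpart in_keys_iff)
      then show False using t by (simp add: mpoly_eval_simps)
    qed
    then have "coeff q t = mpoly_eval (($) a) (hpart t P)"
      by (simp add: q_def coeff_sum sum.delta)
    then have "q \<noteq> 0" using t by auto
    then have "finite ({c. poly q c = 0} \<union> {0})" using poly_roots_finite by blast
    from ex_new_if_finite[OF assms(1) this] obtain c where "c \<notin> {c. poly q c = 0} \<union> {0}" ..
    then have c: "c \<noteq> 0" "poly q c \<noteq> 0" by simp_all
    then have "F (M (c *s a)) * det (M (c *s a)) \<noteq> 0" using P q by simp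
    then show "\<exists>c g. c \<noteq> 0 \<and> invertible g \<and> F g \<noteq> 0 \<and> g $ r = c *s a"
      using c(1) M_row by (intro exI[of _ c] exI[of _ "M (c *s a)"]) (simp add: invertible_det_nz)
  qed
qed

theorem adim_eq_card:
  fixes X :: "'v::{finite,linorder} \<Rightarrow> ('v, 'k::field) mpoly set"
  assumes "infinite (UNIV :: 'k set)" "F \<in> matrix_functions" "\<exists>g. invertible g \<and> F g \<noteq> 0"
    and L: "\<And>g. invertible g \<Longrightarrow> F g \<noteq> 0 \<Longrightarrow> leads (lin_change g ` subscheme_ideal X) = L"
  shows "adim X t m = card {u \<in> L. mdeg u = t \<and> u \<in> vanishing_monoms m}"
proof -
  obtain U where U: "proj_open U" "U \<noteq> {}"
    "\<And>a. a \<in> U \<Longrightarrow> \<exists>c g. c \<noteq> 0 \<and> invertible g \<and> F g \<noteq> 0 \<and> g $ first_var = c *s a"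
    using generic_rows[OF assms(1-3), of first_var] by metis
  show ?thesis
  proof (rule adim_eq[OF assms(1) U(1,2)])
    fix a assume "a \<in> U"
    then obtain c g where "c \<noteq> 0" "invertible g" "F g \<noteq> 0" "g $ first_var = c *s a" using U(3) by metis
    then show "mpoly_vs.dim (subscheme_ideal X \<inter> ideal_power (point_ideal a) m \<inter> forms t) =
        card {u \<in> L. mdeg u = t \<and> u \<in> vanishing_monoms m}"
      using dim_Int_point_ideal_power[OF hom_ideal_subscheme_ideal _ L, of g m t] by (simp add: point_ideal_scale)
  qed
qed

section \<open>Counting monomials\<close>

lemma card_mdeg:
  "card {u :: 'v::finite \<Rightarrow>\<^sub>0 nat. mdeg u = d} = (d + CARD('v) - 1) choose (CARD('v) - 1)"
proof -
  let ?U = "{u :: 'v \<Rightarrow>\<^sub>0 nat. mdeg u = d}"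
  let ?L = "{l :: nat list. length l = CARD('v) \<and> sum_list l = d}"
  obtain xs where xs: "set xs = (UNIV :: 'v set)" "distinct xs"
    using finite_distinct_list[OF finite, of "UNIV :: 'v set"] by blast
  have len: "length xs = CARD('v)" using xs distinct_card by metis
  have sum: "sum_list (map f xs) = sum f UNIV" for f :: "'v \<Rightarrow> nat"
    using xs sum_list_distinct_conv_sum_set[of xs f] by simp
  have "bij_betw (\<lambda>u. map (lookup u) xs) ?U ?L"
    unfolding bij_betw_def
  proof
    show "inj_on (\<lambda>u. map (lookup u) xs) ?U"
      using xs(1) by (intro inj_onI poly_mapping_eqI) (metis UNIV_I map_eq_conv)
    show "(\<lambda>u. map (lookup u) xs) ` ?U = ?L"
    proof
      show "(\<lambda>u. map (lookup u) xs) ` ?U \<subseteq> ?L" by (auto simp: len sum mdeg_eq)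
      show "?L \<subseteq> (\<lambda>u. map (lookup u) xs) ` ?U"
      proof
        fix l assume l: "l \<in> ?L"
        define u :: "'v \<Rightarrow>\<^sub>0 nat" where "u = Abs_poly_mapping (\<lambda>v. the (map_of (zip xs l) v))"
        have u: "lookup u v = the (map_of (zip xs l) v)" for v by (simp add: u_def)
        have map: "map (lookup u) xs = l"
          using l xs(2) len by (intro nth_equalityI) (simp_all add: u map_of_zip_nth)
        then have "mdeg u = d" using l sum[of "lookup u"] by (simp add: mdeg_eq)
        then show "l \<in> (\<lambda>u. map (lookup u) xs) ` ?U" using map by blast
      qed
    qed
  qed
  then have "card ?U = card ?L" by (rule bij_betw_same_card)
  also have "\<dots> = (d + CARD('v) - 1) choose d" by (rule card_length_sum_list)
  also have "\<dots> = (d + CARD('v) - 1) choose (CARD('v) - 1)"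
  proof -
    have "1 \<le> CARD('v)" by (simp add: Suc_leI)
    then show ?thesis by (subst binomial_symmetric) simp_all
  qed
  finally show ?thesis .
qed

theorem O_sequence_standard_monomials:
  fixes L :: "('v::{finite,linorder} \<Rightarrow>\<^sub>0 nat) set"
  assumes up: "\<And>u w. u \<in> L \<Longrightarrow> w + u \<in> L"
  shows "O_sequence (\<lambda>d. int (card {u. mdeg u = d \<and> u \<notin> L}))"
proof (cases "0 \<in> L")
  case True
  then have "u \<in> L" for u using up[of 0 u] by simp
  then show ?thesis by (simp add: O_sequence_def)
next
  case False
  let ?H = "\<lambda>d. {u. mdeg u = d \<and> u \<notin> L}"
  have inj: "inj_on lookup A" for A :: "('v \<Rightarrow>\<^sub>0 nat) set"
    by (rule inj_onI) (rule poly_mapping_eqI, simp)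
  have "u = 0" if "mdeg u = 0" for u :: "'v \<Rightarrow>\<^sub>0 nat"
    using that lookup_le_mdeg[of u] by (intro poly_mapping_eqI) simp
  then have "?H 0 = {0}" using False by auto
  moreover have "card (?H (Suc d)) \<le> macaulay_upper (card (?H d)) d" if "1 \<le> d" for d
  proof -
    have fin: "finite (?H d)" using finite_mdeg[of d] by (rule finite_subset[rotated]) auto
    have "lookup ` ?H (Suc d) \<subseteq> exps UNIV (Suc d)" by (auto simp: exps_def mdeg_eq)
    from macaulay_bound[OF that this]
    have "card (?H (Suc d)) \<le> macaulay_fun d (card (shadow (lookup ` ?H (Suc d))))"
      by (simp add: card_image[OF inj])
    also have "shadow (lookup ` ?H (Suc d)) \<subseteq> lookup ` ?H d"
    proof
      fix w assume "w \<in> shadow (lookup ` ?H (Suc d))"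
      then obtain v u where u: "w(v := Suc (w v)) = lookup u" "mdeg u = Suc d" "u \<notin> L"
        by (auto simp: shadow_def)
      define m :: "'v \<Rightarrow>\<^sub>0 nat" where "m = Abs_poly_mapping w"
      have m: "lookup m = w" by (simp add: m_def)
      have um: "u = single v 1 + m"
        by (rule poly_mapping_eqI) (simp add: u(1)[symmetric] m lookup_add lookup_single when_def)
      then have "mdeg m = d" "m \<notin> L" using u(2,3) up[of m "single v 1"] by (auto simp: mdeg_add)
      then show "w \<in> lookup ` ?H d" using m by blast
    qed
    then have "macaulay_fun d (card (shadow (lookup ` ?H (Suc d)))) \<le> macaulay_fun d (card (?H d))"
      using fin card_mono[of "lookup ` ?H d"] by (intro macaulay_fun_mono) (simp add: card_image[OF inj])
    finally show ?thesis using that macaulay_upper_eq[of "card (?H d)" "d - 1"] by simp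
  qed
  ultimately show ?thesis by (simp add: O_sequence_def)
qed

theorem theorem3p4:
  fixes X :: "'v::{finite,linorder} \<Rightarrow> ('v, 'k::field) mpoly set" and j :: nat
  assumes "infinite (UNIV :: 'k set)"
    and "closed_subscheme X"
  defines "J \<equiv> ideal_colon (gin (subscheme_ideal X)) (mpoly_var (Min UNIV) ^ (j + 1))"
  shows "O_sequence (\<lambda>d. AV X j (d + 1)) \<and>
    (\<forall>d. AV X j (d + 1) = int (hilbert_fun J d))"
proof -
  let ?I = "subscheme_ideal X"
  let ?e = "single (first_var :: 'v) (j + 1)"
  obtain F L where FL: "F \<in> matrix_functions" "\<exists>g. invertible g \<and> F g \<noteq> 0"
    "\<And>g. invertible g \<Longrightarrow> F g \<noteq> 0 \<Longrightarrow> leads (lin_change g ` ?I) = L"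
    using generic_leads_ideal[OF hom_ideal_subscheme_ideal] by metis
  obtain g where g: "invertible g" "F g \<noteq> 0" using FL(2) by blast
  have idl: "hom_ideal (lin_change g ` ?I)"
    using hom_ideal_subscheme_ideal g(1) by (rule hom_ideal_lin_change)
  have up: "w + u \<in> L" if "u \<in> L" for u w
    using leads_single_mult[of "lin_change g ` ?I" u w] idl that FL(3)[OF g] by (simp add: hom_ideal_def)
  \<comment> \<open>the monomials of \<open>J\<close>\<close>
  define M where "M = {u. ?e + u \<in> L}"
  have gin: "gin ?I = monom_span L"
    by (rule gin_eq[OF assms(1) hom_ideal_subscheme_ideal FL(1,2)]) (rule FL(3))
  have adim: "adim X t m = card {u \<in> L. mdeg u = t \<and> u \<in> vanishing_monoms m}" for t m
    by (rule adim_eq_card[OF assms(1) FL(1,2)]) (rule FL(3))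
  have J: "J = monom_span M"
    unfolding J_def gin mpoly_var_power
      ideal_colon_monom_span M_def ..
  have AV: "AV X j (d + 1) = int (card {u. mdeg u = d \<and> u \<notin> M})" for d
  proof -
    let ?t = "d + 1 + j"
    let ?A = "{u \<in> L. mdeg u = ?t \<and> u \<in> vanishing_monoms (d + 1)}"
    let ?B = "{u \<in> L. mdeg u = ?t \<and> u \<notin> vanishing_monoms (d + 1)}"
    have fin: "finite ?A" "finite ?B"
      by (rule finite_subset[OF _ finite_mdeg[of ?t]], blast)+
    have dim_leads: "mpoly_vs.dim (lin_change g ` ?I \<inter> forms ?t) = card (leads (lin_change g ` ?I \<inter> forms ?t))"
      by (rule dim_eq_card_leads[OF finite_mdeg forms_subset_keys hom_ideal_Int_forms_subspace[OF idl]])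
    have "mpoly_vs.dim (?I \<inter> forms ?t) = mpoly_vs.dim (lin_change g ` ?I \<inter> forms ?t)"
      unfolding lin_change_image_Int_forms[OF g(1)] dim_lin_change_image[OF g(1)] ..
    also have "\<dots> = card {u \<in> L. mdeg u = ?t}"
      unfolding dim_leads leads_Int_forms[OF idl] FL(3)[OF g] ..
    also have "{u \<in> L. mdeg u = ?t} = ?A \<union> ?B" by blast
    also have "card (?A \<union> ?B) = card ?A + card ?B"
      using fin by (intro card_Un_disjoint) blast+
    finally have dim: "mpoly_vs.dim (?I \<inter> forms ?t) = card ?A + card ?B" .
    \<comment> \<open>in degree \<open>d + 1 + j\<close>, not vanishing to order \<open>d + 1\<close> means being divisible by \<open>x\<^sub>0\<^sup>j\<^sup>+\<^sup>1\<close>\<close>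
    have "bij_betw ((+) ?e) {u. mdeg u = d \<and> u \<in> M} ?B"
      unfolding bij_betw_def
    proof
      show "inj_on ((+) ?e) {u. mdeg u = d \<and> u \<in> M}" by simp
      show "(+) ?e ` {u. mdeg u = d \<and> u \<in> M} = ?B"
      proof
        show "(+) ?e ` {u. mdeg u = d \<and> u \<in> M} \<subseteq> ?B"
          by (auto simp: M_def mdeg_add vanishing_monoms_def lookup_add lookup_single)
        show "?B \<subseteq> (+) ?e ` {u. mdeg u = d \<and> u \<in> M}"
        proof
          fix u assume u: "u \<in> ?B"
          then have "j + 1 \<le> lookup u first_var" by (auto simp: vanishing_monoms_def)
          then have eq: "u = ?e + (u - ?e)"
            by (intro poly_mapping_eqI) (auto simp: lookup_add lookup_minus lookup_single when_def)
          have "?e + (u - ?e) \<in> L" using u unfolding eq[symmetric] by blast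
          moreover have "mdeg u = j + 1 + mdeg (u - ?e)"
            using arg_cong[OF eq, of mdeg] by (simp add: mdeg_add)
          ultimately have "u - ?e \<in> {u. mdeg u = d \<and> u \<in> M}" using u by (simp add: M_def)
          then show "u \<in> (+) ?e ` {u. mdeg u = d \<and> u \<in> M}" by (intro image_eqI[of u _ "u - ?e"] eq)
        qed
      qed
    qed
    then have B: "card ?B = card {u. mdeg u = d \<and> u \<in> M}" by (rule bij_betw_same_card[symmetric])
    have "{u :: 'v \<Rightarrow>\<^sub>0 nat. mdeg u = d} = {u. mdeg u = d \<and> u \<in> M} \<union> {u. mdeg u = d \<and> u \<notin> M}" by blast
    then have "card {u :: 'v \<Rightarrow>\<^sub>0 nat. mdeg u = d} =
        card ({u. mdeg u = d \<and> u \<in> M} \<union> {u. mdeg u = d \<and> u \<notin> M})" by (rule arg_cong)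
    also have "\<dots> = card {u. mdeg u = d \<and> u \<in> M} + card {u. mdeg u = d \<and> u \<notin> M}"
      by (intro card_Un_disjoint finite_subset[OF _ finite_mdeg[of d]]) blast+
    finally have "(d + CARD('v) - 1) choose (CARD('v) - 1) = card ?B + card {u. mdeg u = d \<and> u \<notin> M}"
      using card_mdeg[of d, where 'v = 'v] B by simp
    moreover have "d + 1 + (CARD('v) - 1) - 1 = d + CARD('v) - 1" by (simp add: Suc_leI)
    ultimately show ?thesis
      unfolding AV_def vdim_def proj_dim_def adim dim by simp
  qed
  have "w + u \<in> M" if "u \<in> M" for u w
    using up[of "?e + u" w] that by (simp add: M_def ac_simps)
  then have "O_sequence (\<lambda>d. int (card {u. mdeg u = d \<and> u \<notin> M}))"
    by (rule O_sequence_standard_monomials)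
  then show ?thesis by (simp only: AV J hilbert_fun_monom_span simp_thms)
qed

end
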